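(* Let $N\geq 1$, let $\Omega\subset\mathbb{R}^N$ be a bounded Lipschitz domain containing the origin, and let $\mu>-1$. For $l>0$ let $\Omega_l=l\,\Omega=\{lx:x\in\Omega\}$. Then: (i) there exists a critical value $$l_c:=\exp\Big(\frac{\lambda_1^{\ln,\mu}(\Omega)}{2(1+\mu)}\Big)>0$$ such that $$\lambda_1^{\ln,\mu}(\Omega_l)\begin{cases}>0, & 0<l<l_c,\\ =0, & l=l_c,\\ <0, & l>l_c;\end{cases}$$ (ii) the eigenvalue gaps are scaling-invariant, i.e. for every $k\in\mathbb{N}$, $$\lambda_{k+1}^{\ln,\mu}(\Omega_l)-\lambda_k^{\ln,\mu}(\Omega_l)=\lambda_{k+1}^{\ln,\mu}(\Omega)-\lambda_k^{\ln,\mu}(\Omega),\qquad\forall\, l>0.$$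
   Context: $C_c^\infty(\Omega)$ is the set of smooth real functions on $\mathbb{R}^N$ with compact support contained in $\Omega$; $\|u\|_2=(\int_\Omega u^2dx)^{1/2}$; $a_\pm=\max\{0,\pm a\}$; $B_r(x)$ is the open ball of radius $r$ centred at $x$; $\log=\ln$ is the natural logarithm; $|\Omega|$ is Lebesgue measure; $\Gamma$ is the Gamma function, $\psi=\Gamma'/\Gamma$ is the Digamma function, $\gamma=-\Gamma'(1)$; $\mathbb{N}=\{1,2,\dots\}$. Constants: $$c_N=\frac{\Gamma(\frac N2)}{\pi^{\frac N2}},\quad \rho_N=2\ln 2+\psi\Big(\frac N2\Big)-\gamma,\quad C_N=c_N\Big(\int_{\mathbb{R}^N\setminus B_1(0)} |y|^{-2N}\,dy\Big)^{\frac12},$$ $$d_{N,\Omega}= 2\psi\Big(\frac N4 \Big)-2\psi\Big(\frac N2 \Big) +1-\gamma-C_N |\Omega|^{\frac12}.$$ The logarithmic Laplacian (the operator with Fourier symbol $2\ln|\xi|$) is, for Hölder continuous compactly supported $u$, $$(-\Delta)^{\ln} u(x)=c_N\,\mathrm{p.v.}\int_{B_1(x)}\frac{u(x)-u(y)}{|x-y|^{N}}\,dy - c_N\int_{\mathbb{R}^N\setminus B_1(0)}\frac{u(x+y)}{|y|^N}\,dy+\rho_N\,u(x),$$ and the logarithmic Hardy operator is $\mathcal{L}_\mu u=(-\Delta)^{\ln}u+2\mu\big(\log\frac1{|x|}\big)u$. Inner products: $$\langle u,v\rangle_{\ln}=c_N\iint_{\{x,y\in\mathbb{R}^N:\,|x-y|<1\}}\frac{(u(x)-u(y))(v(x)-v(y))}{|x-y|^{N}}\,dx\,dy+\int_{\Omega}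 u(x)v(x)\,dx,$$ $$\langle u,v\rangle_{\ln,\mu} = \langle u,v\rangle_{\ln} +2\mu \int_{\Omega} \Big(\log\frac1{|x|} \Big)_+u(x) v(x)\,dx+ (d_{N,\Omega})_+ \int_{\Omega} u(x) v(x)\,dx,$$ with $\|u\|_{\ln,\mu}=\sqrt{\langle u,u\rangle_{\ln,\mu}}$. $\mathbb{H}_0^{\ln,\mu}(\Omega)$ is the closure (completion) of $C_c^\infty(\Omega)$ with respect to $\|\cdot\|_{\ln,\mu}$. The Dirichlet energy of $\mathcal{L}_\mu$ in $\Omega$ is the bilinear form $$\mathcal{E}_{\ln,\mu}(u,\varphi)=\int_{\Omega}u(x)(-\Delta)^{\ln}\varphi(x)\,dx+2\mu \int_{\Omega} \Big(\log\frac1{|x|}\Big) u(x)\varphi(x)\,dx,$$ understood for all $u,\varphi\in\mathbb{H}_0^{\ln,\mu}(\Omega)$ by density of $C_c^\infty(\Omega)$ and continuity. The Dirichlet eigenvalues $\lambda_1^{\ln,\mu}(\Omega)<\lambda_2^{\ln,\mu}(\Omega)\le\cdots$ of $\mathcal{L}_\mu$ in $\Omega$ are defined inductively by successive minimization: for $k\ge1$, $$\lambda_k^{\ln,\mu}(\Omega)=\min\Big\{\mathcal{E}_{\ln,\mu}(u,u): u\in\mathbb{H}_0^{\ln,\mu}(\Omega),\ \|u\|_2=1,\ \int_\Omega u\,\phi_j^{\ln,\mu}\,dx=0\text{ for }1\le j\le k-1\Big\},$$ and $\phi_k^{\ln,\mu}$ is a minimizer. These are eigenvalues with eigenfunctions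 $\phi_k^{\ln,\mu}$ in the weak sense $\mathcal{E}_{\ln,\mu}(\phi_k^{\ln,\mu},\varphi)=\lambda_k^{\ln,\mu}(\Omega)\int_\Omega\phi_k^{\ln,\mu}\varphi\,dx$ for all $\varphi\in\mathbb{H}_0^{\ln,\mu}(\Omega)$. The same definitions apply with $\Omega_l$ in place of $\Omega$. *)

theory Defs
  imports "HOL-Analysis.Analysis"
begin

text \<open>The ambient space \<open>\<real>\<^sup>N\<close> is \<^typ>\<open>real ^ 'n\<close> with \<open>N = CARD('n)\<close>.\<close>

section \<open>Lipschitz domains and test functions\<close>

text \<open>Near each boundary point, after a rotation turning the unit vector \<open>e\<close> into a coordinate
  direction, the set is the strict epigraph of a Lipschitz function \<open>g\<close> on the hyperplane
  orthogonal to \<open>e\<close>.\<close>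

definition lipschitz_domain :: "(real ^ 'n) set \<Rightarrow> bool" where
  "lipschitz_domain \<Omega> \<longleftrightarrow> open \<Omega> \<and> connected \<Omega> \<and> \<Omega> \<noteq> {} \<and>
     (\<forall>p \<in> frontier \<Omega>. \<exists>r > 0. \<exists>e C. \<exists>g :: real ^ 'n \<Rightarrow> real.
        norm e = 1 \<and> C-lipschitz_on {y. y \<bullet> e = 0} g \<and>
        \<Omega> \<inter> ball p r = {x \<in> ball p r. g (x - (x \<bullet> e) *\<^sub>R e) < x \<bullet> e})"

fun C_k :: "nat \<Rightarrow> (real ^ 'n \<Rightarrow> real) \<Rightarrow> bool" where
  "C_k 0 f \<longleftrightarrow> continuous_on UNIV f"
| "C_k (Suc k) f \<longleftrightarrow> (\<forall>x. f differentiable (at x)) \<and>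
     (\<forall>v. C_k k (\<lambda>x. frechet_derivative f (at x) v))"

definition test_functions :: "(real ^ 'n) set \<Rightarrow> (real ^ 'n \<Rightarrow> real) set" where
  "test_functions \<Omega> = {f. (\<forall>k. C_k k f) \<and>
     compact (closure {x. f x \<noteq> 0}) \<and> closure {x. f x \<noteq> 0} \<subseteq> \<Omega>}"

section \<open>Constants\<close>

definition c_const :: "nat \<Rightarrow> real" where
  "c_const N = Gamma (real N / 2) / pi powr (real N / 2)"

definition rho_const :: "nat \<Rightarrow> real" where
  "rho_const N = 2 * ln 2 + Digamma (real N / 2) - euler_mascheroni"

definition tail_const :: "'n::finite itself \<Rightarrow> real" where
  "tail_const _ = c_const CARD('n) *
     sqrt (LINT y:(- ball (0 :: real ^ 'n) 1)|lborel. 1 / norm y ^ (2 * CARD('n)))"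

definition d_const :: "(real ^ 'n) set \<Rightarrow> real" where
  "d_const \<Omega> = 2 * Digamma (real CARD('n) / 4) - 2 * Digamma (real CARD('n) / 2) + 1
     - euler_mascheroni - tail_const TYPE('n) * sqrt (measure lborel \<Omega>)"

section \<open>The logarithmic Laplacian\<close>

text \<open>The principal value is the limit over \<open>\<epsilon> \<rightarrow> 0+\<close> of the integrals on
  \<open>B\<^sub>1(x)\<close> with the closed ball of radius \<open>\<epsilon>\<close> removed.\<close>

definition log_laplacian :: "(real ^ 'n \<Rightarrow> real) \<Rightarrow> real ^ 'n \<Rightarrow> real" where
  "log_laplacian u x =
     c_const CARD('n) * Lim (at_right 0)
       (\<lambda>\<epsilon>. LINT y:(ball x 1 - cball x \<epsilon>)|lborel. (u x - u y) / norm (x - y) ^ CARD('n))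
     - c_const CARD('n) * (LINT y:(- ball 0 1)|lborel. u (x + y) / norm y ^ CARD('n))
     + rho_const CARD('n) * u x"

section \<open>The energy space\<close>

definition L2_inner :: "(real ^ 'n) set \<Rightarrow> (real ^ 'n \<Rightarrow> real) \<Rightarrow> (real ^ 'n \<Rightarrow> real) \<Rightarrow> real" where
  "L2_inner \<Omega> u v = (LINT x:\<Omega>|lborel. u x * v x)"

definition L2_norm_on :: "(real ^ 'n) set \<Rightarrow> (real ^ 'n \<Rightarrow> real) \<Rightarrow> real" where
  "L2_norm_on \<Omega> u = sqrt (LINT x:\<Omega>|lborel. (u x)\<^sup>2)"

text \<open>Square integrable functions on \<open>\<Omega>\<close>, extended by zero. These are functions rather than
  classes modulo null sets; everything below only depends on the class.\<close>

definition L2_space :: "(real ^ 'n) set \<Rightarrow> (real ^ 'n \<Rightarrow> real) set" where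
  "L2_space \<Omega> = {u \<in> borel_measurable lborel.
     (\<forall>x. x \<notin> \<Omega> \<longrightarrow> u x = 0) \<and> integrable lborel (\<lambda>x. (u x)\<^sup>2)}"

definition ln_inner ::
  "(real ^ 'n) set \<Rightarrow> (real ^ 'n \<Rightarrow> real) \<Rightarrow> (real ^ 'n \<Rightarrow> real) \<Rightarrow> real" where
  "ln_inner \<Omega> u v =
     c_const CARD('n) *
       (LINT p:{p. dist (fst p) (snd p) < 1}|(lborel \<Otimes>\<^sub>M lborel).
          (u (fst p) - u (snd p)) * (v (fst p) - v (snd p)) / norm (fst p - snd p) ^ CARD('n))
     + L2_inner \<Omega> u v"

definition ln_mu_inner ::
  "real \<Rightarrow> (real ^ 'n) set \<Rightarrow> (real ^ 'n \<Rightarrow> real) \<Rightarrow> (real ^ 'n \<Rightarrow> real) \<Rightarrow> real" where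
  "ln_mu_inner \<mu> \<Omega> u v = ln_inner \<Omega> u v
     + 2 * \<mu> * (LINT x:\<Omega>|lborel. max 0 (ln (1 / norm x)) * u x * v x)
     + max 0 (d_const \<Omega>) * L2_inner \<Omega> u v"

definition ln_mu_norm :: "real \<Rightarrow> (real ^ 'n) set \<Rightarrow> (real ^ 'n \<Rightarrow> real) \<Rightarrow> real" where
  "ln_mu_norm \<mu> \<Omega> u = sqrt (ln_mu_inner \<mu> \<Omega> u u)"

text \<open>The completion of the test functions is realised inside \<open>L\<^sup>2(\<Omega>)\<close> in the usual way: its
  elements are the \<open>L\<^sup>2\<close> limits of sequences of test functions that are Cauchy for
  \<^const>\<open>ln_mu_norm\<close>. The sequence \<open>U\<close> is then said to approximate its limit \<open>u\<close>.\<close>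

definition approximates ::
  "real \<Rightarrow> (real ^ 'n) set \<Rightarrow> (nat \<Rightarrow> real ^ 'n \<Rightarrow> real) \<Rightarrow> (real ^ 'n \<Rightarrow> real) \<Rightarrow> bool" where
  "approximates \<mu> \<Omega> U u \<longleftrightarrow> (\<forall>n. U n \<in> test_functions \<Omega>) \<and>
     (\<forall>e > 0. \<exists>M. \<forall>m \<ge> M. \<forall>n \<ge> M. ln_mu_norm \<mu> \<Omega> (\<lambda>x. U m x - U n x) < e) \<and>
     (\<lambda>n. L2_norm_on \<Omega> (\<lambda>x. U n x - u x)) \<longlonglongrightarrow> 0"

definition energy_space :: "real \<Rightarrow> (real ^ 'n) set \<Rightarrow> (real ^ 'n \<Rightarrow> real) set" where
  "energy_space \<mu> \<Omega> = {u \<in> L2_space \<Omega>. \<exists>U. approximates \<mu> \<Omega> U u}"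

section \<open>The Dirichlet energy\<close>

definition test_energy ::
  "real \<Rightarrow> (real ^ 'n) set \<Rightarrow> (real ^ 'n \<Rightarrow> real) \<Rightarrow> (real ^ 'n \<Rightarrow> real) \<Rightarrow> real" where
  "test_energy \<mu> \<Omega> u \<phi> = (LINT x:\<Omega>|lborel. u x * log_laplacian \<phi> x)
     + 2 * \<mu> * (LINT x:\<Omega>|lborel. ln (1 / norm x) * u x * \<phi> x)"

text \<open>Extension of \<^const>\<open>test_energy\<close> from the test functions to \<^const>\<open>energy_space\<close> by density
  and continuity.\<close>

definition dirichlet_energy ::
  "real \<Rightarrow> (real ^ 'n) set \<Rightarrow> (real ^ 'n \<Rightarrow> real) \<Rightarrow> (real ^ 'n \<Rightarrow> real) \<Rightarrow> real" where
  "dirichlet_energy \<mu> \<Omega> u \<phi> = (THE E. \<forall>U V.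
     approximates \<mu> \<Omega> U u \<longrightarrow> approximates \<mu> \<Omega> V \<phi> \<longrightarrow>
       (\<lambda>n. test_energy \<mu> \<Omega> (U n) (V n)) \<longlonglongrightarrow> E)"

section \<open>Dirichlet eigenvalues\<close>

text \<open>The index \<open>k\<close> starts at 1. \<open>eigenfunction \<mu> \<Omega> k\<close> is a chosen minimizer of the energy among
  the unit vectors orthogonal to the eigenfunctions chosen for \<open>1 \<le> j < k\<close>, and
  \<open>eigenvalue \<mu> \<Omega> k\<close> is the minimum.\<close>

definition admissible ::
  "real \<Rightarrow> (real ^ 'n) set \<Rightarrow> nat \<Rightarrow> (nat \<Rightarrow> real ^ 'n \<Rightarrow> real) \<Rightarrow> (real ^ 'n \<Rightarrow> real) set" where
  "admissible \<mu> \<Omega> k \<phi> = {u \<in> energy_space \<mu> \<Omega>. L2_norm_on \<Omega> u = 1 \<and>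
     (\<forall>j \<in> {1..<k}. L2_inner \<Omega> u (\<phi> j) = 0)}"

lemma admissible_cong [fundef_cong]:
  assumes "\<mu> = \<mu>'" "\<Omega> = \<Omega>'" "k = k'" "\<And>j. j \<in> {1..<k'} \<Longrightarrow> \<phi> j = \<phi>' j"
  shows "admissible \<mu> \<Omega> k \<phi> = admissible \<mu>' \<Omega>' k' \<phi>'"
  using assms by (simp add: admissible_def)

fun eigenfunction :: "real \<Rightarrow> (real ^ 'n) set \<Rightarrow> nat \<Rightarrow> real ^ 'n \<Rightarrow> real" where
  "eigenfunction \<mu> \<Omega> k =
     (ARG_MIN (\<lambda>u. dirichlet_energy \<mu> \<Omega> u u) u.
        u \<in> admissible \<mu> \<Omega> k (\<lambda>j. eigenfunction \<mu> \<Omega> j))"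

declare eigenfunction.simps [simp del]

definition eigenvalue :: "real \<Rightarrow> (real ^ 'n) set \<Rightarrow> nat \<Rightarrow> real" where
  "eigenvalue \<mu> \<Omega> k =
     (LEAST c. c \<in> (\<lambda>u. dirichlet_energy \<mu> \<Omega> u u) ` admissible \<mu> \<Omega> k (eigenfunction \<mu> \<Omega>))"

end

theory Submission
  imports Defs "HOL-Library.Function_Algebras" "HOL-Complex_Analysis.Great_Picard"
begin

text \<open>
  If \<open>u\<close> lives on \<open>\<Omega>\<close> and \<open>v x = l powr (- N / 2) * u (x / l)\<close>, then \<open>v\<close> has the same \<open>L\<^sup>2\<close> norm, and
  because the symbols \<open>2 ln \<bar>\<xi>\<bar>\<close> and \<open>2 \<mu> ln (1 / \<bar>x\<bar>)\<close> are logarithmic, the energy of \<open>v\<close> is the energy of \<open>u\<close>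
  minus \<open>2 (1 + \<mu>) ln l\<close>. Hence every eigenvalue is shifted by this amount, provided that the minima exist
  and do not depend on the choice of the minimizers.

  Existence: the energy is bounded below and controls the form \<open>A\<close> with kernel \<open>\<bar>x - y\<bar> powr (- N)\<close> on
  \<open>\<bar>x - y\<bar> < 1\<close>, since \<open>2 \<integral> ln\<^sup>+ (1 / \<bar>x\<bar>) u\<^sup>2 \<le> A u + C \<integral> u\<^sup>2\<close> holds with the sharp leading constant. A bound on
  \<open>A\<close> gives \<open>L\<^sup>2\<close> compactness: averaging over dyadic cells of \<open>J\<close> different scales approximates \<open>u\<close> with squared
  error \<open>O(A u / J)\<close>. By the parallelogram law a minimizing sequence that is \<open>L\<^sup>2\<close>-Cauchy is Cauchy for the energy.
  Independence of the choice: the span of the first \<open>k\<close> eigenfunctions of one choice contains a nonzero vector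
  orthogonal to the first \<open>k - 1\<close> eigenfunctions of another one.
\<close>

section \<open>Semi-inner products and closable forms\<close>

text \<open>The definitions select limits, eigenfunctions and eigenvalues by \<open>THE\<close>,
  \<open>ARG_MIN\<close> and \<open>LEAST\<close>, so no eigenvalue can be computed before existence
  and uniqueness are settled. Since the completion is realised inside L2, sequences with the same L2
  limit must also share the limit of their energies; this closability follows from Fatou's lemma,
  because the kernel of A is nonnegative. For negative \<mu> the logarithmic potential competes with
  A at the same order: A has weight \<open>c_const N / 2\<close> in the energy and
  \<open>c_const N\<close> times the area of the unit sphere is 2, so the Hardy inequality leaves a
  positive multiple of A exactly down to \<mu> > -1. The kernel is borderline: A controls no
  positive order of smoothness, but every dyadic scale takes a comparable share of it, so among J
  scales an average share is at most a multiple of A / J. The minimization theory is developed for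
  abstract forms; the domain and its dilation are two instances joined by an isomorphism, and the
  scaling law has to be computed on test functions only.\<close>

instantiation "fun" :: (type, scaleR) scaleR
begin
definition scaleR_fun_def: "c *\<^sub>R f = (\<lambda>x. c *\<^sub>R f x)"
instance ..
end

instance "fun" :: (type, real_vector) real_vector
  by standard (auto simp: scaleR_fun_def fun_eq_iff scaleR_add_right scaleR_add_left)

text \<open>Gaussian elimination: an unknown with nonzero coefficient in equation \<open>i\<close>
  is eliminated from the other equations, which removes one equation and one unknown. The lemma is
  the dimension count behind all later trial vectors that must be orthogonal to given ones.\<close>

lemma homogeneous_system_nontrivial_solution:
  fixes a :: "'i \<Rightarrow> 'j \<Rightarrow> real"
  assumes "finite K" "finite J" "card K < card J"
  shows "\<exists>c. (\<exists>j\<in>J. c j \<noteq> 0) \<and> (\<forall>i\<in>K. (\<Sum>j\<in>J. c j * a i j) = 0)"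
  using assms
proof (induction K arbitrary: a J rule: finite_induct)
  case empty
  then have "J \<noteq> {}" by auto
  then show ?case by (intro exI[of _ "\<lambda>_. 1"]) auto
next
  case (insert i K)
  show ?case
  proof (cases "\<forall>j\<in>J. a i j = 0")
    case True
    obtain c where "\<exists>j\<in>J. c j \<noteq> 0" "\<forall>i\<in>K. (\<Sum>j\<in>J. c j * a i j) = 0"
      using insert.IH[of J a] insert.prems insert.hyps by auto
    then show ?thesis using True by (intro exI[of _ c]) auto
  next
    case False
    then obtain p where p: "p \<in> J" "a i p \<noteq> 0" by auto
    let ?J = "J - {p}"
    obtain c where c: "\<exists>j\<in>?J. c j \<noteq> 0"
      "\<forall>i'\<in>K. (\<Sum>j\<in>?J. c j * (a i' j - a i' p * a i j / a i p)) = 0"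
      using insert.IH[of ?J "\<lambda>i' j. a i' j - a i' p * a i j / a i p"] insert.prems insert.hyps p
      by (auto simp: less_diff_conv)
    define s where "s = (\<Sum>j\<in>?J. c j * a i j)"
    \<comment> \<open>The value at the pivot \<open>p\<close> is the one forced by equation
      \<open>i\<close>; the reduced coefficients above already account for its contribution to the
      other equations.\<close>
    define d where "d = c(p := - s / a i p)"
    have sum_d: "(\<Sum>j\<in>J. d j * b j) = - s / a i p * b p + (\<Sum>j\<in>?J. c j * b j)" for b
    proof -
      have "(\<Sum>j\<in>J. d j * b j) = d p * b p + (\<Sum>j\<in>?J. d j * b j)"
        using p insert.prems by (simp add: sum.remove)
      moreover have "(\<Sum>j\<in>?J. d j * b j) = (\<Sum>j\<in>?J. c j * b j)"
        by (rule sum.cong) (auto simp: d_def)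
      ultimately show ?thesis by (simp add: d_def)
    qed
    have "\<exists>j\<in>J. d j \<noteq> 0" using c(1) by (auto simp: d_def)
    moreover have "(\<Sum>j\<in>J. d j * a i j) = 0"
      using p unfolding sum_d by (simp add: s_def)
    moreover have "(\<Sum>j\<in>J. d j * a i' j) = 0" if "i' \<in> K" for i'
    proof -
      have "(\<Sum>j\<in>?J. c j * a i' j) - a i' p / a i p * s = 0"
        using c(2)[rule_format, OF that]
        by (simp add: s_def sum_distrib_left sum_subtractf right_diff_distrib mult_ac)
      then show ?thesis unfolding sum_d by (simp add: field_simps)
    qed
    ultimately show ?thesis by (intro exI[of _ d]) auto
  qed
qed

text \<open>All laws are relative to \<open>V\<close>, because the concrete forms are integrals and
  behave bilinearly only where these converge. Symmetry makes linearity in one argument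
  enough.\<close>

locale sym_bilinear =
  fixes V :: "'v::real_vector set" and B :: "'v \<Rightarrow> 'v \<Rightarrow> real"
  assumes subspace: "subspace V"
    and sym: "\<And>u v. u \<in> V \<Longrightarrow> v \<in> V \<Longrightarrow> B u v = B v u"
    and add: "\<And>u v w. u \<in> V \<Longrightarrow> v \<in> V \<Longrightarrow> w \<in> V \<Longrightarrow> B (u + v) w = B u w + B v w"
    and scale: "\<And>c u w. u \<in> V \<Longrightarrow> w \<in> V \<Longrightarrow> B (c *\<^sub>R u) w = c * B u w"
begin

lemma mem [intro, simp]:
  "u \<in> V \<Longrightarrow> v \<in> V \<Longrightarrow> u + v \<in> V" "u \<in> V \<Longrightarrow> v \<in> V \<Longrightarrow> u - v \<in> V" "u \<in> V \<Longrightarrow> c *\<^sub>R u \<in> V"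
  using subspace by (auto simp: subspace_add subspace_diff subspace_scale)

lemma diff: "u \<in> V \<Longrightarrow> v \<in> V \<Longrightarrow> w \<in> V \<Longrightarrow> B (u - v) w = B u w - B v w"
  using add[of u "(-1) *\<^sub>R v" w] scale[of v w "-1"] mem(3)[of v "-1"] by simp

lemma add_right: "u \<in> V \<Longrightarrow> v \<in> V \<Longrightarrow> w \<in> V \<Longrightarrow> B w (u + v) = B w u + B w v"
  using add[of u v w] sym[of w u] sym[of w v] sym[of w "u + v"] by simp

lemma diff_right: "u \<in> V \<Longrightarrow> v \<in> V \<Longrightarrow> w \<in> V \<Longrightarrow> B w (u - v) = B w u - B w v"
  using diff[of u v w] sym[of w u] sym[of w v] sym[of w "u - v"] by simp

lemma scale_right: "u \<in> V \<Longrightarrow> w \<in> V \<Longrightarrow> B w (c *\<^sub>R u) = c * B w u"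
  using scale[of u w c] sym[of w u] sym[of w "c *\<^sub>R u"] by simp

lemmas expand = add diff scale add_right diff_right scale_right

lemma sum_mem: "(\<And>j. j \<in> J \<Longrightarrow> f j \<in> V) \<Longrightarrow> (\<Sum>j\<in>J. c j *\<^sub>R f j) \<in> V"
  using subspace by (intro subspace_sum) auto

lemma sum_left:
  assumes "finite J" "\<And>j. j \<in> J \<Longrightarrow> f j \<in> V" "w \<in> V"
  shows "B (\<Sum>j\<in>J. c j *\<^sub>R f j) w = (\<Sum>j\<in>J. c j * B (f j) w)"
  using assms
proof (induction J rule: finite_induct)
  case empty
  then show ?case using scale[of w w 0] by simp
next
  case (insert j J)
  then show ?case by (simp add: add scale sum_mem)
qed

lemma sum_orthogonal:
  assumes "finite J" "\<And>j. j \<in> J \<Longrightarrow> f j \<in> V"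
    and "\<And>i j. i \<in> J \<Longrightarrow> j \<in> J \<Longrightarrow> i \<noteq> j \<Longrightarrow> B (f i) (f j) = 0"
  shows "B (\<Sum>j\<in>J. c j *\<^sub>R f j) (\<Sum>j\<in>J. c j *\<^sub>R f j) = (\<Sum>j\<in>J. (c j)\<^sup>2 * B (f j) (f j))"
proof -
  let ?s = "\<Sum>j\<in>J. c j *\<^sub>R f j"
  have s: "?s \<in> V" using assms(2) by (rule sum_mem)
  have "B (f i) ?s = c i * B (f i) (f i)" if "i \<in> J" for i
  proof -
    have "B (f i) ?s = (\<Sum>j\<in>J. c j * B (f j) (f i))"
      using that s assms by (subst sym) (auto simp: sum_left)
    also have "\<dots> = (\<Sum>j\<in>J. if j = i then c i * B (f i) (f i) else 0)"
      using that assms(3) by (intro sum.cong) auto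
    finally show ?thesis using that assms(1) by simp
  qed
  then show ?thesis
    using assms s by (simp add: sum_left power2_eq_square mult.assoc cong: sum.cong)
qed

end

lemma sym_bilinear_subspace:
  "sym_bilinear V B \<Longrightarrow> subspace W \<Longrightarrow> W \<subseteq> V \<Longrightarrow> sym_bilinear W B"
  by (simp add: sym_bilinear_def subset_eq)

lemma sym_bilinear_add_scaled:
  "sym_bilinear V B \<Longrightarrow> sym_bilinear V D \<Longrightarrow> sym_bilinear V (\<lambda>u v. B u v + c * D u v)"
  unfolding sym_bilinear_def by (auto simp: algebra_simps)

text \<open>Stated for the quadratic form without absolute value or root, since it is also applied
  to energies that may be negative. It becomes a genuine Cauchy condition once a lower bound is
  available.\<close>

definition form_Cauchy :: "('v::real_vector \<Rightarrow> 'v \<Rightarrow> real) \<Rightarrow> (nat \<Rightarrow> 'v) \<Rightarrow> bool" where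
  "form_Cauchy B U \<longleftrightarrow> (\<forall>e>0. \<exists>M. \<forall>m\<ge>M. \<forall>n\<ge>M. B (U m - U n) (U m - U n) < e)"

text \<open>The factor \<open>c\<close> may have either sign; only \<open>D\<close> has to be
  nonnegative on differences. This permits passing between an energy and its shifts in both
  directions.\<close>

lemma form_Cauchy_add_scaled:
  assumes "form_Cauchy B U" "form_Cauchy D U"
    and nonneg: "\<And>m n. 0 \<le> D (U m - U n) (U m - U n)"
  shows "form_Cauchy (\<lambda>u v. B u v + c * D u v) U"
  unfolding form_Cauchy_def
proof (intro allI impI)
  fix e :: real assume e: "e > 0"
  have "e / 2 / (\<bar>c\<bar> + 1) > 0" using e by simp
  then obtain M where M: "\<forall>m\<ge>M. \<forall>n\<ge>M. D (U m - U n) (U m - U n) < e / 2 / (\<bar>c\<bar> + 1)"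
    using assms(2) unfolding form_Cauchy_def by blast
  obtain M' where M': "\<forall>m\<ge>M'. \<forall>n\<ge>M'. B (U m - U n) (U m - U n) < e / 2"
    using assms(1) e unfolding form_Cauchy_def by (meson half_gt_zero)
  have "B (U m - U n) (U m - U n) + c * D (U m - U n) (U m - U n) < e" if "m \<ge> max M M'" "n \<ge> max M M'" for m n
  proof -
    have "c * D (U m - U n) (U m - U n) \<le> (\<bar>c\<bar> + 1) * D (U m - U n) (U m - U n)"
      using nonneg by (intro mult_right_mono) auto
    also have "\<dots> < e / 2" using M that by (simp add: field_simps)
    finally show ?thesis using M' that by fastforce
  qed
  then show "\<exists>M. \<forall>m\<ge>M. \<forall>n\<ge>M. B (U m - U n) (U m - U n) + c * D (U m - U n) (U m - U n) < e" by blast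
qed

section \<open>Semi-inner products: Cauchy-Schwarz, triangle inequality, Cauchy sequences\<close>

locale semi_inner = sym_bilinear +
  assumes nonneg: "\<And>u. u \<in> V \<Longrightarrow> 0 \<le> B u u"
begin

definition nrm :: "'a \<Rightarrow> real" where "nrm u = sqrt (B u u)"

lemma nrm_nonneg [simp]: "u \<in> V \<Longrightarrow> 0 \<le> nrm u" by (simp add: nrm_def nonneg)

lemma nrm_sq: "u \<in> V \<Longrightarrow> (nrm u)\<^sup>2 = B u u" by (simp add: nrm_def nonneg)

lemma Cauchy_Schwarz:
  assumes u: "u \<in> V" and v: "v \<in> V"
  shows "\<bar>B u v\<bar> \<le> nrm u * nrm v"
proof -
  have quad: "0 \<le> B u u + 2 * t * B u v + t\<^sup>2 * B v v" for t
  proof -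
    have "0 \<le> B (u + t *\<^sub>R v) (u + t *\<^sub>R v)" using u v by (intro nonneg) auto
    also have "\<dots> = B u u + 2 * t * B u v + t\<^sup>2 * B v v"
      using u v sym[of u v] by (simp add: expand algebra_simps power2_eq_square)
    finally show ?thesis .
  qed
  have "(B u v)\<^sup>2 \<le> B u u * B v v"
  proof (cases "B v v = 0")
    case True
    \<comment> \<open>With \<open>B v v = 0\<close> the expression in \<open>quad\<close> is affine
      in \<open>t\<close>; a nonzero slope would let it reach the value -1, which is what the chosen
      \<open>t\<close> does.\<close>
    have "B u v = 0"
    proof (rule ccontr)
      assume "B u v \<noteq> 0"
      then show False using quad[of "- (B u u + 1) / (2 * B u v)"] True nonneg[OF u] by (simp add: field_simps)
    qed
    then show ?thesis using True by simp
  next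
    case False
    then have pos: "B v v > 0" using nonneg[OF v] by simp
    have "0 \<le> B u u - (B u v)\<^sup>2 / B v v"
      using quad[of "- B u v / B v v"] pos by (simp add: field_simps power2_eq_square)
    then show ?thesis using pos by (simp add: field_simps)
  qed
  then have "sqrt ((B u v)\<^sup>2) \<le> sqrt (B u u * B v v)" by (rule real_sqrt_le_mono)
  then show ?thesis by (simp add: nrm_def real_sqrt_mult)
qed

lemma nrm_scale: "u \<in> V \<Longrightarrow> nrm (c *\<^sub>R u) = \<bar>c\<bar> * nrm u"
  by (simp add: nrm_def expand real_sqrt_mult flip: mult.assoc)

lemma nrm_triangle:
  assumes u: "u \<in> V" and v: "v \<in> V"
  shows "nrm (u + v) \<le> nrm u + nrm v"
proof (rule power2_le_imp_le)
  have "(nrm (u + v))\<^sup>2 = B u u + 2 * B u v + B v v"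
    using u v sym[of u v] by (simp add: nrm_sq expand)
  also have "\<dots> \<le> (nrm u)\<^sup>2 + 2 * (nrm u * nrm v) + (nrm v)\<^sup>2"
    using Cauchy_Schwarz[OF u v] u v by (simp add: nrm_sq)
  finally show "(nrm (u + v))\<^sup>2 \<le> (nrm u + nrm v)\<^sup>2" by (simp add: power2_sum algebra_simps)
qed (use u v in simp)

lemma nrm_diff_commute: "u \<in> V \<Longrightarrow> v \<in> V \<Longrightarrow> nrm (u - v) = nrm (v - u)"
  using nrm_scale[of "u - v" "-1"] by simp

lemma nrm_triangle_diff:
  assumes "u \<in> V" "v \<in> V" "w \<in> V"
  shows "nrm (u - w) \<le> nrm (u - v) + nrm (v - w)"
  using nrm_triangle[of "u - v" "v - w"] assms by simp

lemma nrm_reverse_triangle: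
  assumes "u \<in> V" "v \<in> V"
  shows "\<bar>nrm u - nrm v\<bar> \<le> nrm (u - v)"
  using nrm_triangle[of "u - v" v] nrm_triangle[of "v - u" u] nrm_diff_commute[of u v] assms by simp

lemma parallelogram:
  "u \<in> V \<Longrightarrow> v \<in> V \<Longrightarrow> B (u - v) (u - v) = 2 * B u u + 2 * B v v - B (u + v) (u + v)"
  by (simp add: expand)

lemma tendsto_zero_iff:
  assumes "\<And>n. U n \<in> V"
  shows "(\<lambda>n. B (U n) (U n)) \<longlonglongrightarrow> 0 \<longleftrightarrow> (\<lambda>n. nrm (U n)) \<longlonglongrightarrow> 0"
proof
  assume "(\<lambda>n. B (U n) (U n)) \<longlonglongrightarrow> 0"
  from tendsto_real_sqrt[OF this] show "(\<lambda>n. nrm (U n)) \<longlonglongrightarrow> 0" by (simp add: nrm_def)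
next
  assume "(\<lambda>n. nrm (U n)) \<longlonglongrightarrow> 0"
  from tendsto_power[OF this, of 2] show "(\<lambda>n. B (U n) (U n)) \<longlonglongrightarrow> 0" using assms by (simp add: nrm_sq)
qed

lemma Cauchy_iff_nrm:
  assumes "\<And>n. U n \<in> V"
  shows "form_Cauchy B U \<longleftrightarrow> (\<forall>e>0. \<exists>M. \<forall>m\<ge>M. \<forall>n\<ge>M. nrm (U m - U n) < e)"
proof
  assume L: "form_Cauchy B U"
  show "\<forall>e>0. \<exists>M. \<forall>m\<ge>M. \<forall>n\<ge>M. nrm (U m - U n) < e"
  proof (intro allI impI)
    fix e :: real assume e: "e > 0"
    then obtain M where "\<forall>m\<ge>M. \<forall>n\<ge>M. B (U m - U n) (U m - U n) < e\<^sup>2"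
      using L unfolding form_Cauchy_def by (meson zero_less_power)
    then show "\<exists>M. \<forall>m\<ge>M. \<forall>n\<ge>M. nrm (U m - U n) < e"
      using e by (intro exI[of _ M]) (auto simp: nrm_def intro: real_less_lsqrt)
  qed
next
  assume R: "\<forall>e>0. \<exists>M. \<forall>m\<ge>M. \<forall>n\<ge>M. nrm (U m - U n) < e"
  show "form_Cauchy B U"
    unfolding form_Cauchy_def
  proof (intro allI impI)
    fix e :: real assume e: "e > 0"
    then obtain M where "\<forall>m\<ge>M. \<forall>n\<ge>M. nrm (U m - U n) < sqrt e"
      using R by (meson real_sqrt_gt_zero)
    then show "\<exists>M. \<forall>m\<ge>M. \<forall>n\<ge>M. B (U m - U n) (U m - U n) < e"
      by (intro exI[of _ M]) (auto simp: nrm_def)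
  qed
qed

lemma Cauchy_close:
  assumes U: "\<And>n. U n \<in> V" and W: "\<And>n. W n \<in> V" and "form_Cauchy B U"
    and "(\<lambda>n. nrm (W n - U n)) \<longlonglongrightarrow> 0"
  shows "form_Cauchy B W"
  unfolding Cauchy_iff_nrm[of W, OF W]
proof (intro allI impI)
  fix e :: real assume "e > 0"
  then have e: "e / 3 > 0" by simp
  obtain M where M: "\<forall>m\<ge>M. \<forall>n\<ge>M. nrm (U m - U n) < e / 3"
    using assms(3) e Cauchy_iff_nrm[of U, OF U] by blast
  obtain M' where M': "\<forall>n\<ge>M'. nrm (W n - U n) < e / 3"
    using LIMSEQ_D[OF assms(4) e] U W by auto
  have "nrm (W m - W n) < e" if "m \<ge> max M M'" "n \<ge> max M M'" for m n
    using nrm_triangle_diff[of "W m" "U m" "W n"] nrm_triangle_diff[of "U m" "U n" "W n"] U W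
      nrm_diff_commute[of "U n" "W n"] M[rule_format, of m n] M'[rule_format, of m] M'[rule_format, of n] that
    by simp
  then show "\<exists>M. \<forall>m\<ge>M. \<forall>n\<ge>M. nrm (W m - W n) < e" by blast
qed

lemma convergent_Cauchy:
  assumes "\<And>n. U n \<in> V" "u \<in> V" "(\<lambda>n. B (U n - u) (U n - u)) \<longlonglongrightarrow> 0"
  shows "form_Cauchy B U"
proof (rule Cauchy_close[of "\<lambda>_. u"])
  show "form_Cauchy B (\<lambda>_. u)"
    using scale[of u 0 0] assms(2) mem(3)[of u 0] by (auto simp: form_Cauchy_def)
  show "(\<lambda>n. nrm (U n - u)) \<longlonglongrightarrow> 0" using assms tendsto_zero_iff[of "\<lambda>n. U n - u"] by auto
qed (use assms in auto)

lemma Cauchy_lincomb: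
  assumes U: "\<And>n. U n \<in> V" and W: "\<And>n. W n \<in> V" and CU: "form_Cauchy B U" and CW: "form_Cauchy B W"
  shows "form_Cauchy B (\<lambda>n. a *\<^sub>R U n + b *\<^sub>R W n)"
proof (subst Cauchy_iff_nrm)
  show "\<forall>e>0. \<exists>M. \<forall>m\<ge>M. \<forall>n\<ge>M. nrm (a *\<^sub>R U m + b *\<^sub>R W m - (a *\<^sub>R U n + b *\<^sub>R W n)) < e"
  proof (intro allI impI)
    fix e :: real assume "e > 0"
    then have e: "e / (\<bar>a\<bar> + \<bar>b\<bar> + 1) > 0" by simp
    obtain M where M: "\<forall>m\<ge>M. \<forall>n\<ge>M. nrm (U m - U n) < e / (\<bar>a\<bar> + \<bar>b\<bar> + 1)"
      using CU e Cauchy_iff_nrm[of U, OF U] by blast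
    obtain M' where M': "\<forall>m\<ge>M'. \<forall>n\<ge>M'. nrm (W m - W n) < e / (\<bar>a\<bar> + \<bar>b\<bar> + 1)"
      using CW e Cauchy_iff_nrm[of W, OF W] by blast
    have "nrm (a *\<^sub>R U m + b *\<^sub>R W m - (a *\<^sub>R U n + b *\<^sub>R W n)) < e" if "m \<ge> max M M'" "n \<ge> max M M'" for m n
    proof -
      have "nrm (a *\<^sub>R U m + b *\<^sub>R W m - (a *\<^sub>R U n + b *\<^sub>R W n)) = nrm (a *\<^sub>R (U m - U n) + b *\<^sub>R (W m - W n))"
        by (simp add: algebra_simps)
      also have "\<dots> \<le> \<bar>a\<bar> * nrm (U m - U n) + \<bar>b\<bar> * nrm (W m - W n)"
        using nrm_triangle[of "a *\<^sub>R (U m - U n)" "b *\<^sub>R (W m - W n)"] U W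
        by (simp add: nrm_scale)
      also have "\<dots> \<le> \<bar>a\<bar> * (e / (\<bar>a\<bar> + \<bar>b\<bar> + 1)) + \<bar>b\<bar> * (e / (\<bar>a\<bar> + \<bar>b\<bar> + 1))"
        using M M' that by (intro add_mono mult_left_mono) (auto intro: less_imp_le)
      also have "\<dots> = (\<bar>a\<bar> + \<bar>b\<bar>) * (e / (\<bar>a\<bar> + \<bar>b\<bar> + 1))" by (simp only: distrib_right)
      also have "\<dots> < e" using \<open>e > 0\<close> by (simp add: field_simps)
      finally show ?thesis .
    qed
    then show "\<exists>M. \<forall>m\<ge>M. \<forall>n\<ge>M. nrm (a *\<^sub>R U m + b *\<^sub>R W m - (a *\<^sub>R U n + b *\<^sub>R W n)) < e" by blast
  qed
qed (use U W in auto)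

lemma tendsto_lincomb:
  fixes a b :: real
  assumes "\<And>n. U n \<in> V" "\<And>n. W n \<in> V" "u \<in> V" "w \<in> V"
    and U: "(\<lambda>n. B (U n - u) (U n - u)) \<longlonglongrightarrow> 0" and W: "(\<lambda>n. B (W n - w) (W n - w)) \<longlonglongrightarrow> 0"
  defines "D \<equiv> \<lambda>n. a *\<^sub>R U n + b *\<^sub>R W n - (a *\<^sub>R u + b *\<^sub>R w)"
  shows "(\<lambda>n. B (D n) (D n)) \<longlonglongrightarrow> 0"
proof (subst tendsto_zero_iff)
  have "(\<lambda>n. \<bar>a\<bar> * nrm (U n - u) + \<bar>b\<bar> * nrm (W n - w)) \<longlonglongrightarrow> \<bar>a\<bar> * 0 + \<bar>b\<bar> * 0"
    using assms tendsto_zero_iff[of "\<lambda>n. U n - u"] tendsto_zero_iff[of "\<lambda>n. W n - w"]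
    by (intro tendsto_add tendsto_mult_left) auto
  then have lim: "(\<lambda>n. \<bar>a\<bar> * nrm (U n - u) + \<bar>b\<bar> * nrm (W n - w)) \<longlonglongrightarrow> 0" by simp
  have "D n = a *\<^sub>R (U n - u) + b *\<^sub>R (W n - w)" for n by (simp add: D_def algebra_simps)
  moreover have "nrm (a *\<^sub>R (U n - u) + b *\<^sub>R (W n - w)) \<le> \<bar>a\<bar> * nrm (U n - u) + \<bar>b\<bar> * nrm (W n - w)" for n
    using nrm_triangle[of "a *\<^sub>R (U n - u)" "b *\<^sub>R (W n - w)"] assms by (simp add: nrm_scale)
  moreover have "D n \<in> V" for n using assms by auto
  ultimately show "(\<lambda>n. nrm (D n)) \<longlonglongrightarrow> 0"
    using assms by (intro tendsto_sandwich[OF _ _ tendsto_const lim]) auto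
qed (use assms in auto)

lemma form_tendsto:
  assumes "\<And>n. U n \<in> V" "u \<in> V" "w \<in> V" and U: "(\<lambda>n. B (U n - u) (U n - u)) \<longlonglongrightarrow> 0"
  shows "(\<lambda>n. B (U n) w) \<longlonglongrightarrow> B u w" "(\<lambda>n. B (U n) (U n)) \<longlonglongrightarrow> B u u"
proof -
  have lim: "(\<lambda>n. nrm (U n - u)) \<longlonglongrightarrow> 0" using assms tendsto_zero_iff[of "\<lambda>n. U n - u"] by auto
  have lim': "(\<lambda>n. nrm (U n - u) * nrm w) \<longlonglongrightarrow> 0" using tendsto_mult_right[OF lim, of "nrm w"] by simp
  have "norm (B (U n) w - B u w) \<le> nrm (U n - u) * nrm w" for n
    using Cauchy_Schwarz[of "U n - u" w] assms by (simp add: diff)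
  then have "(\<lambda>n. B (U n) w - B u w) \<longlonglongrightarrow> 0"
    by (intro Lim_null_comparison[OF _ lim']) simp
  then show "(\<lambda>n. B (U n) w) \<longlonglongrightarrow> B u w" by (simp add: LIM_zero_iff)
  have "(\<lambda>n. nrm (U n) - nrm u) \<longlonglongrightarrow> 0"
    using nrm_reverse_triangle[OF assms(1,2)] by (intro Lim_null_comparison[OF _ lim]) (simp add: always_eventually)
  then have "(\<lambda>n. nrm (U n)) \<longlonglongrightarrow> nrm u" by (simp add: LIM_zero_iff)
  from tendsto_power[OF this, of 2] show "(\<lambda>n. B (U n) (U n)) \<longlonglongrightarrow> B u u" using assms by (simp add: nrm_sq)
qed

lemma Cauchy_convergent_form:
  assumes U: "\<And>n. U n \<in> V" and C: "form_Cauchy B U"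
  shows "convergent (\<lambda>n. B (U n) (U n))"
proof -
  have "Cauchy (\<lambda>n. nrm (U n))"
    unfolding Cauchy_def
  proof (intro allI impI)
    fix e :: real assume "e > 0"
    then obtain M where "\<forall>m\<ge>M. \<forall>n\<ge>M. nrm (U m - U n) < e" using C Cauchy_iff_nrm[of U, OF U] by blast
    then show "\<exists>M. \<forall>m\<ge>M. \<forall>n\<ge>M. dist (nrm (U m)) (nrm (U n)) < e"
      using nrm_reverse_triangle[OF U U] unfolding dist_real_def by (meson le_less_trans)
  qed
  then obtain l where "(\<lambda>n. nrm (U n)) \<longlonglongrightarrow> l" using convergentD real_Cauchy_convergent by blast
  from tendsto_power[OF this, of 2] show ?thesis using U by (auto simp: nrm_sq convergent_def)
qed

end

text \<open>Abstract setting of the direct method: \<open>L\<close> plays the role of L2,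
  \<open>T\<close> of the test functions and \<open>E\<close> of the energy. Boundedness from below
  and compactness are demanded on \<open>T\<close> only, where the form is explicit.
  \<open>closable\<close> is what makes the extension of \<open>E\<close> to limits well defined,
  and \<open>infinite_dim\<close> ensures that any number of orthogonality conditions leaves
  admissible vectors.\<close>

locale closable_form = L2: semi_inner L I + test: sym_bilinear T E
  for L T :: "'v::real_vector set" and I E :: "'v \<Rightarrow> 'v \<Rightarrow> real" +
  fixes C :: real
  assumes TL: "T \<subseteq> L"
    and lower: "\<And>u. u \<in> T \<Longrightarrow> I u u \<le> E u u + C * I u u"
    and complete: "\<And>U. (\<And>n. U n \<in> L) \<Longrightarrow> form_Cauchy I U \<Longrightarrow> \<exists>u\<in>L. (\<lambda>n. I (U n - u) (U n - u)) \<longlonglongrightarrow> 0"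
    and compact: "\<And>(U :: nat \<Rightarrow> _) M. (\<And>n. U n \<in> T) \<Longrightarrow> (\<And>n. I (U n) (U n) \<le> M) \<Longrightarrow> (\<And>n. E (U n) (U n) \<le> M) \<Longrightarrow>
      \<exists>r. strict_mono r \<and> form_Cauchy I (U \<circ> r)"
    and closable: "\<And>U. (\<And>n. U n \<in> T) \<Longrightarrow> form_Cauchy E U \<Longrightarrow> (\<lambda>n. I (U n) (U n)) \<longlonglongrightarrow> 0 \<Longrightarrow>
      (\<lambda>n. E (U n) (U n)) \<longlonglongrightarrow> 0"
    and infinite_dim: "\<And>n::nat. \<exists>t. (\<forall>i\<le>n. t i \<in> T \<and> I (t i) (t i) > 0) \<and>
      (\<forall>i\<le>n. \<forall>j\<le>n. i \<noteq> j \<longrightarrow> I (t i) (t j) = 0)"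
begin

text \<open>The shift by \<open>C\<close> turns the energy into a semi-inner product that dominates
  \<open>I\<close>. Norm estimates are made for \<open>S\<close> and translated back to
  \<open>E\<close>, whose sign is not controlled.\<close>

definition S :: "'v \<Rightarrow> 'v \<Rightarrow> real" where "S u v = E u v + C * I u v"

lemma T_L [intro, simp]: "u \<in> T \<Longrightarrow> u \<in> L" using TL by blast

sublocale S: semi_inner T S
proof -
  have "sym_bilinear T S"
    unfolding S_def
    by (intro sym_bilinear_add_scaled test.sym_bilinear_axioms
        sym_bilinear_subspace[OF L2.sym_bilinear_axioms] test.subspace TL)
  moreover have "0 \<le> S u u" if "u \<in> T" for u
    using lower[OF that] L2.nonneg[of u] that by (simp add: S_def)
  ultimately show "semi_inner T S" by (simp add: semi_inner_def semi_inner_axioms_def)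
qed

text \<open>Counterpart of \<open>approximates\<close> in which the Cauchy condition is imposed on
  the energy instead of the norm of the energy space. For the concrete form the two are shown to be
  the same.\<close>

definition approx :: "(nat \<Rightarrow> 'v) \<Rightarrow> 'v \<Rightarrow> bool" where
  "approx U u \<longleftrightarrow> (\<forall>n. U n \<in> T) \<and> form_Cauchy E U \<and> (\<lambda>n. I (U n - u) (U n - u)) \<longlonglongrightarrow> 0"

definition H :: "'v set" where "H = {u \<in> L. \<exists>U. approx U u}"

definition EE :: "'v \<Rightarrow> 'v \<Rightarrow> real" where
  "EE u v = (THE e. \<forall>U V. approx U u \<longrightarrow> approx V v \<longrightarrow> (\<lambda>n. E (U n) (V n)) \<longlonglongrightarrow> e)"

lemma H_L [intro, simp]: "u \<in> H \<Longrightarrow> u \<in> L" by (simp add: H_def)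

lemma H_I: "u \<in> L \<Longrightarrow> approx U u \<Longrightarrow> u \<in> H" by (auto simp only: H_def)

lemma H_E: "u \<in> H \<Longrightarrow> (\<And>U. u \<in> L \<Longrightarrow> approx U u \<Longrightarrow> thesis) \<Longrightarrow> thesis" by (auto simp only: H_def)

lemma S_Cauchy_iff:
  assumes T: "\<And>n. U n \<in> T" and I: "form_Cauchy I U"
  shows "form_Cauchy S U \<longleftrightarrow> form_Cauchy E U"
proof
  have nn: "0 \<le> I (U m - U n) (U m - U n)" for m n using T by (simp add: L2.nonneg)
  show "form_Cauchy E U \<Longrightarrow> form_Cauchy S U"
    using form_Cauchy_add_scaled[of E U I C] I nn unfolding S_def by simp
  show "form_Cauchy S U \<Longrightarrow> form_Cauchy E U"
    using form_Cauchy_add_scaled[of S U I "- C"] I nn unfolding S_def by simp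
qed

lemma approx_iff_S:
  assumes "u \<in> L"
  shows "approx U u \<longleftrightarrow> (\<forall>n. U n \<in> T) \<and> form_Cauchy S U \<and> (\<lambda>n. I (U n - u) (U n - u)) \<longlonglongrightarrow> 0"
proof (cases "(\<forall>n. U n \<in> T) \<and> (\<lambda>n. I (U n - u) (U n - u)) \<longlonglongrightarrow> 0")
  case True
  then have "form_Cauchy I U" using assms by (intro L2.convergent_Cauchy) auto
  then show ?thesis using True S_Cauchy_iff by (auto simp: approx_def)
qed (auto simp: approx_def)

lemma approx_lincomb:
  assumes u: "u \<in> L" "approx U u" and w: "w \<in> L" "approx W w"
  shows "approx (\<lambda>n. a *\<^sub>R U n + b *\<^sub>R W n) (a *\<^sub>R u + b *\<^sub>R w)"
proof -
  have T: "\<And>n. U n \<in> T" "\<And>n. W n \<in> T" using assms by (simp_all add: approx_def)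
  have "form_Cauchy S (\<lambda>n. a *\<^sub>R U n + b *\<^sub>R W n)"
    using assms T by (intro S.Cauchy_lincomb) (simp_all add: approx_iff_S)
  moreover have "(\<lambda>n. I (a *\<^sub>R U n + b *\<^sub>R W n - (a *\<^sub>R u + b *\<^sub>R w)) (a *\<^sub>R U n + b *\<^sub>R W n - (a *\<^sub>R u + b *\<^sub>R w))) \<longlonglongrightarrow> 0"
    using assms T by (intro L2.tendsto_lincomb) (simp_all add: approx_def)
  ultimately show ?thesis using assms T by (simp add: approx_iff_S)
qed

lemma approx_add: "\<lbrakk>u \<in> L; approx U u; w \<in> L; approx W w\<rbrakk> \<Longrightarrow> approx (\<lambda>n. U n + W n) (u + w)"
  using approx_lincomb[of u U w W 1 1] by simp

lemma approx_diff: "\<lbrakk>u \<in> L; approx U u; w \<in> L; approx W w\<rbrakk> \<Longrightarrow> approx (\<lambda>n. U n - W n) (u - w)"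
  using approx_lincomb[of u U w W 1 "-1"] by simp

lemma approx_scale: "\<lbrakk>u \<in> L; approx U u\<rbrakk> \<Longrightarrow> approx (\<lambda>n. a *\<^sub>R U n) (a *\<^sub>R u)"
  using approx_lincomb[of u U u U a 0] by simp

lemma approx_const:
  assumes "t \<in> T" shows "approx (\<lambda>_. t) t"
proof -
  have "form_Cauchy I (\<lambda>_. 0 :: 'v)" "form_Cauchy E (\<lambda>_. t)" "I 0 0 = 0"
    using L2.scale[of 0 0 0] L2.mem(3)[of t 0] test.scale[of 0 0 0] test.mem(3)[of t 0] assms by (auto simp: form_Cauchy_def)
  then show ?thesis using assms by (simp add: approx_def)
qed

lemma T_H [intro, simp]: "t \<in> T \<Longrightarrow> t \<in> H" using H_I[OF T_L approx_const] .

lemma approx_S_tendsto_zero: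
  assumes "approx U 0" shows "(\<lambda>n. S (U n) (U n)) \<longlonglongrightarrow> 0"
proof -
  have I: "(\<lambda>n. I (U n) (U n)) \<longlonglongrightarrow> 0" using assms by (simp add: approx_def)
  moreover have "(\<lambda>n. E (U n) (U n)) \<longlonglongrightarrow> 0" using assms I by (intro closable) (auto simp: approx_def)
  ultimately have "(\<lambda>n. E (U n) (U n) + C * I (U n) (U n)) \<longlonglongrightarrow> 0 + C * 0"
    by (intro tendsto_intros)
  then show ?thesis by (simp add: S_def)
qed

text \<open>Two sequences approximating the same \<open>u\<close> differ by a sequence approximating
  0. Closability sends the form \<open>S\<close> of the difference to 0, so the reverse triangle
  inequality forces the same limit of the norms, and the limit of \<open>I\<close> is
  \<open>I u u\<close> for both.\<close>

lemma approx_quadratic_limit: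
  assumes "u \<in> L"
  shows "\<exists>q. \<forall>U. approx U u \<longrightarrow> (\<lambda>n. E (U n) (U n)) \<longlonglongrightarrow> q"
proof (cases "\<exists>U. approx U u")
  case True
  then obtain W where W: "approx W u" by auto
  then have WT: "\<And>n. W n \<in> T" by (simp add: approx_def)
  have "convergent (\<lambda>n. S (W n) (W n))"
    using W assms by (intro S.Cauchy_convergent_form) (auto simp: approx_iff_S)
  then obtain q where q: "(\<lambda>n. S (W n) (W n)) \<longlonglongrightarrow> q" by (auto simp: convergent_def)
  show ?thesis
  proof (intro exI[of _ "q - C * I u u"] allI impI)
    fix U assume U: "approx U u"
    then have UT: "\<And>n. U n \<in> T" by (simp add: approx_def)
    have "(\<lambda>n. I (U n) (U n)) \<longlonglongrightarrow> I u u"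
      using U assms UT by (intro L2.form_tendsto(2)[of U u u]) (auto simp: approx_def)
    moreover have "(\<lambda>n. S (U n) (U n)) \<longlonglongrightarrow> q"
    proof -
      have "approx (\<lambda>n. U n - W n) 0" using approx_diff[OF assms U assms W] by simp
      then have "(\<lambda>n. S (U n - W n) (U n - W n)) \<longlonglongrightarrow> 0" by (rule approx_S_tendsto_zero)
      then have *: "(\<lambda>n. S.nrm (U n - W n)) \<longlonglongrightarrow> 0"
        using S.tendsto_zero_iff[of "\<lambda>n. U n - W n"] UT WT by auto
      have "(\<lambda>n. S.nrm (U n) - S.nrm (W n)) \<longlonglongrightarrow> 0"
        using S.nrm_reverse_triangle[OF UT WT] by (intro Lim_null_comparison[OF _ *]) simp
      moreover have "(\<lambda>n. S.nrm (W n)) \<longlonglongrightarrow> sqrt q"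
        using tendsto_real_sqrt[OF q] by (simp add: S.nrm_def)
      ultimately have "(\<lambda>n. S.nrm (U n)) \<longlonglongrightarrow> sqrt q"
        using tendsto_add by fastforce
      from tendsto_power[OF this, of 2] have "(\<lambda>n. S (U n) (U n)) \<longlonglongrightarrow> (sqrt q)\<^sup>2"
        using UT by (simp add: S.nrm_sq)
      moreover have "q \<ge> 0" using q WT S.nonneg by (intro LIMSEQ_le_const[OF q]) auto
      ultimately show ?thesis by simp
    qed
    ultimately have "(\<lambda>n. S (U n) (U n) - C * I (U n) (U n)) \<longlonglongrightarrow> q - C * I u u"
      by (intro tendsto_intros)
    then show "(\<lambda>n. E (U n) (U n)) \<longlonglongrightarrow> q - C * I u u" by (simp add: S_def)
  qed
qed auto

text \<open>Polarization reduces the mixed limit to two quadratic ones. This is the step that gives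
  the description operator in \<open>EE\<close> its value; afterwards \<open>EE\<close> is handled
  only through limits.\<close>

lemma EE_tendsto:
  assumes u: "u \<in> L" "approx U u" and v: "v \<in> L" "approx V v"
  shows "(\<lambda>n. E (U n) (V n)) \<longlonglongrightarrow> EE u v"
proof -
  obtain q where q: "\<And>U. approx U (u + v) \<Longrightarrow> (\<lambda>n. E (U n) (U n)) \<longlonglongrightarrow> q"
    using approx_quadratic_limit[of "u + v"] u v by auto
  obtain p where p: "\<And>U. approx U (u - v) \<Longrightarrow> (\<lambda>n. E (U n) (U n)) \<longlonglongrightarrow> p"
    using approx_quadratic_limit[of "u - v"] u v by auto
  have lim: "(\<lambda>n. E (U n) (V n)) \<longlonglongrightarrow> (q - p) / 4" if "approx U u" "approx V v" for U V
  proof -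
    have "(\<lambda>n. (E (U n + V n) (U n + V n) - E (U n - V n) (U n - V n)) / 4) \<longlonglongrightarrow> (q - p) / 4"
      using that u(1) v(1) by (intro tendsto_intros q p approx_add approx_diff) auto
    moreover have "(E (U n + V n) (U n + V n) - E (U n - V n) (U n - V n)) / 4 = E (U n) (V n)" for n
      using that test.sym[of "U n" "V n"] by (simp add: approx_def test.expand)
    ultimately show ?thesis by simp
  qed
  have "EE u v = (q - p) / 4"
    unfolding EE_def
  proof (rule the_equality)
    show "\<forall>U V. approx U u \<longrightarrow> approx V v \<longrightarrow> (\<lambda>n. E (U n) (V n)) \<longlonglongrightarrow> (q - p) / 4"
      using lim by simp
  next
    fix e assume "\<forall>U V. approx U u \<longrightarrow> approx V v \<longrightarrow> (\<lambda>n. E (U n) (V n)) \<longlonglongrightarrow> e"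
    then have "(\<lambda>n. E (U n) (V n)) \<longlonglongrightarrow> e" using u v by simp
    then show "e = (q - p) / 4" using lim[OF u(2) v(2)] by (rule LIMSEQ_unique)
  qed
  with lim[OF u(2) v(2)] show ?thesis by (simp only:)
qed

lemma EE_on_T: "s \<in> T \<Longrightarrow> t \<in> T \<Longrightarrow> EE s t = E s t"
  using EE_tendsto[OF _ approx_const _ approx_const, of s t] by (simp add: LIMSEQ_const_iff)

lemma subspace_H: "subspace H"
proof -
  have "0 \<in> H" using test.subspace by (simp add: subspace_0)
  moreover have "u + v \<in> H" if "u \<in> H" "v \<in> H" for u v
  proof -
    obtain U where U: "u \<in> L" "approx U u" using \<open>u \<in> H\<close> by (rule H_E)
    obtain V where V: "v \<in> L" "approx V v" using \<open>v \<in> H\<close> by (rule H_E)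
    from approx_add[OF U V] L2.mem(1)[OF U(1) V(1)] show ?thesis by (rule H_I[rotated])
  qed
  moreover have "c *\<^sub>R u \<in> H" if "u \<in> H" for c u
  proof -
    obtain U where "u \<in> L" "approx U u" using \<open>u \<in> H\<close> by (rule H_E)
    from approx_scale[OF this] L2.mem(3)[OF this(1)] show ?thesis by (rule H_I[rotated])
  qed
  ultimately show ?thesis by (simp add: subspace_def)
qed

lemma H_lower:
  assumes "u \<in> H" shows "I u u \<le> EE u u + C * I u u"
proof -
  obtain U where U: "approx U u" and uL: "u \<in> L" using assms(1) by (elim H_E)
  have I: "(\<lambda>n. I (U n) (U n)) \<longlonglongrightarrow> I u u"
    using U uL by (intro L2.form_tendsto(2)[of U u u]) (auto simp: approx_def)
  have "(\<lambda>n. E (U n) (U n) + C * I (U n) (U n)) \<longlonglongrightarrow> EE u u + C * I u u"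
    using I EE_tendsto[OF uL U uL U] by (intro tendsto_intros)
  then show ?thesis
    using U lower by (intro LIMSEQ_le[OF I]) (auto simp: approx_def)
qed

sublocale energy: sym_bilinear H EE
proof
  show "subspace H" by (rule subspace_H)
  fix u v assume "u \<in> H" "v \<in> H"
  then obtain U V where U: "u \<in> L" "approx U u" and V: "v \<in> L" "approx V v" by (elim H_E)
  have "(\<lambda>n. E (U n) (V n)) = (\<lambda>n. E (V n) (U n))" using U V by (intro ext) (simp add: approx_def test.sym)
  from EE_tendsto[OF U V, unfolded this] EE_tendsto[OF V U] show "EE u v = EE v u" by (rule LIMSEQ_unique)
next
  fix u v w assume "u \<in> H" "v \<in> H" "w \<in> H"
  then obtain U V W where U: "u \<in> L" "approx U u" and V: "v \<in> L" "approx V v" and W: "w \<in> L" "approx W w"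
    by (elim H_E)
  have eq: "(\<lambda>n. E (U n + V n) (W n)) = (\<lambda>n. E (U n) (W n) + E (V n) (W n))"
    using U V W by (intro ext) (simp add: approx_def test.add)
  from EE_tendsto[OF L2.mem(1)[OF U(1) V(1)] approx_add[OF U V] W, unfolded eq]
    tendsto_add[OF EE_tendsto[OF U W] EE_tendsto[OF V W]]
  show "EE (u + v) w = EE u w + EE v w" by (rule LIMSEQ_unique)
next
  fix c u w assume "u \<in> H" "w \<in> H"
  then obtain U W where U: "u \<in> L" "approx U u" and W: "w \<in> L" "approx W w"
    by (elim H_E)
  have eq: "(\<lambda>n. E (c *\<^sub>R U n) (W n)) = (\<lambda>n. c * E (U n) (W n))"
    using U W by (intro ext) (simp add: approx_def test.scale)
  from EE_tendsto[OF L2.mem(3)[OF U(1)] approx_scale[OF U] W, of c, unfolded eq] tendsto_mult_left[OF EE_tendsto[OF U W], of c]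
  show "EE (c *\<^sub>R u) w = c * EE u w" by (rule LIMSEQ_unique)
qed

definition SS :: "'v \<Rightarrow> 'v \<Rightarrow> real" where "SS u v = EE u v + C * I u v"

lemma I_le_SS: "u \<in> H \<Longrightarrow> I u u \<le> SS u u" using H_lower by (simp add: SS_def)

sublocale SS: semi_inner H SS
proof -
  have "sym_bilinear H SS"
    unfolding SS_def
    by (intro sym_bilinear_add_scaled energy.sym_bilinear_axioms
        sym_bilinear_subspace[OF L2.sym_bilinear_axioms] subspace_H) auto
  moreover have "0 \<le> SS u u" if "u \<in> H" for u
    using I_le_SS[OF that] L2.nonneg[of u] that by simp
  ultimately show "semi_inner H SS" by (simp add: semi_inner_def semi_inner_axioms_def)
qed

lemma SS_on_T: "s \<in> T \<Longrightarrow> t \<in> T \<Longrightarrow> SS s t = S s t"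
  by (simp add: SS_def S_def EE_on_T)

text \<open>Approximating sequences converge in the form norm and not merely in \<open>I\<close>:
  for fixed \<open>n\<close> the sequence \<open>U n - U m\<close> approximates
  \<open>U n - u\<close> as \<open>m\<close> grows, so the Cauchy bound for \<open>S\<close> passes
  to the limit.\<close>

lemma approx_SS_tendsto:
  assumes uL: "u \<in> L" and U: "approx U u"
  shows "(\<lambda>n. SS (U n - u) (U n - u)) \<longlonglongrightarrow> 0"
proof (rule LIMSEQ_I)
  fix e :: real assume "e > 0"
  then have e: "e / 2 > 0" by simp
  have UT: "\<And>n. U n \<in> T" and uH: "u \<in> H" using U uL by (auto simp: approx_def intro: H_I)
  have "form_Cauchy S U" using U uL by (simp add: approx_iff_S)
  then obtain M where M: "\<And>m n. m \<ge> M \<Longrightarrow> n \<ge> M \<Longrightarrow> S (U m - U n) (U m - U n) < e / 2"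
    using e unfolding form_Cauchy_def by blast
  have "SS (U n - u) (U n - u) \<le> e / 2" if "n \<ge> M" for n
  proof -
    have ap: "approx (\<lambda>m. U n - U m) (U n - u)"
      using approx_diff[OF _ approx_const uL U] UT by auto
    have L: "U n - u \<in> L" using UT uL by auto
    have "(\<lambda>m. I (U n - U m) (U n - U m)) \<longlonglongrightarrow> I (U n - u) (U n - u)"
      using ap L UT by (intro L2.form_tendsto(2)[of _ _ u]) (auto simp: approx_def uL)
    then have "(\<lambda>m. S (U n - U m) (U n - U m)) \<longlonglongrightarrow> SS (U n - u) (U n - u)"
      unfolding S_def SS_def using EE_tendsto[OF L ap L ap] by (intro tendsto_intros)
    then show ?thesis using M that by (intro LIMSEQ_le_const2) (auto intro: less_imp_le)
  qed
  then have "norm (SS (U n - u) (U n - u) - 0) < e" if "n \<ge> M" for n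
    using that \<open>e > 0\<close> SS.nonneg[of "U n - u"] UT uH by (fastforce simp: abs_if)
  then show "\<exists>M. \<forall>n\<ge>M. norm (SS (U n - u) (U n - u) - 0) < e" by blast
qed

lemma approx_within:
  assumes "u \<in> H" "e > 0"
  shows "\<exists>t\<in>T. SS.nrm (t - u) < e"
proof -
  obtain U where uL: "u \<in> L" and U: "approx U u" using assms(1) by (elim H_E)
  then have "\<And>n. U n \<in> T" by (simp add: approx_def)
  then have "(\<lambda>n. SS.nrm (U n - u)) \<longlonglongrightarrow> 0"
    using approx_SS_tendsto[OF uL U] SS.tendsto_zero_iff[of "\<lambda>n. U n - u"] assms by auto
  from LIMSEQ_D[OF this assms(2)] \<open>\<And>n. U n \<in> T\<close> show ?thesis using assms by (auto intro: le_less_trans[OF abs_ge_self])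
qed

section \<open>Existence of constrained minimizers\<close>

definition adm :: "nat \<Rightarrow> (nat \<Rightarrow> 'v) \<Rightarrow> 'v set" where
  "adm k \<phi> = {u \<in> H. I u u = 1 \<and> (\<forall>j\<in>{1..<k}. I u (\<phi> j) = 0)}"

lemma adm_scale:
  assumes w: "w \<in> H" "\<forall>j\<in>{1..<k}. I w (\<phi> j) = 0" "I w w > 0" and \<phi>: "\<forall>j\<in>{1..<k}. \<phi> j \<in> L"
  defines "v \<equiv> (1 / sqrt (I w w)) *\<^sub>R w"
  shows "v \<in> adm k \<phi>" "EE v v = EE w w / I w w"
proof -
  have "I v v = 1"
    using w by (simp add: v_def L2.expand flip: power2_eq_square)
  then show "v \<in> adm k \<phi>"
    using assms by (auto simp: adm_def L2.scale)
  show "EE v v = EE w w / I w w"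
    using w by (simp add: v_def energy.expand flip: power2_eq_square)
qed

text \<open>The span of \<open>k + 1\<close> mutually orthogonal test functions is met by at most
  \<open>k - 1\<close> linear conditions, hence contains an admissible direction; orthogonality
  shows that its \<open>I\<close> norm is positive.\<close>

lemma adm_nonempty:
  assumes \<phi>: "\<forall>j\<in>{1..<k}. \<phi> j \<in> L"
  shows "adm k \<phi> \<noteq> {}"
proof -
  obtain t where t: "\<forall>i\<le>k. t i \<in> T \<and> I (t i) (t i) > 0" "\<forall>i\<le>k. \<forall>j\<le>k. i \<noteq> j \<longrightarrow> I (t i) (t j) = 0"
    using infinite_dim[of k] by blast
  obtain c where c: "\<exists>j\<in>{..k}. c j \<noteq> 0" "\<forall>i\<in>{1..<k}. (\<Sum>j\<le>k. c j * I (t j) (\<phi> i)) = 0"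
    using homogeneous_system_nontrivial_solution[of "{1..<k}" "{..k}" "\<lambda>i j. I (t j) (\<phi> i)"]
    by (auto simp: less_Suc_eq_le)
  define w where "w = (\<Sum>j\<le>k. c j *\<^sub>R t j)"
  have "w \<in> T" unfolding w_def using t by (intro test.sum_mem) auto
  moreover have "I w (\<phi> i) = 0" if "i \<in> {1..<k}" for i
  proof -
    have "I w (\<phi> i) = (\<Sum>j\<le>k. c j * I (t j) (\<phi> i))"
      unfolding w_def using t \<phi> that by (intro L2.sum_left) auto
    then show ?thesis using c(2) that by simp
  qed
  moreover have "I w w > 0"
  proof -
    obtain j where j: "j \<le> k" "c j \<noteq> 0" using c by auto
    have "I w w = (\<Sum>j\<le>k. (c j)\<^sup>2 * I (t j) (t j))"
      unfolding w_def using t by (intro L2.sum_orthogonal) auto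
    also have "\<dots> > 0" using j t by (intro sum_pos2[of _ j]) (auto intro: less_imp_le)
    finally show ?thesis .
  qed
  ultimately show ?thesis using adm_scale(1)[of w k \<phi>] \<phi> by auto
qed

text \<open>Direct method without weak convergence: compactness yields an \<open>I\<close>-Cauchy
  subsequence of a minimizing sequence, and the parallelogram law upgrades this to the form norm, so
  the limit attains the infimum.\<close>

lemma minimizer_exists:
  assumes \<phi>: "\<forall>j\<in>{1..<k}. \<phi> j \<in> L"
  shows "\<exists>u\<in>adm k \<phi>. \<forall>v\<in>adm k \<phi>. EE u u \<le> EE v v"
proof -
  define A where "A = (\<lambda>u. EE u u) ` adm k \<phi>"
  define m0 where "m0 = Inf A"
  have "A \<noteq> {}" using adm_nonempty[OF \<phi>] by (auto simp: A_def)
  have "bdd_below A" using H_lower by (intro bdd_belowI[of _ "1 - C"]) (fastforce simp: A_def adm_def)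
  have m0_le: "m0 \<le> EE v v" if "v \<in> adm k \<phi>" for v
    unfolding m0_def using that \<open>bdd_below A\<close> by (intro cInf_lower) (auto simp: A_def)
  \<comment> \<open>Homogeneous version of the infimum, valid without normalization; it is applied
    below to sums of two members of the minimizing sequence.\<close>
  have m0_I: "m0 * I w w \<le> EE w w" if w: "w \<in> H" "\<forall>j\<in>{1..<k}. I w (\<phi> j) = 0" for w
  proof (cases "I w w = 0")
    case True
    then show ?thesis using H_lower[OF w(1)] by simp
  next
    case False
    then have "I w w > 0" using L2.nonneg[of w] w by simp
    then show ?thesis using m0_le[OF adm_scale(1)[OF w _ \<phi>]] adm_scale(2)[OF w _ \<phi>] by (simp add: field_simps)
  qed
  have "\<exists>u\<in>adm k \<phi>. EE u u < m0 + 1 / real (Suc n)" for n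
    using cInf_lessD[OF \<open>A \<noteq> {}\<close>, of "m0 + 1 / real (Suc n)"] by (auto simp: A_def m0_def)
  then obtain u where u: "\<And>n. u n \<in> adm k \<phi>" "\<And>n. EE (u n) (u n) < m0 + 1 / real (Suc n)"
    by metis
  have uH: "\<And>n. u n \<in> H" using u by (simp add: adm_def)
  \<comment> \<open>Compactness is available for test functions only, so the minimizing sequence is
    shadowed by test functions at vanishing form distance.\<close>
  have "\<exists>t\<in>T. SS.nrm (t - u n) < 1 / real (Suc n)" for n
    using approx_within[OF uH] by simp
  then obtain t where t: "\<And>n. t n \<in> T" "\<And>n. SS.nrm (t n - u n) < 1 / real (Suc n)"
    by metis
  \<comment> \<open>The root bounds the form norm of \<open>u n\<close>, whose energy is at most
    \<open>m0 + 1\<close>; the added 1 bounds the distance to \<open>t n\<close>.\<close>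
  define R where "R = (sqrt (m0 + 1 + C) + 1)\<^sup>2"
  have S_le: "S (t n) (t n) \<le> R" for n
  proof -
    have "1 / real (Suc n) \<le> 1" by simp
    then have "EE (u n) (u n) \<le> m0 + 1" using u(2)[of n] by linarith
    then have "SS (u n) (u n) \<le> m0 + 1 + C" using u(1)[of n] by (simp add: SS_def adm_def)
    then have "SS.nrm (u n) \<le> sqrt (m0 + 1 + C)" by (simp add: SS.nrm_def)
    moreover have "SS.nrm (t n) \<le> SS.nrm (u n) + SS.nrm (t n - u n)"
      using SS.nrm_triangle[of "u n" "t n - u n"] uH t by simp
    ultimately have "SS.nrm (t n) \<le> sqrt (m0 + 1 + C) + 1"
      using t(2)[of n] \<open>1 / real (Suc n) \<le> 1\<close> by linarith
    then have "(SS.nrm (t n))\<^sup>2 \<le> R" unfolding R_def using t by (intro power_mono) auto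
    then show ?thesis using t by (simp add: SS.nrm_sq SS_on_T)
  qed
  have R: "R \<ge> 0" by (simp add: R_def)
  have I_le: "I (t n) (t n) \<le> R" for n using lower[OF t(1), of n] S_le[of n] by (simp add: S_def)
  have "\<bar>C\<bar> * I (t n) (t n) \<le> \<bar>C\<bar> * R" for n using I_le by (intro mult_left_mono) auto
  moreover have "- (C * I (t n) (t n)) \<le> \<bar>C\<bar> * I (t n) (t n)" for n
    using L2.nonneg[of "t n"] t mult_right_mono[of "-C" "\<bar>C\<bar>" "I (t n) (t n)"] by simp
  ultimately have "E (t n) (t n) \<le> R + \<bar>C\<bar> * R" for n using S_le[of n] unfolding S_def by (smt (verit))
  moreover have "I (t n) (t n) \<le> R + \<bar>C\<bar> * R" for n using I_le[of n] R by (simp add: add_increasing2)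
  ultimately obtain r where r: "strict_mono r" "form_Cauchy I (t \<circ> r)"
    using t(1) compact[of t "R + \<bar>C\<bar> * R"] by auto
  have "(\<lambda>n. SS.nrm (t n - u n)) \<longlonglongrightarrow> 0"
    using t uH by (intro tendsto_sandwich[OF _ _ tendsto_const LIMSEQ_Suc[OF lim_1_over_n]])
      (auto intro!: always_eventually less_imp_le)
  then have lim_tu: "(\<lambda>n. SS.nrm ((t \<circ> r) n - (u \<circ> r) n)) \<longlonglongrightarrow> 0"
    using LIMSEQ_subseq_LIMSEQ[OF _ r(1)] by (fastforce simp: o_def)
  then have lim_ut: "(\<lambda>n. SS.nrm ((u \<circ> r) n - (t \<circ> r) n)) \<longlonglongrightarrow> 0"
    using SS.nrm_diff_commute uH t by (simp add: o_def)
  have "L2.nrm ((u \<circ> r) n - (t \<circ> r) n) \<le> SS.nrm ((u \<circ> r) n - (t \<circ> r) n)" for n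
    using I_le_SS uH t by (simp add: L2.nrm_def SS.nrm_def)
  then have "(\<lambda>n. L2.nrm ((u \<circ> r) n - (t \<circ> r) n)) \<longlonglongrightarrow> 0"
    using uH t by (intro tendsto_sandwich[OF _ _ tendsto_const lim_ut]) auto
  then have I_ur: "form_Cauchy I (u \<circ> r)"
    using r(2) uH t by (intro L2.Cauchy_close[of "t \<circ> r" "u \<circ> r"]) auto
  \<comment> \<open>The sum \<open>u m + u n\<close> satisfies the same orthogonality conditions, so
    its energy is at least \<open>m0\<close> times its mass. In the parallelogram law this caps the
    energy of the difference.\<close>
  have par: "EE (u m - u n) (u m - u n) \<le> 2 / real (Suc m) + 2 / real (Suc n) + m0 * I (u m - u n) (u m - u n)" for m n
  proof -
    have "I (u m + u n) (u m + u n) = 4 - I (u m - u n) (u m - u n)"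
      using L2.parallelogram[of "u m" "u n"] u by (simp add: adm_def)
    moreover have "EE (u m - u n) (u m - u n) = 2 * EE (u m) (u m) + 2 * EE (u n) (u n) - EE (u m + u n) (u m + u n)"
      using uH by (simp add: energy.expand)
    moreover have "m0 * I (u m + u n) (u m + u n) \<le> EE (u m + u n) (u m + u n)"
      using u \<phi> by (intro m0_I) (auto simp: adm_def L2.add)
    ultimately show ?thesis using u(2)[of m] u(2)[of n] by (simp add: right_diff_distrib)
  qed
  \<comment> \<open>By \<open>par\<close> the energy minus \<open>m0\<close> times the mass is
    already Cauchy. Adding \<open>C + m0\<close> times the \<open>I\<close>-Cauchy mass recovers
    \<open>SS\<close>, whatever the sign of that coefficient.\<close>
  have "form_Cauchy (\<lambda>u v. EE u v + (- m0) * I u v) (u \<circ> r)"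
    unfolding form_Cauchy_def
  proof (intro allI impI)
    fix e :: real assume "e > 0"
    then obtain M where M: "1 / real (Suc M) < e / 4" using nat_approx_posE[of "e / 4"] by auto
    have "EE (u (r m) - u (r n)) (u (r m) - u (r n)) - m0 * I (u (r m) - u (r n)) (u (r m) - u (r n)) < e"
      if "m \<ge> M" "n \<ge> M" for m n
    proof -
      have "2 / real (Suc (r i)) < e / 2" if "i \<ge> M" for i
      proof -
        have "1 / real (Suc (r i)) \<le> 1 / real (Suc M)"
          using seq_suble[OF r(1), of i] that by (intro divide_left_mono) auto
        then show ?thesis using M by simp
      qed
      from this[OF that(1)] this[OF that(2)] show ?thesis using par[of "r m" "r n"] by simp
    qed
    then show "\<exists>M. \<forall>m\<ge>M. \<forall>n\<ge>M. EE ((u \<circ> r) m - (u \<circ> r) n) ((u \<circ> r) m - (u \<circ> r) n) +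
        - m0 * I ((u \<circ> r) m - (u \<circ> r) n) ((u \<circ> r) m - (u \<circ> r) n) < e" by (intro exI[of _ M]) simp
  qed
  from form_Cauchy_add_scaled[OF this I_ur, of "C + m0"] have "form_Cauchy SS (u \<circ> r)"
    using uH by (simp add: SS_def[abs_def] algebra_simps L2.nonneg)
  \<comment> \<open>Back to the shadowing sequence: membership of the limit in \<open>H\<close> has
    to be witnessed by test functions.\<close>
  then have "form_Cauchy SS (t \<circ> r)"
    using lim_tu uH t by (intro SS.Cauchy_close[of "u \<circ> r" "t \<circ> r"]) auto
  then have S_tr: "form_Cauchy S (t \<circ> r)" using t by (simp add: form_Cauchy_def SS_on_T)
  obtain v where v: "v \<in> L" "(\<lambda>n. I ((t \<circ> r) n - v) ((t \<circ> r) n - v)) \<longlonglongrightarrow> 0"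
    using complete[of "t \<circ> r"] r(2) t by auto
  have ap: "approx (t \<circ> r) v" using approx_iff_S[OF v(1)] S_tr v(2) t by simp
  have vH: "v \<in> H" using H_I[OF v(1) ap] .
  have "(\<lambda>n. SS.nrm ((t \<circ> r) n - v)) \<longlonglongrightarrow> 0"
    using approx_SS_tendsto[OF v(1) ap] SS.tendsto_zero_iff[of "\<lambda>n. (t \<circ> r) n - v"] vH t by auto
  from tendsto_add[OF lim_ut this]
  have lim_sum: "(\<lambda>n. SS.nrm ((u \<circ> r) n - (t \<circ> r) n) + SS.nrm ((t \<circ> r) n - v)) \<longlonglongrightarrow> 0" by simp
  have "(\<lambda>n. SS.nrm (u (r n) - v)) \<longlonglongrightarrow> 0"
    using SS.nrm_triangle_diff[OF uH T_H[OF t(1)] vH] uH vH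
    by (intro tendsto_sandwich[OF _ _ tendsto_const lim_sum]) auto
  then have SS0: "(\<lambda>n. SS (u (r n) - v) (u (r n) - v)) \<longlonglongrightarrow> 0"
    using SS.tendsto_zero_iff[of "\<lambda>n. u (r n) - v"] uH vH by auto
  have I0: "(\<lambda>n. I (u (r n) - v) (u (r n) - v)) \<longlonglongrightarrow> 0"
    using I_le_SS uH vH L2.nonneg by (intro tendsto_sandwich[OF _ _ tendsto_const SS0]) auto
  have limI: "(\<lambda>n. I (u (r n)) (u (r n))) \<longlonglongrightarrow> I v v"
    using uH vH by (intro L2.form_tendsto(2)[OF _ _ _ I0, of v]) auto
  have "I v v = 1" using limI u(1) by (simp add: adm_def LIMSEQ_const_iff)
  moreover have "I v (\<phi> j) = 0" if "j \<in> {1..<k}" for j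
  proof -
    have "(\<lambda>n. I (u (r n)) (\<phi> j)) \<longlonglongrightarrow> I v (\<phi> j)"
      using uH vH \<phi> that by (intro L2.form_tendsto(1)[OF _ _ _ I0]) auto
    then show ?thesis using u(1) that by (simp add: adm_def LIMSEQ_const_iff)
  qed
  ultimately have v_adm: "v \<in> adm k \<phi>" using vH by (simp add: adm_def)
  have "(\<lambda>n. SS (u (r n)) (u (r n))) \<longlonglongrightarrow> SS v v"
    using uH vH by (intro SS.form_tendsto(2)[OF _ _ _ SS0, of v]) auto
  then have "(\<lambda>n. SS (u (r n)) (u (r n)) - C * I (u (r n)) (u (r n))) \<longlonglongrightarrow> SS v v - C * I v v"
    using limI by (intro tendsto_intros)
  then have limE: "(\<lambda>n. EE (u (r n)) (u (r n))) \<longlonglongrightarrow> EE v v" by (simp add: SS_def)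
  have "(\<lambda>n. m0 + 1 / real (Suc (r n))) \<longlonglongrightarrow> m0 + 0"
    using LIMSEQ_subseq_LIMSEQ[OF LIMSEQ_Suc[OF lim_1_over_n] r(1)] by (intro tendsto_intros) (simp add: o_def)
  then have "EE v v \<le> m0" using u(2) by (intro LIMSEQ_le[OF limE]) (auto intro: less_imp_le)
  then show ?thesis using v_adm m0_le by (meson order_trans)
qed

section \<open>Minima do not depend on the chosen minimizers\<close>

definition successive_minimizers :: "nat \<Rightarrow> (nat \<Rightarrow> 'v) \<Rightarrow> bool" where
  "successive_minimizers k \<phi> \<longleftrightarrow>
     (\<forall>j\<in>{1..k}. \<phi> j \<in> adm j \<phi> \<and> (\<forall>v\<in>adm j \<phi>. EE (\<phi> j) (\<phi> j) \<le> EE v v))"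

text \<open>A later minimizer satisfies all constraints of an earlier stage, which gives
  monotonicity. Moreover \<open>\<phi> i + t *\<^sub>R \<phi> j\<close> respects the constraints of
  stage \<open>i\<close> for every \<open>t\<close>, so minimality yields a nonnegative quadratic in
  \<open>t\<close> without constant term; its linear coefficient is the mixed energy and must
  vanish.\<close>

lemma successive_minimizers_orthogonal:
  assumes "successive_minimizers k \<phi>" "i \<in> {1..k}" "j \<in> {1..k}" "i < j"
  shows "I (\<phi> i) (\<phi> j) = 0" "EE (\<phi> i) (\<phi> j) = 0" "EE (\<phi> i) (\<phi> i) \<le> EE (\<phi> j) (\<phi> j)"
proof -
  have adm: "\<phi> l \<in> adm l \<phi>" if "l \<in> {1..k}" for l using assms(1) that by (simp add: successive_minimizers_def)
  have \<phi>H: "\<phi> l \<in> H" "I (\<phi> l) (\<phi> l) = 1" if "l \<in> {1..k}" for l using adm[OF that] by (auto simp: adm_def)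
  have orth: "I (\<phi> m) (\<phi> l) = 0" if "l \<in> {1..k}" "m \<in> {1..k}" "l < m" for l m
    using adm[OF that(2)] that by (simp add: adm_def)
  note H = \<phi>H[OF assms(2)] \<phi>H[OF assms(3)]
  show I: "I (\<phi> i) (\<phi> j) = 0" using orth[OF assms(2,3,4)] H by (subst L2.sym) auto
  have "\<phi> j \<in> adm i \<phi>" using adm[OF assms(3)] assms(4) by (simp add: adm_def)
  then show le: "EE (\<phi> i) (\<phi> i) \<le> EE (\<phi> j) (\<phi> j)"
    using assms(1,2) by (simp add: successive_minimizers_def)
  define e where "e = EE (\<phi> i) (\<phi> j)"
  define d where "d = EE (\<phi> j) (\<phi> j) - EE (\<phi> i) (\<phi> i)"
  have "0 \<le> 2 * t * e + t\<^sup>2 * d" for t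
  proof -
    let ?w = "\<phi> i + t *\<^sub>R \<phi> j"
    have Iw: "I ?w ?w = 1 + t\<^sup>2"
      using H I L2.sym[of "\<phi> i" "\<phi> j"] by (simp add: L2.expand power2_eq_square)
    have w: "?w \<in> H" "\<forall>l\<in>{1..<i}. I ?w (\<phi> l) = 0"
      using H assms \<phi>H(1) orth by (auto simp: L2.expand)
    have pos: "I ?w ?w > 0" using Iw by (simp add: add_pos_nonneg)
    have \<phi>L: "\<forall>l\<in>{1..<i}. \<phi> l \<in> L" using \<phi>H assms by auto
    have "EE (\<phi> i) (\<phi> i) \<le> EE ?w ?w / I ?w ?w"
      using adm_scale[OF w pos \<phi>L] assms(1,2) by (metis successive_minimizers_def)
    then have "EE (\<phi> i) (\<phi> i) * (1 + t\<^sup>2) \<le> EE ?w ?w" using pos Iw by (simp add: field_simps)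
    also have "EE ?w ?w = EE (\<phi> i) (\<phi> i) + 2 * t * e + t\<^sup>2 * EE (\<phi> j) (\<phi> j)"
      using H energy.sym[of "\<phi> i" "\<phi> j"] by (simp add: energy.expand e_def power2_eq_square algebra_simps)
    finally show ?thesis by (simp add: d_def algebra_simps)
  qed
  note quad = this
  have "d \<ge> 0" using le by (simp add: d_def)
  show "EE (\<phi> i) (\<phi> j) = 0"
  proof (rule ccontr)
    assume "EE (\<phi> i) (\<phi> j) \<noteq> 0"
    then have "e \<noteq> 0" by (simp add: e_def)
    \<comment> \<open>At \<open>t = - a\<close> the quadratic equals
      \<open>- (a\<^sup>2 * (d + 2))\<close>. The 1 in the denominator covers the case
      \<open>d = 0\<close>.\<close>
    define a where "a = e / (d + 1)"
    have e: "e = a * (d + 1)" using \<open>d \<ge> 0\<close> by (simp add: a_def)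
    have "2 * (- a) * e + (- a)\<^sup>2 * d = - (a\<^sup>2 * (d + 2))" by (simp add: e algebra_simps power2_eq_square)
    moreover have "a\<^sup>2 * (d + 2) > 0" using \<open>e \<noteq> 0\<close> \<open>d \<ge> 0\<close> by (simp add: e)
    ultimately show False using quad[of "- a"] by linarith
  qed
qed

text \<open>On the span of the first \<open>k\<close> vectors of \<open>\<phi>\<close>, orthogonal
  for both forms, the energy of a unit vector is a convex combination of the values
  \<open>EE (\<phi> j) (\<phi> j)\<close>, hence at most the last one. The vector orthogonal to the
  earlier \<open>\<psi>\<close> competes with \<open>\<psi> k\<close>.\<close>

lemma successive_minima_le:
  assumes \<phi>: "successive_minimizers k \<phi>" and \<psi>: "successive_minimizers k \<psi>" and k: "k \<ge> 1"
  shows "EE (\<psi> k) (\<psi> k) \<le> EE (\<phi> k) (\<phi> k)"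
proof -
  have \<phi>H: "\<phi> j \<in> H" "I (\<phi> j) (\<phi> j) = 1" if "j \<in> {1..k}" for j
    using \<phi> that by (auto simp: successive_minimizers_def adm_def)
  have \<psi>H: "\<psi> j \<in> H" if "j \<in> {1..k}" for j
    using \<psi> that by (auto simp: successive_minimizers_def adm_def)
  obtain c where c: "\<exists>j\<in>{1..k}. c j \<noteq> 0" "\<forall>i\<in>{1..<k}. (\<Sum>j\<in>{1..k}. c j * I (\<phi> j) (\<psi> i)) = 0"
    using homogeneous_system_nontrivial_solution[of "{1..<k}" "{1..k}" "\<lambda>i j. I (\<phi> j) (\<psi> i)"] k by auto
  define w where "w = (\<Sum>j\<in>{1..k}. c j *\<^sub>R \<phi> j)"
  have wH: "w \<in> H" unfolding w_def using \<phi>H by (intro energy.sum_mem) auto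
  have orth: "\<forall>i\<in>{1..<k}. I w (\<psi> i) = 0"
  proof
    fix i assume i: "i \<in> {1..<k}"
    have "I w (\<psi> i) = (\<Sum>j\<in>{1..k}. c j * I (\<phi> j) (\<psi> i))"
      unfolding w_def using \<phi>H \<psi>H[of i] i by (intro L2.sum_left) auto
    then show "I w (\<psi> i) = 0" using c(2) i by simp
  qed
  have zero: "I (\<phi> i) (\<phi> j) = 0" "EE (\<phi> i) (\<phi> j) = 0" if "i \<in> {1..k}" "j \<in> {1..k}" "i \<noteq> j" for i j
    using successive_minimizers_orthogonal(1,2)[OF \<phi>, of i j] successive_minimizers_orthogonal(1,2)[OF \<phi>, of j i]
      that \<phi>H L2.sym[of "\<phi> i" "\<phi> j"] energy.sym[of "\<phi> i" "\<phi> j"] by (metis H_L linorder_neqE_nat)+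
  have Iw: "I w w = (\<Sum>j\<in>{1..k}. (c j)\<^sup>2)"
  proof -
    have "I w w = (\<Sum>j\<in>{1..k}. (c j)\<^sup>2 * I (\<phi> j) (\<phi> j))"
      unfolding w_def using \<phi>H zero by (intro L2.sum_orthogonal) auto
    then show ?thesis using \<phi>H by simp
  qed
  have pos: "I w w > 0"
  proof -
    obtain j where "j \<in> {1..k}" "c j \<noteq> 0" using c(1) by auto
    then show ?thesis unfolding Iw by (intro sum_pos2[of _ j]) auto
  qed
  have "EE w w = (\<Sum>j\<in>{1..k}. (c j)\<^sup>2 * EE (\<phi> j) (\<phi> j))"
    unfolding w_def using \<phi>H zero by (intro energy.sum_orthogonal) auto
  also have "\<dots> \<le> (\<Sum>j\<in>{1..k}. (c j)\<^sup>2 * EE (\<phi> k) (\<phi> k))"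
  proof (intro sum_mono mult_left_mono)
    fix j assume j: "j \<in> {1..k}"
    show "EE (\<phi> j) (\<phi> j) \<le> EE (\<phi> k) (\<phi> k)"
      using successive_minimizers_orthogonal(3)[OF \<phi> j, of k] j k by (cases "j = k") auto
  qed simp
  also have "\<dots> = EE (\<phi> k) (\<phi> k) * I w w" by (simp add: Iw sum_distrib_left mult.commute)
  finally have "EE w w / I w w \<le> EE (\<phi> k) (\<phi> k)" using pos by (simp add: field_simps)
  moreover have "EE (\<psi> k) (\<psi> k) \<le> EE w w / I w w"
  proof -
    have "\<forall>l\<in>{1..<k}. \<psi> l \<in> L" using \<psi>H by auto
    from adm_scale[OF wH orth pos this] show ?thesis
      using \<psi> k by (metis atLeastAtMost_iff order_refl successive_minimizers_def)
  qed
  ultimately show ?thesis by linarith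
qed

lemma successive_minima_unique:
  "\<lbrakk>successive_minimizers k \<phi>; successive_minimizers k \<psi>; k \<ge> 1\<rbrakk> \<Longrightarrow> EE (\<psi> k) (\<psi> k) = EE (\<phi> k) (\<phi> k)"
  using successive_minima_le by (intro antisym) auto

end

section \<open>Transport of a form along an isomorphism\<close>

lemma form_Cauchy_dominated:
  assumes G: "form_Cauchy G U" and D: "form_Cauchy D U" and "a \<ge> 0" "b \<ge> 0"
    and le: "\<And>m n. F (V m - V n) (V m - V n) \<le> a * G (U m - U n) (U m - U n) + b * D (U m - U n) (U m - U n)"
  shows "form_Cauchy F V"
  unfolding form_Cauchy_def
proof (intro allI impI)
  fix e :: real assume e: "e > 0"
  have "e / 2 / (a + 1) > 0" using e assms(3) by simp
  then obtain M where M: "\<And>m n. m \<ge> M \<Longrightarrow> n \<ge> M \<Longrightarrow> G (U m - U n) (U m - U n) < e / 2 / (a + 1)"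
    using G unfolding form_Cauchy_def by blast
  have "e / 2 / (b + 1) > 0" using e assms(4) by simp
  then obtain M' where M': "\<And>m n. m \<ge> M' \<Longrightarrow> n \<ge> M' \<Longrightarrow> D (U m - U n) (U m - U n) < e / 2 / (b + 1)"
    using D unfolding form_Cauchy_def by blast
  have small: "c * x < e / 2" if "c \<ge> 0" "x < e / 2 / (c + 1)" for c x :: real
  proof -
    have "c * x \<le> c * (e / 2 / (c + 1))" using that by (intro mult_left_mono) auto
    also have "\<dots> < e / 2" using that e by (simp add: field_simps)
    finally show ?thesis .
  qed
  have "F (V m - V n) (V m - V n) < e" if "m \<ge> max M M'" "n \<ge> max M M'" for m n
    using le[of m n] small[OF assms(3) M[of m n]] small[OF assms(4) M'[of m n]] that by simp
  then show "\<exists>M. \<forall>m\<ge>M. \<forall>n\<ge>M. F (V m - V n) (V m - V n) < e" by blast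
qed

text \<open>Two closable forms related by a bijection that preserves \<open>I\<close> and lowers the
  energy by \<open>s\<close> times \<open>I\<close>. The energy relation is required on test
  functions only and is extended by limits; the constants \<open>C\<close> and \<open>C'\<close> of
  the two forms are unrelated.\<close>

locale shifted_forms =
  A: closable_form L T I E C + B: closable_form L' T' I' E' C'
  for L T :: "'v::real_vector set" and I E C and L' T' :: "'w::real_vector set" and I' E' C' +
  fixes \<Phi> :: "'v \<Rightarrow> 'w" and \<Psi> :: "'w \<Rightarrow> 'v" and s :: real
  assumes \<Phi>_diff: "\<And>u v. \<Phi> (u - v) = \<Phi> u - \<Phi> v" and \<Psi>_diff: "\<And>u v. \<Psi> (u - v) = \<Psi> u - \<Psi> v"
    and \<Psi>_\<Phi>: "\<And>u. \<Psi> (\<Phi> u) = u" and \<Phi>_\<Psi>: "\<And>w. \<Phi> (\<Psi> w) = w"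
    and \<Phi>_L: "\<And>u. u \<in> L \<Longrightarrow> \<Phi> u \<in> L'" and \<Psi>_L: "\<And>w. w \<in> L' \<Longrightarrow> \<Psi> w \<in> L"
    and \<Phi>_T: "\<And>u. u \<in> T \<Longrightarrow> \<Phi> u \<in> T'" and \<Psi>_T: "\<And>w. w \<in> T' \<Longrightarrow> \<Psi> w \<in> T"
    and I_\<Phi>: "\<And>u v. u \<in> L \<Longrightarrow> v \<in> L \<Longrightarrow> I' (\<Phi> u) (\<Phi> v) = I u v"
    and E_\<Phi>: "\<And>u v. u \<in> T \<Longrightarrow> v \<in> T \<Longrightarrow> E' (\<Phi> u) (\<Phi> v) = E u v - s * I u v"
begin

lemma approx_\<Phi>:
  assumes uL: "u \<in> L" and U: "A.approx U u"
  shows "B.approx (\<lambda>n. \<Phi> (U n)) (\<Phi> u)"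
proof -
  have T: "\<And>n. U n \<in> T" using U by (simp add: A.approx_def)
  have L: "\<And>n. U n \<in> L" using T by simp
  have I: "form_Cauchy I U"
    using U uL L by (intro A.L2.convergent_Cauchy) (auto simp: A.approx_def)
  have "form_Cauchy E' (\<lambda>n. \<Phi> (U n))"
  proof (rule form_Cauchy_dominated[where G = E and D = I and a = 1 and b = "\<bar>s\<bar>"])
    show "form_Cauchy E U" using U by (simp add: A.approx_def)
    fix m n
    have "- s * I (U m - U n) (U m - U n) \<le> \<bar>s\<bar> * I (U m - U n) (U m - U n)"
      using L by (intro mult_right_mono A.L2.nonneg) auto
    then show "E' (\<Phi> (U m) - \<Phi> (U n)) (\<Phi> (U m) - \<Phi> (U n)) \<le>
        1 * E (U m - U n) (U m - U n) + \<bar>s\<bar> * I (U m - U n) (U m - U n)"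
      using T by (simp add: E_\<Phi> flip: \<Phi>_diff)
  qed (use I in auto)
  moreover have "(\<lambda>n. I' (\<Phi> (U n) - \<Phi> u) (\<Phi> (U n) - \<Phi> u)) \<longlonglongrightarrow> 0"
    using U L uL by (simp add: I_\<Phi> A.approx_def flip: \<Phi>_diff)
  ultimately show ?thesis using T \<Phi>_T by (simp add: B.approx_def)
qed

lemma \<Phi>_H:
  assumes "u \<in> A.H" shows "\<Phi> u \<in> B.H"
proof -
  obtain U where "u \<in> L" "A.approx U u" using assms by (rule A.H_E)
  then show ?thesis using B.H_I[OF \<Phi>_L approx_\<Phi>] by blast
qed

text \<open>The relation on test functions passes to the limit because approximating sequences also
  converge in \<open>I\<close>; the mixed limit of \<open>I\<close> is obtained by
  polarization.\<close>

lemma EE_\<Phi>: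
  assumes "u \<in> A.H" "v \<in> A.H"
  shows "B.EE (\<Phi> u) (\<Phi> v) = A.EE u v - s * I u v"
proof -
  obtain U where U: "u \<in> L" "A.approx U u" using assms(1) by (rule A.H_E)
  obtain V where V: "v \<in> L" "A.approx V v" using assms(2) by (rule A.H_E)
  have UT: "\<And>n. U n \<in> T" and VT: "\<And>n. V n \<in> T" using U V by (auto simp: A.approx_def)
  have I: "(\<lambda>n. I (U n) (V n)) \<longlonglongrightarrow> I u v"
  proof -
    have conv: "(\<lambda>n. I (W n) (W n)) \<longlonglongrightarrow> I w w" if "w \<in> L" "A.approx W w" for W w
      using that by (intro A.L2.form_tendsto(2)[of W w w]) (auto simp: A.approx_def)
    have "(\<lambda>n. (I (U n + V n) (U n + V n) - I (U n) (U n) - I (V n) (V n)) / 2) \<longlonglongrightarrow> (I (u + v) (u + v) - I u u - I v v) / 2"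
      using U V by (intro tendsto_intros conv A.approx_add) auto
    moreover have "(I (x + y) (x + y) - I x x - I y y) / 2 = I x y" if "x \<in> L" "y \<in> L" for x y
      using that A.L2.sym[of x y] by (simp add: A.L2.expand)
    ultimately show ?thesis using U V UT VT by simp
  qed
  have "(\<lambda>n. E' (\<Phi> (U n)) (\<Phi> (V n))) \<longlonglongrightarrow> A.EE u v - s * I u v"
    unfolding E_\<Phi>[OF UT VT] using A.EE_tendsto[OF U V] I by (intro tendsto_intros)
  moreover have "(\<lambda>n. E' (\<Phi> (U n)) (\<Phi> (V n))) \<longlonglongrightarrow> B.EE (\<Phi> u) (\<Phi> v)"
    using U V by (intro B.EE_tendsto \<Phi>_L approx_\<Phi>)
  ultimately show ?thesis using LIMSEQ_unique by blast
qed

lemma inverse: "shifted_forms L' T' I' E' C' L T I E C \<Psi> \<Phi> (- s)"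
proof -
  have I: "I (\<Psi> u) (\<Psi> v) = I' u v" if "u \<in> L'" "v \<in> L'" for u v
    using I_\<Phi>[OF \<Psi>_L \<Psi>_L, OF that] by (simp add: \<Phi>_\<Psi>)
  have E: "E (\<Psi> u) (\<Psi> v) = E' u v - (- s) * I' u v" if "u \<in> T'" "v \<in> T'" for u v
    using E_\<Phi>[OF \<Psi>_T \<Psi>_T, OF that] I[of u v] that by (simp add: \<Phi>_\<Psi>)
  show ?thesis
    by unfold_locales (fact \<Phi>_diff \<Psi>_diff \<Psi>_\<Phi> \<Phi>_\<Psi> \<Phi>_L \<Psi>_L \<Phi>_T \<Psi>_T I E)+
qed

text \<open>On unit vectors the two energies differ by the constant \<open>s\<close>, so the
  pullback of successive minimizers consists of successive minimizers again. It need not agree with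
  \<open>\<phi>\<close>, and uniqueness of the minima closes the gap.\<close>

lemma successive_minima_shift:
  assumes \<phi>: "A.successive_minimizers k \<phi>" and \<psi>: "B.successive_minimizers k \<psi>" and k: "k \<ge> 1"
  shows "B.EE (\<psi> k) (\<psi> k) = A.EE (\<phi> k) (\<phi> k) - s"
proof -
  interpret inv: shifted_forms L' T' I' E' C' L T I E C \<Psi> \<Phi> "- s" by (rule inverse)
  define \<eta> where "\<eta> = (\<lambda>j. \<Psi> (\<psi> j))"
  have \<psi>H: "\<psi> j \<in> B.H" "I' (\<psi> j) (\<psi> j) = 1" if "j \<in> {1..k}" for j
    using \<psi> that by (auto simp: B.successive_minimizers_def B.adm_def)
  have EE_\<eta>: "A.EE (\<eta> j) (\<eta> j) = B.EE (\<psi> j) (\<psi> j) + s" if "j \<in> {1..k}" for j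
    using inv.EE_\<Phi>[of "\<psi> j" "\<psi> j"] \<psi>H[OF that] by (simp add: \<eta>_def)
  have "A.successive_minimizers k \<eta>"
    unfolding A.successive_minimizers_def
  proof (intro ballI conjI)
    fix j assume j: "j \<in> {1..k}"
    have \<psi>j: "\<psi> j \<in> B.adm j \<psi>" using \<psi> j by (simp add: B.successive_minimizers_def)
    show "\<eta> j \<in> A.adm j \<eta>"
      using \<psi>j \<psi>H j unfolding A.adm_def B.adm_def \<eta>_def by (simp add: inv.\<Phi>_H inv.I_\<Phi>)
    fix v assume v: "v \<in> A.adm j \<eta>"
    have vH: "v \<in> A.H" "I v v = 1" using v by (auto simp: A.adm_def)
    have "I' (\<Phi> v) (\<psi> i) = 0" if i: "i \<in> {1..<j}" for i
    proof -
      have "I' (\<Phi> v) (\<psi> i) = I v (\<eta> i)"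
        using I_\<Phi>[of v "\<eta> i"] vH \<psi>H(1)[of i] i j \<Psi>_L[of "\<psi> i"] by (simp add: \<eta>_def \<Phi>_\<Psi>)
      then show ?thesis using v i by (simp add: A.adm_def)
    qed
    then have "\<Phi> v \<in> B.adm j \<psi>" using vH by (simp add: B.adm_def \<Phi>_H I_\<Phi>)
    then have "B.EE (\<psi> j) (\<psi> j) \<le> B.EE (\<Phi> v) (\<Phi> v)" using \<psi> j by (simp add: B.successive_minimizers_def)
    then show "A.EE (\<eta> j) (\<eta> j) \<le> A.EE v v" using EE_\<Phi>[OF vH(1) vH(1)] vH(2) EE_\<eta>[OF j] by simp
  qed
  then have "A.EE (\<eta> k) (\<eta> k) = A.EE (\<phi> k) (\<phi> k)" using \<phi> k by (intro A.successive_minima_unique)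
  then show ?thesis using EE_\<eta>[of k] k by simp
qed

end

section \<open>Radial integrals\<close>

definition sphere_area :: "'a::euclidean_space itself \<Rightarrow> real" where
  "sphere_area _ = DIM('a) * unit_ball_vol DIM('a)"

lemma sphere_area_pos: "sphere_area TYPE('a::euclidean_space) > 0"
  by (simp add: sphere_area_def)

text \<open>Polar coordinates for radial functions: both measures assign to a half-line
  \<open>{..r}\<close> the volume of the ball of radius \<open>r\<close>, and the half-lines form a
  generator closed under intersections.\<close>

lemma distr_norm_lborel:
  "distr lborel borel (norm :: 'a::euclidean_space \<Rightarrow> real) =
   density lborel (\<lambda>r. ennreal (sphere_area TYPE('a) * r ^ (DIM('a) - 1)) * indicator {0..} r)"
  (is "?M = ?N")
proof (rule measure_eqI_generator_eq[where E = "range (\<lambda>r::real. {..r})" and A = "\<lambda>n::nat. {..real n}" and \<Omega> = UNIV])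
  show "Int_stable (range (\<lambda>r::real. {..r}))"
    by (auto simp: Int_stable_def min_def)
  show "sets ?M = sigma_sets UNIV (range atMost)" "sets ?N = sigma_sets UNIV (range atMost)"
    by (simp_all add: borel_eq_atMost)
  show "(\<Union>n. {..real n}) = UNIV" using real_arch_simple by auto
  have M: "emeasure ?M {..r} = ennreal (if r < 0 then 0 else unit_ball_vol DIM('a) * r ^ DIM('a))" for r
  proof -
    have "emeasure ?M {..r} = emeasure lborel {x::'a. norm x \<le> r}"
      by (subst emeasure_distr) (auto intro!: arg_cong[where f = "emeasure lborel"])
    also have "\<dots> = ennreal (if r < 0 then 0 else unit_ball_vol DIM('a) * r ^ DIM('a))"
    proof (cases "r < 0")
      case True
      then have "{x::'a. norm x \<le> r} = {}" by (auto dest: order_trans[OF norm_ge_zero])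
      then show ?thesis using True by simp
    next
      case False
      then show ?thesis using emeasure_cball[of r "0::'a"] by (simp add: cball_def)
    qed
    finally show ?thesis .
  qed
  show "emeasure ?M {..real n} \<noteq> \<infinity>" for n by (simp add: M)
  show "emeasure ?M X = emeasure ?N X" if "X \<in> range (\<lambda>r::real. {..r})" for X
  proof -
    from that obtain r where X: "X = {..r}" by auto
    have "emeasure ?N X = (\<integral>\<^sup>+s. ennreal (sphere_area TYPE('a) * s ^ (DIM('a) - 1)) * indicator {0..r} s \<partial>lborel)"
      unfolding X by (subst emeasure_density) (auto intro!: nn_integral_cong split: split_indicator)
    also have "\<dots> = ennreal (if r < 0 then 0 else unit_ball_vol DIM('a) * r ^ DIM('a))"
    proof (cases "r < 0")
      case False
      have "((\<lambda>s. unit_ball_vol DIM('a) * s ^ DIM('a)) has_real_derivative sphere_area TYPE('a) * s ^ (DIM('a) - 1)) (at s)" for s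
        unfolding sphere_area_def by (auto intro!: derivative_eq_intros)
      moreover have "unit_ball_vol DIM('a) * 0 ^ DIM('a) = (0::real)" by (simp add: power_0_left)
      ultimately show ?thesis
        using False sphere_area_pos[where 'a = 'a]
        by (subst nn_integral_FTC_Icc[where F = "\<lambda>s. unit_ball_vol DIM('a) * s ^ DIM('a)"])
           (auto simp: order_less_imp_le)
    qed auto
    finally show ?thesis by (simp add: X M)
  qed
qed auto

lemma nn_integral_radial:
  assumes [measurable]: "f \<in> borel_measurable borel"
  shows "(\<integral>\<^sup>+(x::'a::euclidean_space). f (norm x) \<partial>lborel) =
    (\<integral>\<^sup>+r. ennreal (sphere_area TYPE('a) * r ^ (DIM('a) - 1)) * f r * indicator {0..} r \<partial>lborel)"
proof -
  have "(\<integral>\<^sup>+(x::'a). f (norm x) \<partial>lborel) = (\<integral>\<^sup>+r. f r \<partial>distr lborel borel (norm :: 'a \<Rightarrow> real))"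
    by (simp add: nn_integral_distr)
  also have "\<dots> = (\<integral>\<^sup>+r. ennreal (sphere_area TYPE('a) * r ^ (DIM('a) - 1)) * indicator {0..} r * f r \<partial>lborel)"
    unfolding distr_norm_lborel by (rule nn_integral_density) measurable
  finally show ?thesis by (simp add: mult_ac)
qed

lemma nn_integral_radial_has_integral:
  fixes f :: "real \<Rightarrow> real"
  assumes [measurable]: "f \<in> borel_measurable borel" "A \<in> sets borel" and "A \<subseteq> {0..}"
    and nonneg: "\<And>r. r \<in> A \<Longrightarrow> 0 \<le> f r"
    and I: "((\<lambda>r. r ^ (DIM('a) - 1) * f r) has_integral I) A"
  shows "(\<integral>\<^sup>+(x::'a::euclidean_space). ennreal (f (norm x)) * indicator A (norm x) \<partial>lborel) = ennreal (sphere_area TYPE('a) * I)"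
proof -
  have "(\<integral>\<^sup>+(x::'a). ennreal (f (norm x)) * indicator A (norm x) \<partial>lborel) =
    (\<integral>\<^sup>+r. ennreal (sphere_area TYPE('a) * r ^ (DIM('a) - 1)) * (ennreal (f r) * indicator A r) * indicator {0..} r \<partial>lborel)"
    by (rule nn_integral_radial) measurable
  also have "\<dots> = (\<integral>\<^sup>+r. ennreal (sphere_area TYPE('a) * (r ^ (DIM('a) - 1) * f r)) * indicator A r \<partial>lborel)"
  proof (intro nn_integral_cong)
    fix r :: real
    show "ennreal (sphere_area TYPE('a) * r ^ (DIM('a) - 1)) * (ennreal (f r) * indicator A r) * indicator {0..} r =
      ennreal (sphere_area TYPE('a) * (r ^ (DIM('a) - 1) * f r)) * indicator A r"
    proof (cases "r \<in> A")
      case True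
      then have "r \<ge> 0" "f r \<ge> 0" using assms(3) nonneg by auto
      then show ?thesis using True sphere_area_pos[where 'a = 'a]
        by (simp add: ennreal_mult[symmetric] mult.assoc)
    qed simp
  qed
  also have "\<dots> = ennreal (sphere_area TYPE('a) * I)"
    using assms(3) nonneg sphere_area_pos[where 'a = 'a] has_integral_mult_right[OF I, of "sphere_area TYPE('a)"]
    by (intro nn_integral_has_integral_lebesgue') (auto simp: subset_eq order_less_imp_le)
  finally show ?thesis .
qed

lemma nn_integral_radial_powr_atLeast:
  assumes "a > 0" "e > 0"
  shows "(\<integral>\<^sup>+(y::'a::euclidean_space). ennreal (norm y powr (- real DIM('a) - e)) * indicator {a..} (norm y) \<partial>lborel)
    = ennreal (sphere_area TYPE('a) * (a powr (- e) / e))"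
proof (rule nn_integral_radial_has_integral)
  have "((\<lambda>r. r powr (- 1 - e)) has_integral - (a powr (- 1 - e + 1)) / (- 1 - e + 1)) {a..}"
    using assms by (intro has_integral_powr_to_inf) auto
  moreover have "r ^ (DIM('a) - 1) * r powr (- real DIM('a) - e) = r powr (- 1 - e)" if "r \<in> {a..}" for r
    using that assms DIM_positive[where 'a = 'a]
    by (simp add: powr_realpow[symmetric] powr_add[symmetric] of_nat_diff Suc_leI)
  ultimately show "((\<lambda>r. r ^ (DIM('a) - 1) * r powr (- real DIM('a) - e)) has_integral a powr (- e) / e) {a..}"
    by (subst has_integral_cong[where g = "\<lambda>r. r powr (- 1 - e)"]) auto
qed (use assms in auto)

lemma nn_integral_radial_powr_atMost:
  assumes "a \<ge> 0" "e > 0"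
  shows "(\<integral>\<^sup>+(y::'a::euclidean_space). ennreal (norm y powr (e - real DIM('a))) * indicator {0..a} (norm y) \<partial>lborel)
    = ennreal (sphere_area TYPE('a) * (a powr e / e))"
proof (rule nn_integral_radial_has_integral)
  have "((\<lambda>r. r powr (e - 1)) has_integral a powr (e - 1 + 1) / (e - 1 + 1)) {0..a}"
    using assms by (intro has_integral_powr_from_0) auto
  moreover have "r ^ (DIM('a) - 1) * r powr (e - real DIM('a)) = r powr (e - 1)" if "r \<in> {0..a}" for r
  proof (cases "r = 0")
    case False
    then show ?thesis using that DIM_positive[where 'a = 'a]
      by (simp add: powr_realpow[symmetric] powr_add[symmetric] of_nat_diff Suc_leI)
  qed simp
  ultimately show "((\<lambda>r. r ^ (DIM('a) - 1) * r powr (e - real DIM('a))) has_integral a powr e / e) {0..a}"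
    by (subst has_integral_cong[where g = "\<lambda>r. r powr (e - 1)"]) auto
qed (use assms in auto)

text \<open>In degree exactly \<open>- DIM('a)\<close> the radial integrand is \<open>1 / r\<close>.
  This is the source of both the Hardy potential and the logarithmic shift under dilations.\<close>

lemma nn_integral_annulus:
  assumes "0 < a" "a \<le> b"
  shows "(\<integral>\<^sup>+(y::'a::euclidean_space). ennreal (1 / norm y ^ DIM('a)) * indicator {a..<b} (norm y) \<partial>lborel)
    = ennreal (sphere_area TYPE('a) * ln (b / a))"
proof (rule nn_integral_radial_has_integral)
  have "((\<lambda>r. 1 / r) has_integral ln b - ln a) {a..b}"
    using assms by (intro fundamental_theorem_of_calculus)
      (auto intro!: derivative_eq_intros simp: has_real_derivative_iff_has_vector_derivative[symmetric])
  then have "((\<lambda>r. 1 / r) has_integral ln b - ln a) {a..<b}"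
    by (subst has_integral_spike_set_eq[where T = "{a..b}"]) (auto intro!: negligible_subset[OF negligible_sing[of b]])
  moreover have "r ^ (DIM('a) - 1) * (1 / r ^ DIM('a)) = 1 / r" if "r \<in> {a..<b}" for r
    using that assms DIM_positive[where 'a = 'a] by (simp add: field_simps power_Suc[symmetric])
  ultimately show "((\<lambda>r. r ^ (DIM('a) - 1) * (1 / r ^ DIM('a))) has_integral ln (b / a)) {a..<b}"
    using assms by (subst has_integral_cong[where g = "\<lambda>r. 1 / r"]) (auto simp: ln_div)
qed (use assms in auto)

text \<open>The normalization of the operator. It fixes the factor 2 in the scaling shift and makes
  the Hardy inequality below match the energy exactly.\<close>

lemma c_const_sphere_area: "c_const CARD('n::finite) * sphere_area TYPE(real ^ 'n) = 2"
proof -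
  define N where "N = real CARD('n)"
  have N: "N > 0" by (simp add: N_def)
  have "Gamma (N / 2 + 1) = N / 2 * Gamma (N / 2)" using N by (intro Gamma_plus1) (auto simp: nonpos_Ints_def)
  moreover have "Gamma (N / 2) > 0" "Gamma (N / 2 + 1) > 0" using N by (auto intro!: Gamma_real_pos)
  ultimately have "Gamma (N / 2) * N / Gamma (N / 2 + 1) = 2" by (simp add: field_simps)
  then show ?thesis using N pi_gt_zero
    by (simp add: c_const_def sphere_area_def unit_ball_vol_def add_divide_distrib flip: N_def)
qed

lemma c_const_pos: "c_const CARD('n::finite) > 0"
  by (auto simp: c_const_def intro!: divide_pos_pos Gamma_real_pos)

section \<open>The logarithmic Hardy inequality\<close>

text \<open>At the origin the quotient is 0 by convention, so the diagonal contributes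
  nothing.\<close>

definition near_kernel :: "'a::euclidean_space \<Rightarrow> real" where
  "near_kernel z = indicator {..<1} (norm z) / norm z ^ DIM('a)"

lemma near_kernel_nonneg [simp]: "0 \<le> near_kernel z" by (simp add: near_kernel_def)

lemma near_kernel_measurable [measurable]: "near_kernel \<in> borel_measurable borel"
  unfolding near_kernel_def[abs_def] by measurable

lemma near_kernel_minus_commute: "near_kernel (x - y) = near_kernel (y - x)"
  by (simp add: near_kernel_def norm_minus_commute)

text \<open>Restricting the ground state argument to pairs of points whose norms differ by a factor of at
  least 2 keeps the leading constant of the Hardy inequality and avoids principal values.\<close>
definition gap_kernel :: "'a::euclidean_space \<Rightarrow> 'a \<Rightarrow> real" where
  "gap_kernel x y = (if x \<noteq> 0 \<and> y \<noteq> 0 \<and> (2 * norm x \<le> norm y \<or> 2 * norm y \<le> norm x) then near_kernel (x - y) else 0)"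

lemma gap_kernel_nonneg [simp]: "0 \<le> gap_kernel x y" by (simp add: gap_kernel_def)

lemma gap_kernel_commute: "gap_kernel x y = gap_kernel y x"
  using near_kernel_minus_commute[of x y] by (auto simp: gap_kernel_def)

lemma gap_kernel_measurable [measurable]:
  assumes [measurable]: "f \<in> borel_measurable M" "g \<in> borel_measurable M"
  shows "(\<lambda>x. gap_kernel (f x) (g x)) \<in> borel_measurable M"
  unfolding gap_kernel_def by measurable

text \<open>The weight ratio \<open>w y / w x\<close> for \<open>w x = \<bar>x\<bar> powr (- N / 2)\<close>.\<close>
definition weight_ratio :: "'a::euclidean_space \<Rightarrow> 'a \<Rightarrow> real" where
  "weight_ratio x y = (norm x / norm y) powr (DIM('a) / 2)"

lemma weight_ratio_nonneg [simp]: "0 \<le> weight_ratio x y" by (simp add: weight_ratio_def)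

lemma weight_ratio_measurable [measurable]:
  assumes [measurable]: "f \<in> borel_measurable M" "g \<in> borel_measurable M"
  shows "(\<lambda>x. weight_ratio (f x) (g x)) \<in> borel_measurable M"
  unfolding weight_ratio_def by measurable

text \<open>Pointwise ground state substitution. For the ratio \<open>q\<close> of the weights at
  the two points, \<open>(a * q - b)\<^sup>2 / q \<ge> 0\<close> expands to
  \<open>2 * a * b \<le> a\<^sup>2 * q + b\<^sup>2 / q\<close>, which is inserted in the expansion
  of \<open>(a - b)\<^sup>2\<close>.\<close>

lemma gap_kernel_ground_state:
  fixes a b :: real
  shows "a\<^sup>2 * gap_kernel x y + b\<^sup>2 * gap_kernel x y \<le>
    near_kernel (x - y) * (a - b)\<^sup>2 + a\<^sup>2 * (gap_kernel x y * weight_ratio x y) + b\<^sup>2 * (gap_kernel y x * weight_ratio y x)"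
proof (cases "gap_kernel x y = 0")
  case True
  then show ?thesis using gap_kernel_commute[of x y] by simp
next
  case False
  then have xy: "x \<noteq> 0" "y \<noteq> 0" "gap_kernel x y = near_kernel (x - y)"
    by (auto simp: gap_kernel_def split: if_splits)
  define q where "q = weight_ratio x y"
  have q: "q > 0" using xy by (simp add: q_def weight_ratio_def)
  have q': "weight_ratio y x = 1 / q" using xy by (simp add: q_def weight_ratio_def powr_divide)
  have "0 \<le> (a * q - b)\<^sup>2 / q" using q by simp
  also have "\<dots> = a\<^sup>2 * q + b\<^sup>2 * (1 / q) - 2 * a * b" using q by (simp add: field_simps power2_eq_square)
  finally have "a\<^sup>2 + b\<^sup>2 \<le> (a - b)\<^sup>2 + a\<^sup>2 * q + b\<^sup>2 * (1 / q)" by (simp add: power2_diff)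
  from mult_left_mono[OF this near_kernel_nonneg[of "x - y"]] show ?thesis
    using xy gap_kernel_commute[of x y] by (simp add: q' algebra_simps flip: q_def)
qed

text \<open>The gap makes \<open>norm (x - y)\<close> comparable to the larger of the two norms.
  Against the weight with exponent half the dimension, the kernel is then integrable at infinity in
  the outer region and at the origin in the inner one, and homogeneity removes the dependence on
  \<open>x\<close>. Each region contributes one half of the constant.\<close>

lemma gap_kernel_weight_bound:
  fixes x :: "'a::euclidean_space"
  shows "(\<integral>\<^sup>+y. ennreal (gap_kernel x y * weight_ratio x y) \<partial>lborel) \<le> ennreal (2 ^ DIM('a) * sphere_area TYPE('a) * (4 / DIM('a)))"
proof (cases "x = 0")
  case True
  then show ?thesis by (simp add: gap_kernel_def)
next
  case False
  define N where "N = real DIM('a)"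
  define r where "r = norm x"
  have r: "r > 0" using False by (simp add: r_def)
  have N: "N > 0" by (simp add: N_def)
  have near_le: "near_kernel (x - y) \<le> 2 ^ DIM('a) * d powr (- N)" if "d > 0" "norm (x - y) \<ge> d / 2" for y d
  proof -
    have "near_kernel (x - y) \<le> 1 / norm (x - y) ^ DIM('a)"
      by (simp add: near_kernel_def indicator_def)
    also have "\<dots> \<le> 1 / (d / 2) ^ DIM('a)"
      using that by (intro divide_left_mono power_mono mult_pos_pos zero_less_power) auto
    also have "\<dots> = 2 ^ DIM('a) * d powr (- N)"
      using that by (simp add: N_def powr_minus powr_realpow field_simps)
    finally show ?thesis .
  qed
  have weight: "weight_ratio x y = r powr (N / 2) * norm y powr (- (N / 2))" if "y \<noteq> 0" for y
    using that by (simp add: weight_ratio_def N_def r_def powr_divide powr_minus field_simps)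
  have pt: "ennreal (gap_kernel x y * weight_ratio x y) \<le>
      ennreal (2 ^ DIM('a) * r powr (N / 2)) * (ennreal (norm y powr (- N - N / 2)) * indicator {2 * r..} (norm y)) +
      ennreal (2 ^ DIM('a) * r powr (- N / 2)) * (ennreal (norm y powr (N / 2 - N)) * indicator {0..r / 2} (norm y))" for y
  proof -
    consider "gap_kernel x y = 0" | "y \<noteq> 0" "2 * r \<le> norm y" "gap_kernel x y = near_kernel (x - y)"
      | "y \<noteq> 0" "2 * norm y \<le> r" "gap_kernel x y = near_kernel (x - y)"
      unfolding gap_kernel_def r_def by metis
    then show ?thesis
    proof cases
      case 2
      have "norm (x - y) \<ge> norm y / 2" using norm_triangle_ineq2[of y x] 2 by (simp add: r_def norm_minus_commute)
      then have "near_kernel (x - y) \<le> 2 ^ DIM('a) * norm y powr (- N)" using 2 by (intro near_le) auto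
      note * = mult_right_mono[OF this weight_ratio_nonneg[of x y]]
      have "gap_kernel x y * weight_ratio x y \<le> 2 ^ DIM('a) * r powr (N / 2) * (norm y powr (- N) * norm y powr (- (N / 2)))"
        using * 2 by (simp add: weight mult_ac)
      also have "norm y powr (- N) * norm y powr (- (N / 2)) = norm y powr (- N - N / 2)"
        unfolding powr_add[symmetric] by simp
      finally have "gap_kernel x y * weight_ratio x y \<le> 2 ^ DIM('a) * r powr (N / 2) * norm y powr (- N - N / 2)" .
      then show ?thesis using 2 by (simp add: ennreal_mult[symmetric] add_increasing2 ennreal_leI)
    next
      case 3
      have "norm (x - y) \<ge> r / 2" using norm_triangle_ineq2[of x y] 3 by (simp add: r_def)
      then have "near_kernel (x - y) \<le> 2 ^ DIM('a) * r powr (- N)" using r by (intro near_le) auto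
      from mult_right_mono[OF this weight_ratio_nonneg[of x y]]
      have "gap_kernel x y * weight_ratio x y \<le> 2 ^ DIM('a) * (r powr (- N) * r powr (N / 2)) * norm y powr (- (N / 2))"
        using 3 by (simp add: weight mult_ac)
      also have "r powr (- N) * r powr (N / 2) = r powr (- N / 2)" by (simp add: powr_add[symmetric] field_simps)
      finally have "gap_kernel x y * weight_ratio x y \<le> 2 ^ DIM('a) * r powr (- N / 2) * norm y powr (N / 2 - N)" by simp
      then show ?thesis using 3 by (simp add: ennreal_mult[symmetric] add_increasing ennreal_leI)
    qed simp
  qed
  have "(\<integral>\<^sup>+y. ennreal (gap_kernel x y * weight_ratio x y) \<partial>lborel) \<le>
      ennreal (2 ^ DIM('a) * r powr (N / 2)) * ennreal (sphere_area TYPE('a) * ((2 * r) powr (- (N / 2)) / (N / 2))) +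
      ennreal (2 ^ DIM('a) * r powr (- N / 2)) * ennreal (sphere_area TYPE('a) * ((r / 2) powr (N / 2) / (N / 2)))"
    using r N nn_integral_radial_powr_atLeast[where 'a = 'a, of "2 * r" "N / 2"] nn_integral_radial_powr_atMost[where 'a = 'a, of "r / 2" "N / 2"]
    by (intro order_trans[OF nn_integral_mono[OF pt]]) (simp add: nn_integral_add nn_integral_cmult N_def)
  also have "\<dots> = ennreal (2 ^ DIM('a) * r powr (N / 2) * (sphere_area TYPE('a) * ((2 * r) powr (- (N / 2)) / (N / 2))) +
      2 ^ DIM('a) * r powr (- N / 2) * (sphere_area TYPE('a) * ((r / 2) powr (N / 2) / (N / 2))))"
    using N sphere_area_pos[where 'a = 'a] by (simp add: ennreal_mult[symmetric] order_less_imp_le flip: ennreal_plus)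
  also have "\<dots> \<le> ennreal (2 ^ DIM('a) * sphere_area TYPE('a) * (2 / N) + 2 ^ DIM('a) * sphere_area TYPE('a) * (2 / N))"
  proof (intro ennreal_leI add_mono)
    \<comment> \<open>The powers of \<open>r\<close> cancel and leave this factor from the gap of 2,
      which is discarded.\<close>
    have half: "2 powr (- (N / 2)) \<le> (1::real)" using N powr_mono[of "- (N / 2)" 0 2] by simp
    have "r powr (N / 2) * (2 * r) powr (- (N / 2)) = 2 powr (- (N / 2))"
      using r by (simp add: powr_mult powr_minus field_simps)
    then have "r powr (N / 2) * (2 * r) powr (- (N / 2)) \<le> 1" using half by simp
    from mult_left_mono[OF this, of "2 ^ DIM('a) * sphere_area TYPE('a) * (2 / N)"]
    show "2 ^ DIM('a) * r powr (N / 2) * (sphere_area TYPE('a) * ((2 * r) powr (- (N / 2)) / (N / 2))) \<le> 2 ^ DIM('a) * sphere_area TYPE('a) * (2 / N)"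
      using N sphere_area_pos[where 'a = 'a] by (simp add: mult_ac)
    have "r powr (- N / 2) * (r / 2) powr (N / 2) = 2 powr (- (N / 2))"
      using r by (simp add: powr_divide powr_minus field_simps)
    then have "r powr (- N / 2) * (r / 2) powr (N / 2) \<le> 1" using half by simp
    from mult_left_mono[OF this, of "2 ^ DIM('a) * sphere_area TYPE('a) * (2 / N)"]
    show "2 ^ DIM('a) * r powr (- N / 2) * (sphere_area TYPE('a) * ((r / 2) powr (N / 2) / (N / 2))) \<le> 2 ^ DIM('a) * sphere_area TYPE('a) * (2 / N)"
      using N sphere_area_pos[where 'a = 'a] by (simp add: mult_ac)
  qed
  finally show ?thesis by (simp add: N_def mult_ac)
qed

text \<open>For \<open>y\<close> in the shell \<open>2 * r \<le> norm y < 1 - r\<close> the distance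
  to \<open>x\<close> is below 1, so the kernel is active, and it is nearly
  \<open>1 / norm y ^ DIM('a)\<close>. Integrating over the shell produces
  \<open>ln ((1 - r) / (2 * r))\<close> with the full area of the sphere as coefficient; everything
  else is a bounded error.\<close>

lemma log_le_gap_kernel:
  fixes x :: "'a::euclidean_space"
  shows "ennreal (sphere_area TYPE('a) * max 0 (ln (1 / norm x))) \<le>
    (\<integral>\<^sup>+y. ennreal (gap_kernel x y) \<partial>lborel) + ennreal (sphere_area TYPE('a) * (ln 3 + DIM('a) / 2))"
proof (cases "x = 0 \<or> norm x \<ge> 1 / 3")
  case True
  have "ln (1 / norm x) \<le> ln 3" if "x \<noteq> 0" using that True by (subst ln_le_cancel_iff) (auto simp: field_simps)
  then have "max 0 (ln (1 / norm x)) \<le> ln 3 + DIM('a) / 2" by (cases "x = 0") (auto simp: add_increasing2)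
  then show ?thesis using sphere_area_pos[where 'a = 'a] by (simp add: add_increasing ennreal_leI)
next
  case False
  define N where "N = real DIM('a)"
  define r where "r = norm x"
  have r: "0 < r" "r < 1 / 3" using False by (auto simp: r_def)
  have N: "N \<ge> 1" using DIM_positive[where 'a = 'a] by (simp add: N_def Suc_leI)
  have pt: "ennreal (1 / norm y ^ DIM('a)) * indicator {2 * r..<1 - r} (norm y) \<le>
      ennreal (gap_kernel x y) + ennreal (N * r) * (ennreal (norm y powr (- N - 1)) * indicator {2 * r..} (norm y))" for y
  proof (cases "norm y \<in> {2 * r..<1 - r}")
    case True
    define s where "s = norm y"
    have s: "s \<ge> 2 * r" "s < 1 - r" "s > 0" using True r by (auto simp: s_def)
    have le: "norm (x - y) \<le> s + r" using norm_triangle_ineq4[of x y] by (simp add: s_def r_def)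
    have "norm (x - y) > 0" using s r by (auto simp: s_def r_def)
    then have "1 / (s + r) ^ DIM('a) \<le> 1 / norm (x - y) ^ DIM('a)"
      using le s r by (intro divide_left_mono power_mono mult_pos_pos zero_less_power) auto
    also have "\<dots> = gap_kernel x y"
      using s r le by (auto simp: gap_kernel_def near_kernel_def s_def r_def indicator_def)
    finally have 1: "1 / (s + r) ^ DIM('a) \<le> gap_kernel x y" .
    \<comment> \<open>Bernoulli's inequality for the power of
      \<open>s / (s + r) = 1 - r / (s + r)\<close>: replacing \<open>s + r\<close> by
      \<open>s\<close> costs one extra power of \<open>r / s\<close>, whose integral over the
      exterior of radius \<open>2 * r\<close> is bounded independently of \<open>r\<close>.\<close>
    have "1 - N * r / s \<le> 1 + N * (- r / (s + r))"
      using s r N by (simp add: divide_left_mono)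
    also have "\<dots> \<le> (1 + (- r / (s + r))) ^ DIM('a)"
      unfolding N_def using s r by (intro Bernoulli_inequality) (simp add: field_simps)
    also have "\<dots> = s ^ DIM('a) / (s + r) ^ DIM('a)" using s r by (simp add: field_simps flip: power_divide)
    finally have "1 \<le> s ^ DIM('a) / (s + r) ^ DIM('a) + N * r / s" by simp
    then have "1 / s ^ DIM('a) \<le> (s ^ DIM('a) / (s + r) ^ DIM('a) + N * r / s) / s ^ DIM('a)"
      using s by (intro divide_right_mono) auto
    also have "\<dots> = 1 / (s + r) ^ DIM('a) + N * r * s powr (- N - 1)"
    proof -
      have "s powr (- N - 1) = 1 / (s * s ^ DIM('a))"
        using s powr_realpow[of s "DIM('a)"] by (simp add: powr_diff powr_minus N_def field_simps)
      then show ?thesis using s by (simp add: add_divide_distrib)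
    qed
    finally have "1 / s ^ DIM('a) \<le> gap_kernel x y + N * r * s powr (- N - 1)" using 1 by simp
    then show ?thesis using True N r
      by (simp add: s_def ennreal_mult[symmetric] ennreal_leI flip: ennreal_plus)
  qed simp
  have "ennreal (sphere_area TYPE('a) * ln ((1 - r) / (2 * r))) =
      (\<integral>\<^sup>+(y::'a). ennreal (1 / norm y ^ DIM('a)) * indicator {2 * r..<1 - r} (norm y) \<partial>lborel)"
    using r by (subst nn_integral_annulus) auto
  also have "\<dots> \<le> (\<integral>\<^sup>+y. (ennreal (gap_kernel x y) +
      ennreal (N * r) * (ennreal (norm y powr (- N - 1)) * indicator {2 * r..} (norm y))) \<partial>lborel)"
    by (intro nn_integral_mono pt)
  also have "\<dots> = (\<integral>\<^sup>+y. ennreal (gap_kernel x y) \<partial>lborel) + ennreal (N * r) * ennreal (sphere_area TYPE('a) * ((2 * r) powr (- 1) / 1))"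
    unfolding N_def using r by (simp add: nn_integral_add nn_integral_cmult nn_integral_radial_powr_atLeast del: powr_neg_one powr_minus)
  also have "ennreal (N * r) * ennreal (sphere_area TYPE('a) * ((2 * r) powr (- 1) / 1)) = ennreal (sphere_area TYPE('a) * (N / 2))"
    using r N sphere_area_pos[where 'a = 'a] by (simp add: ennreal_mult[symmetric] powr_minus field_simps order_less_imp_le)
  finally have 1: "ennreal (sphere_area TYPE('a) * ln ((1 - r) / (2 * r))) \<le>
      (\<integral>\<^sup>+y. ennreal (gap_kernel x y) \<partial>lborel) + ennreal (sphere_area TYPE('a) * (N / 2))" .
  have "max 0 (ln (1 / r)) = ln (1 / r)" using r by simp
  \<comment> \<open>Equivalent to \<open>2 \<le> 3 * (1 - r)\<close>, which is the reason for the
    threshold 1/3.\<close>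
  also have "\<dots> \<le> ln (3 * ((1 - r) / (2 * r)))" using r by (subst ln_le_cancel_iff) (auto simp: field_simps)
  also have "\<dots> = ln 3 + ln ((1 - r) / (2 * r))" using r by (intro ln_mult_pos) auto
  finally have "sphere_area TYPE('a) * max 0 (ln (1 / r)) \<le> sphere_area TYPE('a) * (ln 3 + ln ((1 - r) / (2 * r)))"
    using sphere_area_pos[where 'a = 'a] by simp
  also have "\<dots> = sphere_area TYPE('a) * ln ((1 - r) / (2 * r)) + sphere_area TYPE('a) * ln 3" by (simp add: algebra_simps)
  finally have "ennreal (sphere_area TYPE('a) * max 0 (ln (1 / r))) \<le>
      ennreal (sphere_area TYPE('a) * ln ((1 - r) / (2 * r)) + sphere_area TYPE('a) * ln 3)" by (rule ennreal_leI)
  also have "\<dots> = ennreal (sphere_area TYPE('a) * ln ((1 - r) / (2 * r))) + ennreal (sphere_area TYPE('a) * ln 3)"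
    using r sphere_area_pos[where 'a = 'a] by (intro ennreal_plus) auto
  also have "\<dots> \<le> (\<integral>\<^sup>+y. ennreal (gap_kernel x y) \<partial>lborel) + ennreal (sphere_area TYPE('a) * (N / 2)) + ennreal (sphere_area TYPE('a) * ln 3)"
    using 1 by (rule add_right_mono)
  also have "\<dots> = (\<integral>\<^sup>+y. ennreal (gap_kernel x y) \<partial>lborel) + ennreal (sphere_area TYPE('a) * (ln 3 + N / 2))"
    using N sphere_area_pos[where 'a = 'a] by (simp add: distrib_left add_ac add.assoc flip: ennreal_plus)
  finally show ?thesis by (simp add: r_def N_def)
qed

lemma nn_integral_symmetric_kernel:
  fixes k :: "'a::euclidean_space \<Rightarrow> 'a \<Rightarrow> real" and u :: "'a \<Rightarrow> real"
  assumes [measurable]: "u \<in> borel_measurable borel" "case_prod k \<in> borel_measurable (borel \<Otimes>\<^sub>M borel)"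
    and nonneg: "\<And>x y. k x y \<ge> 0"
  shows "(\<integral>\<^sup>+x. \<integral>\<^sup>+y. ennreal ((u x)\<^sup>2 * k x y + (u y)\<^sup>2 * k y x) \<partial>lborel \<partial>lborel) =
    2 * (\<integral>\<^sup>+x. ennreal ((u x)\<^sup>2) * (\<integral>\<^sup>+y. ennreal (k x y) \<partial>lborel) \<partial>lborel)"
proof -
  have 1: "(\<integral>\<^sup>+x. \<integral>\<^sup>+y. ennreal ((u x)\<^sup>2) * ennreal (k x y) \<partial>lborel \<partial>lborel) =
      (\<integral>\<^sup>+x. ennreal ((u x)\<^sup>2) * (\<integral>\<^sup>+y. ennreal (k x y) \<partial>lborel) \<partial>lborel)"
    by (intro nn_integral_cong nn_integral_cmult) measurable
  have "(\<integral>\<^sup>+x. \<integral>\<^sup>+y. ennreal ((u y)\<^sup>2) * ennreal (k y x) \<partial>lborel \<partial>lborel) =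
      (\<integral>\<^sup>+y. \<integral>\<^sup>+x. ennreal ((u y)\<^sup>2) * ennreal (k y x) \<partial>lborel \<partial>lborel)"
    by (rule lborel_pair.Fubini') measurable
  with 1 show ?thesis
    using nonneg by (simp add: ennreal_mult nn_integral_add mult_2 flip: 1)
qed

text \<open>The potential is at most twice the gap-kernel integral of \<open>(u x)\<^sup>2\<close>
  up to mass; the symmetrized ground state inequality bounds that by the quadratic form plus the
  weighted gap integral, which is again a multiple of the mass. Only the two remainder estimates
  enter the constant in front of the mass.\<close>

lemma log_Hardy_inequality:
  fixes u :: "'a::euclidean_space \<Rightarrow> real"
  assumes [measurable]: "u \<in> borel_measurable borel"
  shows "(\<integral>\<^sup>+x. ennreal (2 * sphere_area TYPE('a) * max 0 (ln (1 / norm x)) * (u x)\<^sup>2) \<partial>lborel) \<le>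
    (\<integral>\<^sup>+x. \<integral>\<^sup>+y. ennreal (near_kernel (x - y) * (u x - u y)\<^sup>2) \<partial>lborel \<partial>lborel) +
    ennreal (2 * sphere_area TYPE('a) * (2 ^ DIM('a) * (4 / DIM('a)) + ln 3 + DIM('a) / 2)) * (\<integral>\<^sup>+x. ennreal ((u x)\<^sup>2) \<partial>lborel)"
proof -
  define \<sigma> where "\<sigma> = sphere_area TYPE('a)"
  define D where "D = 2 ^ DIM('a) * (4 / real DIM('a))"
  define D' where "D' = ln 3 + real DIM('a) / 2"
  define J where "J = (\<integral>\<^sup>+x. \<integral>\<^sup>+y. ennreal (near_kernel (x - y) * (u x - u y)\<^sup>2) \<partial>lborel \<partial>lborel)"
  define W where "W = (\<integral>\<^sup>+x. ennreal ((u x)\<^sup>2) * (\<integral>\<^sup>+y. ennreal (gap_kernel x y) \<partial>lborel) \<partial>lborel)"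
  define U where "U = (\<integral>\<^sup>+x. ennreal ((u x)\<^sup>2) \<partial>lborel)"
  have \<sigma>: "\<sigma> > 0" using sphere_area_pos by (simp add: \<sigma>_def)
  have D: "D \<ge> 0" "D' \<ge> 0" by (simp_all add: D_def D'_def)
  have "2 * W = (\<integral>\<^sup>+x. \<integral>\<^sup>+y. ennreal ((u x)\<^sup>2 * gap_kernel x y + (u y)\<^sup>2 * gap_kernel y x) \<partial>lborel \<partial>lborel)"
    unfolding W_def by (subst nn_integral_symmetric_kernel) auto
  also have "\<dots> \<le> (\<integral>\<^sup>+x. \<integral>\<^sup>+y. (ennreal (near_kernel (x - y) * (u x - u y)\<^sup>2) +
      ennreal ((u x)\<^sup>2 * (gap_kernel x y * weight_ratio x y) + (u y)\<^sup>2 * (gap_kernel y x * weight_ratio y x))) \<partial>lborel \<partial>lborel)"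
  proof (intro nn_integral_mono)
    fix x y :: 'a
    show "ennreal ((u x)\<^sup>2 * gap_kernel x y + (u y)\<^sup>2 * gap_kernel y x) \<le>
        ennreal (near_kernel (x - y) * (u x - u y)\<^sup>2) +
        ennreal ((u x)\<^sup>2 * (gap_kernel x y * weight_ratio x y) + (u y)\<^sup>2 * (gap_kernel y x * weight_ratio y x))"
      using gap_kernel_ground_state[of "u x" x y "u y"] gap_kernel_commute[of y x]
      by (simp add: add.assoc ennreal_leI flip: ennreal_plus)
  qed
  also have "\<dots> = J + (\<integral>\<^sup>+x. \<integral>\<^sup>+y. ennreal ((u x)\<^sup>2 * (gap_kernel x y * weight_ratio x y) + (u y)\<^sup>2 * (gap_kernel y x * weight_ratio y x)) \<partial>lborel \<partial>lborel)"
    unfolding J_def by (simp add: nn_integral_add)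
  also have "(\<integral>\<^sup>+x. \<integral>\<^sup>+y. ennreal ((u x)\<^sup>2 * (gap_kernel x y * weight_ratio x y) + (u y)\<^sup>2 * (gap_kernel y x * weight_ratio y x)) \<partial>lborel \<partial>lborel)
      = 2 * (\<integral>\<^sup>+x. ennreal ((u x)\<^sup>2) * (\<integral>\<^sup>+y. ennreal (gap_kernel x y * weight_ratio x y) \<partial>lborel) \<partial>lborel)"
    by (rule nn_integral_symmetric_kernel) auto
  also have "\<dots> \<le> 2 * (\<integral>\<^sup>+x. ennreal ((u x)\<^sup>2) * ennreal (\<sigma> * D) \<partial>lborel)"
    using gap_kernel_weight_bound[where 'a = 'a]
    by (intro mult_left_mono nn_integral_mono) (auto simp: \<sigma>_def D_def mult_ac)
  also have "\<dots> = 2 * (U * ennreal (\<sigma> * D))"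
    unfolding U_def by (subst nn_integral_multc) auto
  also have "\<dots> = ennreal (2 * \<sigma> * D) * U"
    using \<sigma> D by (simp add: ennreal_mult mult_ac)
  finally have W: "2 * W \<le> J + ennreal (2 * \<sigma> * D) * U" by (simp add: add_left_mono)
  have "(\<integral>\<^sup>+x. ennreal (2 * \<sigma> * max 0 (ln (1 / norm x)) * (u x)\<^sup>2) \<partial>lborel) =
      (\<integral>\<^sup>+x. 2 * (ennreal ((u x)\<^sup>2) * ennreal (\<sigma> * max 0 (ln (1 / norm x)))) \<partial>lborel)"
    using \<sigma> by (intro nn_integral_cong) (simp add: ennreal_mult mult_ac)
  also have "\<dots> \<le> (\<integral>\<^sup>+x. 2 * (ennreal ((u x)\<^sup>2) * ((\<integral>\<^sup>+y. ennreal (gap_kernel x y) \<partial>lborel) + ennreal (\<sigma> * D'))) \<partial>lborel)"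
    using log_le_gap_kernel[where 'a = 'a] unfolding \<sigma>_def D'_def by (intro nn_integral_mono mult_left_mono) auto
  also have "\<dots> = 2 * W + ennreal (2 * \<sigma> * D') * U"
    unfolding W_def U_def using \<sigma> D
    by (simp add: distrib_left nn_integral_add nn_integral_cmult nn_integral_multc ennreal_mult mult_ac)
  also have "\<dots> \<le> J + ennreal (2 * \<sigma> * D) * U + ennreal (2 * \<sigma> * D') * U" using W by (rule add_right_mono)
  also have "\<dots> = J + (ennreal (2 * \<sigma> * D) + ennreal (2 * \<sigma> * D')) * U"
    by (simp only: distrib_right add.assoc)
  also have "ennreal (2 * \<sigma> * D) + ennreal (2 * \<sigma> * D') = ennreal (2 * \<sigma> * (D + D'))"
    using \<sigma> D by (simp add: distrib_left flip: ennreal_plus)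
  finally show ?thesis by (simp add: J_def U_def \<sigma>_def D_def D'_def add.assoc)
qed

section \<open>Test functions\<close>

lemma C_k_SucI:
  assumes "\<And>x. (f has_derivative f' x) (at x)" "\<And>v. C_k k (\<lambda>x. f' x v)"
  shows "C_k (Suc k) f"
proof -
  have "frechet_derivative f (at x) = f' x" for x using frechet_derivative_at[OF assms(1)] by simp
  then show ?thesis using assms by (auto simp: differentiable_def)
qed

lemma C_k_SucD:
  assumes "C_k (Suc k) f"
  shows "(f has_derivative frechet_derivative f (at x)) (at x)" "C_k k (\<lambda>x. frechet_derivative f (at x) v)"
  using assms by (auto simp: frechet_derivative_works)

lemma C_k_Suc_imp: "C_k (Suc k) f \<Longrightarrow> C_k k f"
proof (induction k arbitrary: f)
  case 0
  then show ?case by (auto simp: continuous_on_eq_continuous_at intro: differentiable_imp_continuous_within)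
next
  case (Suc k)
  then show ?case by simp
qed

lemma C_k_const: "C_k k (\<lambda>x. c)"
proof (induction k arbitrary: c)
  case (Suc k)
  show ?case by (rule C_k_SucI[where f' = "\<lambda>_ _. 0"]) (auto intro: Suc)
qed simp

lemma C_k_inner: "C_k k (\<lambda>x. x \<bullet> a)"
proof (cases k)
  case (Suc k)
  show ?thesis unfolding Suc
    by (rule C_k_SucI[where f' = "\<lambda>_ v. v \<bullet> a"]) (auto intro: C_k_const intro!: derivative_eq_intros)
qed (auto intro!: continuous_intros)

lemma C_k_add: "C_k k f \<Longrightarrow> C_k k g \<Longrightarrow> C_k k (\<lambda>x. f x + g x)"
proof (induction k arbitrary: f g)
  case 0
  then show ?case by (auto intro: continuous_on_add)
next
  case (Suc k)
  show ?case
    by (rule C_k_SucI[OF has_derivative_add[OF C_k_SucD(1)[OF Suc.prems(1)] C_k_SucD(1)[OF Suc.prems(2)]]])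
       (intro Suc.IH C_k_SucD(2)[OF Suc.prems(1)] C_k_SucD(2)[OF Suc.prems(2)])
qed

lemma C_k_mult: "C_k k f \<Longrightarrow> C_k k g \<Longrightarrow> C_k k (\<lambda>x. f x * g x)"
proof (induction k arbitrary: f g)
  case 0
  then show ?case by (auto intro: continuous_on_mult)
next
  case (Suc k)
  show ?case
    by (rule C_k_SucI[OF has_derivative_mult[OF C_k_SucD(1)[OF Suc.prems(1)] C_k_SucD(1)[OF Suc.prems(2)]]])
       (intro C_k_add Suc.IH C_k_SucD(2)[OF Suc.prems(1)] C_k_SucD(2)[OF Suc.prems(2)] C_k_Suc_imp[OF Suc.prems(1)] C_k_Suc_imp[OF Suc.prems(2)])
qed

lemma C_k_cmult: "C_k k f \<Longrightarrow> C_k k (\<lambda>x. c * f x)"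
  by (intro C_k_mult C_k_const)

lemma C_k_compose_scaleR: "C_k k f \<Longrightarrow> C_k k (\<lambda>x. f (c *\<^sub>R x))"
proof (induction k arbitrary: f)
  case 0
  then show ?case by (auto intro!: continuous_on_compose2[of UNIV f] continuous_intros)
next
  case (Suc k)
  show ?case
  proof (rule C_k_SucI)
    show "((\<lambda>x. f (c *\<^sub>R x)) has_derivative (\<lambda>v. frechet_derivative f (at (c *\<^sub>R x)) (c *\<^sub>R v))) (at x)" for x
      using has_derivative_compose[OF has_derivative_scaleR_right[OF has_derivative_ident] C_k_SucD(1)[OF Suc.prems]] .
    show "C_k k (\<lambda>x. frechet_derivative f (at (c *\<^sub>R x)) (c *\<^sub>R v))" for v
      by (rule Suc.IH[OF C_k_SucD(2)[OF Suc.prems]])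
  qed
qed

text \<open>The powers of \<open>t\<close> in the denominator make the family stable under
  differentiation, so that smoothness of the bump can be proved by induction.\<close>

definition exp_flat :: "nat \<Rightarrow> real \<Rightarrow> real" where
  "exp_flat m t = (if t > 0 then exp (- 1 / t) / t ^ m else 0)"

lemma exp_flat_tendsto_0: "(exp_flat m \<longlongrightarrow> 0) (at 0)"
proof -
  have "((\<lambda>t. (inverse t) ^ m / exp (inverse t)) \<longlongrightarrow> 0) (at_right (0::real))"
    by (rule filterlim_compose[OF tendsto_power_div_exp_0 filterlim_inverse_at_top_right])
  moreover have "(\<lambda>t::real. (inverse t) ^ m / exp (inverse t)) = (\<lambda>t. exp (- 1 / t) / t ^ m)"
    by (simp add: exp_minus field_simps)
  ultimately have "((\<lambda>t. exp (- 1 / t) / t ^ m) \<longlongrightarrow> 0) (at_right (0::real))" by (simp only:)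
  then have "(exp_flat m \<longlongrightarrow> 0) (at_right 0)"
    by (rule Lim_transform_eventually) (auto simp: exp_flat_def eventually_at_right_less eventually_at_filter)
  moreover have "(exp_flat m \<longlongrightarrow> 0) (at_left 0)"
    by (rule Lim_transform_eventually[OF tendsto_const]) (auto simp: exp_flat_def eventually_at_filter)
  ultimately show ?thesis by (simp add: filterlim_at_split)
qed

lemma exp_flat_DERIV:
  "(exp_flat m has_real_derivative exp_flat (m + 2) t - m * exp_flat (m + 1) t) (at t)"
proof -
  consider "t < 0" | "t = 0" | "t > 0" by linarith
  then show ?thesis
  proof cases
    case 1
    show ?thesis
      by (rule has_field_derivative_transform_within_open[where f = "\<lambda>_. 0" and S = "{..<0}"])
         (use 1 in \<open>auto simp: exp_flat_def\<close>)
  next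
    case 2
    \<comment> \<open>The difference quotient at the origin is the next member of the family, so the
      derivative there is its limit, namely 0.\<close>
    have "(\<lambda>h. (exp_flat m (0 + h) - exp_flat m 0) / h) = exp_flat (m + 1)"
      by (auto simp: exp_flat_def fun_eq_iff)
    then show ?thesis using exp_flat_tendsto_0[of "m + 1"] 2 by (simp add: DERIV_def exp_flat_def)
  next
    case 3
    have *: "((\<lambda>t. exp (- 1 / t) / t ^ m) has_real_derivative exp (- 1 / t) / t ^ (m + 2) - m * (exp (- 1 / t) / t ^ (m + 1))) (at t)"
    proof -
      have p: "real m * t ^ (m - Suc 0) = real m * t ^ m / t" using 3 by (cases m) auto
      have "((\<lambda>t. exp (- 1 / t) / t ^ m) has_real_derivative
          (exp (- 1 / t) * (1 / t\<^sup>2) * t ^ m - exp (- 1 / t) * (real m * t ^ (m - Suc 0))) / (t ^ m * t ^ m)) (at t)"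
        using 3 by (auto intro!: derivative_eq_intros simp: power2_eq_square)
      moreover have "(exp (- 1 / t) * (1 / t\<^sup>2) * t ^ m - exp (- 1 / t) * (real m * t ^ m / t)) / (t ^ m * t ^ m) =
          exp (- 1 / t) / t ^ (m + 2) - real m * (exp (- 1 / t) / t ^ (m + 1))"
        using 3 by (simp add: field_simps power2_eq_square)
      ultimately show ?thesis unfolding p by (simp only:)
    qed
    show ?thesis
      by (rule has_field_derivative_transform_within_open[where f = "\<lambda>t. exp (- 1 / t) / t ^ m" and S = "{0<..}"])
         (use 3 * in \<open>auto simp: exp_flat_def\<close>)
  qed
qed

text \<open>The induction runs over \<open>k\<close> for all \<open>m\<close> simultaneously, since
  a derivative is a combination of the members \<open>m + 1\<close> and \<open>m + 2\<close> times
  an affine function of \<open>x\<close>.\<close>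

lemma C_k_exp_flat: "C_k k (\<lambda>x. exp_flat m (R - (x - a) \<bullet> (x - a)))"
proof (induction k arbitrary: m)
  case 0
  have "continuous_on UNIV (exp_flat m)"
    by (rule DERIV_continuous_on) (rule has_field_derivative_at_within[OF exp_flat_DERIV])
  then show ?case by (auto intro!: continuous_on_compose2[of UNIV "exp_flat m"] continuous_intros)
next
  case (Suc k)
  show ?case
  proof (rule C_k_SucI)
    show "((\<lambda>x. exp_flat m (R - (x - a) \<bullet> (x - a))) has_derivative
        (\<lambda>v. (exp_flat (m + 2) (R - (x - a) \<bullet> (x - a)) + (- real m) * exp_flat (m + 1) (R - (x - a) \<bullet> (x - a))) *
          (- 2 * (x \<bullet> v + - (a \<bullet> v))))) (at x)" for x
    proof -
      have "((\<lambda>x. R - (x - a) \<bullet> (x - a)) has_derivative (\<lambda>v. - 2 * (x \<bullet> v + - (a \<bullet> v)))) (at x)"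
        by (auto intro!: derivative_eq_intros simp: inner_diff_left inner_diff_right inner_commute)
      from has_derivative_compose[OF this exp_flat_DERIV[THEN has_field_derivative_imp_has_derivative]]
      show ?thesis by (simp add: algebra_simps)
    qed
    show "C_k k (\<lambda>x. (exp_flat (m + 2) (R - (x - a) \<bullet> (x - a)) + (- real m) * exp_flat (m + 1) (R - (x - a) \<bullet> (x - a))) *
          (- 2 * (x \<bullet> v + - (a \<bullet> v))))" for v
      by (intro C_k_mult C_k_add C_k_cmult C_k_const C_k_inner Suc)
  qed
qed

lemma bump_test_function:
  assumes "r > 0" "cball a r \<subseteq> \<Omega>"
  shows "(\<lambda>x. exp_flat 0 (r\<^sup>2 - (x - a) \<bullet> (x - a))) \<in> test_functions \<Omega>"
proof -
  have "{x. exp_flat 0 (r\<^sup>2 - (x - a) \<bullet> (x - a)) \<noteq> 0} = ball a r"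
  proof -
    have "(x - a) \<bullet> (x - a) < r\<^sup>2 \<longleftrightarrow> dist a x < r" for x
    proof -
      have "dist a x = norm (x - a)" by (simp add: dist_norm norm_minus_commute)
      moreover have "(norm (x - a))\<^sup>2 < r\<^sup>2 \<longleftrightarrow> norm (x - a) < r"
        using assms(1) power2_less_imp_less[of "norm (x - a)" r] power_strict_mono[of "norm (x - a)" r 2] by auto
      ultimately show ?thesis by (simp only: dot_square_norm)
    qed
    moreover have "exp_flat 0 (r\<^sup>2 - (x - a) \<bullet> (x - a)) \<noteq> 0 \<longleftrightarrow> (x - a) \<bullet> (x - a) < r\<^sup>2" for x
      by (simp add: exp_flat_def)
    ultimately show ?thesis by (simp only: ball_def)
  qed
  then show ?thesis using assms C_k_exp_flat by (auto simp: test_functions_def)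
qed

lemma test_functions_lincomb:
  assumes f: "f \<in> test_functions \<Omega>" and g: "g \<in> test_functions \<Omega>"
  shows "(\<lambda>x. a * f x + b * g x) \<in> test_functions \<Omega>"
proof -
  let ?F = "closure {x. f x \<noteq> 0}" and ?G = "closure {x. g x \<noteq> 0}" and ?H = "closure {x. a * f x + b * g x \<noteq> 0}"
  have "{x. a * f x + b * g x \<noteq> 0} \<subseteq> {x. f x \<noteq> 0} \<union> {x. g x \<noteq> 0}" by auto
  then have sub: "?H \<subseteq> ?F \<union> ?G" by (simp add: closure_mono flip: closure_Un)
  have "compact (?F \<union> ?G)" using f g by (intro compact_Un) (auto simp: test_functions_def)
  then have "compact ?H"
    using compact_Int_closed[of "?F \<union> ?G" ?H] sub by (simp add: Int_absorb1)
  moreover have "?H \<subseteq> \<Omega>" using sub f g by (auto simp: test_functions_def)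
  moreover have "C_k k (\<lambda>x. a * f x + b * g x)" for k
    using f g by (intro C_k_add C_k_cmult) (auto simp: test_functions_def)
  ultimately show ?thesis by (simp add: test_functions_def)
qed

lemma test_functions_scale:
  assumes f: "f \<in> test_functions \<Omega>" and l: "l > 0"
  shows "(\<lambda>x. f ((1 / l) *\<^sub>R x)) \<in> test_functions ((*\<^sub>R) l ` \<Omega>)"
proof -
  have "{x. f ((1 / l) *\<^sub>R x) \<noteq> 0} = (*\<^sub>R) l ` {x. f x \<noteq> 0}"
    using l by (auto simp: image_iff intro!: exI[of _ "(1 / l) *\<^sub>R _"])
  then have "closure {x. f ((1 / l) *\<^sub>R x) \<noteq> 0} = (*\<^sub>R) l ` closure {x. f x \<noteq> 0}"
    by (simp add: closure_scaleR)
  moreover have "compact ((*\<^sub>R) l ` closure {x. f x \<noteq> 0})"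
    using f by (intro compact_scaling) (auto simp: test_functions_def)
  moreover have "C_k k (\<lambda>x. f ((1 / l) *\<^sub>R x))" for k
    using f by (intro C_k_compose_scaleR) (auto simp: test_functions_def)
  moreover have "closure {x. f x \<noteq> 0} \<subseteq> \<Omega>" using f by (simp add: test_functions_def)
  ultimately show ?thesis by (simp add: test_functions_def image_mono del: compact_closure)
qed

text \<open>The only properties of test functions used in the estimates.\<close>
definition Lipschitz_supported :: "'a::euclidean_space set \<Rightarrow> ('a \<Rightarrow> real) \<Rightarrow> bool" where
  "Lipschitz_supported \<Omega> f \<longleftrightarrow> f \<in> borel_measurable borel \<and> (\<forall>x. x \<notin> \<Omega> \<longrightarrow> f x = 0) \<and>
     (\<exists>B. \<forall>x. \<bar>f x\<bar> \<le> B) \<and> (\<exists>K. \<forall>x y. \<bar>f x - f y\<bar> \<le> K * norm (x - y))"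

lemma bounded_of_compact_support:
  fixes f :: "'a::topological_space \<Rightarrow> real"
  assumes "continuous_on UNIV f" "compact K" "\<And>x. x \<notin> K \<Longrightarrow> f x = 0"
  shows "\<exists>B\<ge>0. \<forall>x. \<bar>f x\<bar> \<le> B"
proof -
  have "compact (f ` K)" using assms by (intro compact_continuous_image) (auto intro: continuous_on_subset)
  then obtain B where "\<forall>x\<in>K. \<bar>f x\<bar> \<le> B" using compact_imp_bounded[of "f ` K"] by (auto simp: bounded_iff)
  then have "\<bar>f x\<bar> \<le> max 0 B" for x using assms(3)[of x] by (cases "x \<in> K") (auto simp: max_def)
  then show ?thesis by (intro exI[of _ "max 0 B"]) auto
qed

text \<open>The partial derivatives are continuous and vanish off the compact support, hence are
  bounded; the mean value inequality converts their bounds into a Lipschitz constant.\<close>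

lemma test_function_Lipschitz_supported:
  fixes f :: "real ^ 'n \<Rightarrow> real"
  assumes f: "f \<in> test_functions \<Omega>"
  shows "Lipschitz_supported \<Omega> f"
proof -
  let ?K = "closure {x. f x \<noteq> 0}"
  have C: "C_k k f" for k using f by (simp add: test_functions_def)
  have K: "compact ?K" "?K \<subseteq> \<Omega>" using f by (auto simp: test_functions_def)
  have zero: "f x = 0" if "x \<notin> ?K" for x using that closure_subset[of "{x. f x \<noteq> 0}"] by auto
  have cont: "continuous_on UNIV f" using C[of 0] by simp
  have der: "(f has_derivative frechet_derivative f (at x)) (at x)" for x
    using C_k_SucD(1)[OF C] .
  have "\<exists>B\<ge>0. \<forall>x. \<bar>frechet_derivative f (at x) b\<bar> \<le> B" for b
  proof (rule bounded_of_compact_support[OF _ K(1)])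
    show "continuous_on UNIV (\<lambda>x. frechet_derivative f (at x) b)" using C_k_SucD(2)[OF C[of "Suc 0"]] by simp
    fix x assume x: "x \<notin> ?K"
    have "(f has_derivative (\<lambda>_. 0)) (at x)"
    proof (rule has_derivative_transform_within_open[where f = "\<lambda>_. 0" and s = "- ?K"])
      show "0 = f y" if "y \<in> - ?K" for y using zero[of y] that by simp
    qed (use x in auto)
    from has_derivative_unique[OF this der] show "frechet_derivative f (at x) b = 0" by (simp add: fun_eq_iff)
  qed
  then obtain B where B: "\<And>b. B b \<ge> 0" "\<And>b x. \<bar>frechet_derivative f (at x) b\<bar> \<le> B b" by metis
  define M where "M = (\<Sum>b\<in>Basis. B b)"
  have "norm (f x - f y) \<le> M * norm (x - y)" for x y
  proof (rule differentiable_bound[where S = UNIV])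
    fix z :: "real ^ 'n"
    show "onorm (frechet_derivative f (at z)) \<le> M"
    proof (rule onorm_le)
      fix v :: "real ^ 'n"
      interpret bounded_linear "frechet_derivative f (at z)" using der by (rule has_derivative_bounded_linear)
      have "frechet_derivative f (at z) v = frechet_derivative f (at z) (\<Sum>b\<in>Basis. (v \<bullet> b) *\<^sub>R b)"
        by (simp add: euclidean_representation)
      also have "\<dots> = (\<Sum>b\<in>Basis. (v \<bullet> b) * frechet_derivative f (at z) b)"
        by (simp add: sum scaleR)
      finally have "norm (frechet_derivative f (at z) v) \<le> (\<Sum>b\<in>Basis. \<bar>(v \<bullet> b) * frechet_derivative f (at z) b\<bar>)"
        by (metis real_norm_def sum_abs)
      also have "\<dots> \<le> (\<Sum>b\<in>Basis. norm v * B b)"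
        unfolding abs_mult using B by (intro sum_mono mult_mono) (auto simp: Basis_le_norm)
      finally show "norm (frechet_derivative f (at z) v) \<le> M * norm v"
        by (simp add: M_def sum_distrib_left mult.commute)
    qed
  qed (auto intro: der has_derivative_at_withinI)
  moreover have "\<exists>B. \<forall>x. \<bar>f x\<bar> \<le> B" using bounded_of_compact_support[OF cont K(1) zero] by blast
  moreover have "f \<in> borel_measurable borel" using cont by (rule borel_measurable_continuous_onI)
  moreover have "f x = 0" if "x \<notin> \<Omega>" for x using zero K(2) that by blast
  ultimately show ?thesis unfolding Lipschitz_supported_def by auto
qed

lemma Lipschitz_supported_lincomb:
  assumes "Lipschitz_supported \<Omega> f" "Lipschitz_supported \<Omega> g"
  shows "Lipschitz_supported \<Omega> (\<lambda>x. a * f x + b * g x)"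
proof -
  obtain B K where f: "\<And>x. \<bar>f x\<bar> \<le> B" "\<And>x y. \<bar>f x - f y\<bar> \<le> K * norm (x - y)"
    using assms(1) by (auto simp: Lipschitz_supported_def)
  obtain B' K' where g: "\<And>x. \<bar>g x\<bar> \<le> B'" "\<And>x y. \<bar>g x - g y\<bar> \<le> K' * norm (x - y)"
    using assms(2) by (auto simp: Lipschitz_supported_def)
  have "\<bar>a * f x + b * g x\<bar> \<le> \<bar>a\<bar> * B + \<bar>b\<bar> * B'" for x
    using f(1)[of x] g(1)[of x]
    by (intro order_trans[OF abs_triangle_ineq] add_mono) (auto simp: abs_mult intro: mult_left_mono)
  moreover have "\<bar>(a * f x + b * g x) - (a * f y + b * g y)\<bar> \<le> (\<bar>a\<bar> * K + \<bar>b\<bar> * K') * norm (x - y)" for x y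
  proof -
    have "\<bar>(a * f x + b * g x) - (a * f y + b * g y)\<bar> = \<bar>a * (f x - f y) + b * (g x - g y)\<bar>" by (simp add: algebra_simps)
    also have "\<dots> \<le> \<bar>a\<bar> * (K * norm (x - y)) + \<bar>b\<bar> * (K' * norm (x - y))"
      using f(2)[of x y] g(2)[of x y]
      by (intro order_trans[OF abs_triangle_ineq] add_mono) (auto simp: abs_mult intro: mult_left_mono)
    finally show ?thesis by (simp add: algebra_simps)
  qed
  moreover have "(\<lambda>x. a * f x + b * g x) \<in> borel_measurable borel"
    using assms by (intro borel_measurable_add borel_measurable_times) (auto simp: Lipschitz_supported_def)
  ultimately show ?thesis using assms unfolding Lipschitz_supported_def by auto
qed

section \<open>The energy of a test function\<close>

lemma distr_lborel_reflect: "distr lborel borel (\<lambda>y. x - y) = (lborel :: 'a::euclidean_space measure)"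
  using lborel_affine[of "-1" x] by (simp add: density_1)

lemma nn_integral_reflect:
  assumes [measurable]: "f \<in> borel_measurable borel"
  shows "(\<integral>\<^sup>+y. f (x - y) \<partial>lborel) = (\<integral>\<^sup>+(z::'a::euclidean_space). f z \<partial>lborel)"
  by (subst distr_lborel_reflect[of x, symmetric], subst nn_integral_distr) auto

lemma integrable_reflect:
  fixes f :: "'a::euclidean_space \<Rightarrow> real"
  assumes "integrable lborel f"
  shows "integrable lborel (\<lambda>y. f (x - y))"
proof -
  have "integrable (distr lborel borel (\<lambda>y. x - y)) f" using assms by (simp add: distr_lborel_reflect)
  then show ?thesis by (subst (asm) integrable_distr_eq) (use assms in auto)
qed

definition far_kernel :: "'a::euclidean_space \<Rightarrow> real" where
  "far_kernel z = indicator {1..} (norm z) / norm z ^ DIM('a)"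

lemma far_kernel_measurable [measurable]: "far_kernel \<in> borel_measurable borel"
  unfolding far_kernel_def[abs_def] by measurable

lemma far_kernel_bounds: "0 \<le> far_kernel z" "far_kernel z \<le> 1"
  by (auto simp: far_kernel_def indicator_def divide_le_eq_1 one_le_power)

lemma far_kernel_minus_commute: "far_kernel (x - y) = far_kernel (y - x)"
  by (simp add: far_kernel_def norm_minus_commute)

text \<open>The kernel alone is not integrable at the origin; the additional factor
  \<open>norm z\<close>, supplied by the Lipschitz bound, makes it so. This is why principal values
  become ordinary integrals.\<close>

lemma nn_integral_near_kernel_norm:
  "(\<integral>\<^sup>+(z::'a::euclidean_space). ennreal (near_kernel z * norm z) \<partial>lborel) \<le> ennreal (sphere_area TYPE('a))"
proof -
  have "(\<integral>\<^sup>+(z::'a). ennreal (near_kernel z * norm z) \<partial>lborel) \<le>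
      (\<integral>\<^sup>+(z::'a). ennreal (norm z powr (1 - real DIM('a))) * indicator {0..1} (norm z) \<partial>lborel)"
  proof (intro nn_integral_mono)
    fix z :: 'a
    show "ennreal (near_kernel z * norm z) \<le> ennreal (norm z powr (1 - real DIM('a))) * indicator {0..1} (norm z)"
      by (cases "z = 0") (auto simp: near_kernel_def indicator_def powr_diff powr_realpow)
  qed
  also have "\<dots> = ennreal (sphere_area TYPE('a))"
    using nn_integral_radial_powr_atMost[where 'a = 'a, of 1 1] by simp
  finally show ?thesis .
qed

lemma integrable_near_kernel_norm: "integrable lborel (\<lambda>z::'a::euclidean_space. near_kernel z * norm z)"
  by (rule integrableI_bounded)
    (use order.strict_trans1[OF nn_integral_near_kernel_norm[where 'a = 'a] ennreal_less_top] in \<open>auto simp: abs_mult\<close>)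

text \<open>Tonelli after the substitution \<open>z = x - y\<close>: one variable is confined to a
  set of finite measure and the difference is controlled by an integrable function.\<close>

lemma integrable_pair_dominated:
  fixes f :: "'a::euclidean_space \<times> 'a \<Rightarrow> real" and g :: "'a \<Rightarrow> real"
  assumes [measurable]: "f \<in> borel_measurable (lborel \<Otimes>\<^sub>M lborel)" "\<Omega> \<in> sets borel"
    and fin: "emeasure lborel \<Omega> < \<infinity>" and g: "integrable lborel g" "\<And>z. 0 \<le> g z" and C: "C \<ge> 0"
    and bound: "\<And>x y. \<bar>f (x, y)\<bar> \<le> C * (indicator \<Omega> x * g (x - y))"
  shows "integrable (lborel \<Otimes>\<^sub>M lborel) f"
proof (rule integrableI_bounded)
  have [measurable]: "g \<in> borel_measurable borel" using g(1) by auto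
  have "(\<integral>\<^sup>+p. ennreal (norm (f p)) \<partial>(lborel \<Otimes>\<^sub>M lborel)) = (\<integral>\<^sup>+x. \<integral>\<^sup>+y. ennreal (norm (f (x, y))) \<partial>lborel \<partial>lborel)"
    by (rule lborel.nn_integral_fst[symmetric]) measurable
  also have "\<dots> \<le> (\<integral>\<^sup>+x. \<integral>\<^sup>+y. ennreal C * indicator \<Omega> x * ennreal (g (x - y)) \<partial>lborel \<partial>lborel)"
  proof (intro nn_integral_mono)
    fix x y
    show "ennreal (norm (f (x, y))) \<le> ennreal C * indicator \<Omega> x * ennreal (g (x - y))"
      using bound[of x y] C g(2) by (cases "x \<in> \<Omega>") (auto simp: ennreal_leI ennreal_mult[symmetric])
  qed
  also have "\<dots> = (\<integral>\<^sup>+x. (ennreal C * indicator \<Omega> x) * (\<integral>\<^sup>+z. ennreal (g z) \<partial>lborel) \<partial>lborel)"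
  proof (intro nn_integral_cong)
    fix x
    have "(\<integral>\<^sup>+y. ennreal (g (x - y)) \<partial>lborel) = (\<integral>\<^sup>+z. ennreal (g z) \<partial>lborel)"
      by (rule nn_integral_reflect[where f = "\<lambda>z. ennreal (g z)"]) measurable
    then show "(\<integral>\<^sup>+y. ennreal C * indicator \<Omega> x * ennreal (g (x - y)) \<partial>lborel) =
        (ennreal C * indicator \<Omega> x) * (\<integral>\<^sup>+z. ennreal (g z) \<partial>lborel)"
      by (subst nn_integral_cmult) auto
  qed
  also have "\<dots> = ennreal C * emeasure lborel \<Omega> * (\<integral>\<^sup>+z. ennreal (g z) \<partial>lborel)"
    by (subst nn_integral_multc, measurable, subst nn_integral_cmult) auto
  also have "\<dots> < \<infinity>"
    using fin g by (simp add: ennreal_mult_less_top nn_integral_eq_integral)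
  finally show "(\<integral>\<^sup>+p. ennreal (norm (f p)) \<partial>(lborel \<Otimes>\<^sub>M lborel)) < \<infinity>" .
qed measurable

text \<open>Every pair of points is counted in both orders. The energy therefore contains this form
  with weight \<open>c_const N / 2\<close>, whereas the inner product of the energy space contains
  it with weight \<open>c_const N\<close>.\<close>

definition near_form :: "('a::euclidean_space \<Rightarrow> real) \<Rightarrow> ('a \<Rightarrow> real) \<Rightarrow> real" where
  "near_form u v = (LINT p|(lborel \<Otimes>\<^sub>M lborel). near_kernel (fst p - snd p) * (u (fst p) - u (snd p)) * (v (fst p) - v (snd p)))"

definition far_form :: "('a::euclidean_space \<Rightarrow> real) \<Rightarrow> ('a \<Rightarrow> real) \<Rightarrow> real" where
  "far_form u v = (LINT p|(lborel \<Otimes>\<^sub>M lborel). far_kernel (fst p - snd p) * u (fst p) * v (snd p))"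

definition mass_form :: "('a::euclidean_space \<Rightarrow> real) \<Rightarrow> ('a \<Rightarrow> real) \<Rightarrow> real" where
  "mass_form u v = (LINT x|lborel. u x * v x)"

definition log_form :: "('a::euclidean_space \<Rightarrow> real) \<Rightarrow> ('a \<Rightarrow> real) \<Rightarrow> real" where
  "log_form u v = (LINT x|lborel. ln (1 / norm x) * u x * v x)"

locale bounded_open =
  fixes \<Omega> :: "(real ^ 'n) set"
  assumes bounded: "bounded \<Omega>" and open_\<Omega>: "open \<Omega>"
begin

abbreviation "LS \<equiv> Lipschitz_supported \<Omega>"

lemma \<Omega>_measurable [measurable]: "\<Omega> \<in> sets borel" using open_\<Omega> by simp

lemma \<Omega>_finite: "emeasure lborel \<Omega> < \<infinity>" using bounded by (rule emeasure_bounded_finite)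

lemma LS_measurable [measurable_dest]: "LS u \<Longrightarrow> u \<in> borel_measurable borel"
  by (simp add: Lipschitz_supported_def)

lemma LS_zero: "LS u \<Longrightarrow> x \<notin> \<Omega> \<Longrightarrow> u x = 0"
  by (simp add: Lipschitz_supported_def)

lemma LS_bounds:
  assumes "LS u"
  obtains B K where "B \<ge> 0" "K \<ge> 0" "\<And>x. \<bar>u x\<bar> \<le> B * indicator \<Omega> x" "\<And>x y. \<bar>u x - u y\<bar> \<le> K * norm (x - y)"
proof -
  obtain B K where *: "\<And>x. \<bar>u x\<bar> \<le> B" "\<And>x y. \<bar>u x - u y\<bar> \<le> K * norm (x - y)"
    using assms by (auto simp: Lipschitz_supported_def)
  have "\<bar>u x\<bar> \<le> \<bar>B\<bar> * indicator \<Omega> x" for x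
    using *(1)[of x] LS_zero[OF assms, of x] by (auto simp: indicator_def)
  moreover have "\<bar>u x - u y\<bar> \<le> \<bar>K\<bar> * norm (x - y)" for x y
    using *(2)[of x y] mult_right_mono[OF abs_ge_self[of K] norm_ge_zero[of "x - y"]] by linarith
  ultimately show ?thesis using that[of "\<bar>B\<bar>" "\<bar>K\<bar>"] by simp
qed

lemma integrable_mult_LS:
  assumes u: "LS u" and v: "LS v"
  shows "integrable lborel (\<lambda>x. u x * v x)"
proof -
  obtain B K where B: "B \<ge> 0" "\<And>x. \<bar>u x\<bar> \<le> B * indicator \<Omega> x" using LS_bounds[OF u] by metis
  obtain B' K' where B': "B' \<ge> 0" "\<And>x. \<bar>v x\<bar> \<le> B' * indicator \<Omega> x" using LS_bounds[OF v] by metis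
  have [measurable]: "u \<in> borel_measurable borel" "v \<in> borel_measurable borel" using u v by measurable
  have "integrable lborel (\<lambda>x. B * B' * indicator \<Omega> x)"
    using \<Omega>_finite by simp
  then show ?thesis
  proof (rule Bochner_Integration.integrable_bound)
    have "\<bar>u x * v x\<bar> \<le> B * B' * indicator \<Omega> x" for x
      using mult_mono[OF B(2)[of x] B'(2)[of x]] B(1) by (auto simp: abs_mult indicator_def split: if_splits)
    then show "AE x in lborel. norm (u x * v x) \<le> norm (B * B' * indicator \<Omega> x)"
      using B(1) B'(1) by (auto simp: abs_mult)
  qed measurable
qed

lemma near_half_integrable:
  assumes u: "LS u" and v: "LS v"
  shows "integrable (lborel \<Otimes>\<^sub>M lborel) (\<lambda>(x, y). near_kernel (x - y) * u x * (v x - v y))"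
proof -
  obtain B K where B: "B \<ge> 0" "\<And>x. \<bar>u x\<bar> \<le> B * indicator \<Omega> x" using LS_bounds[OF u] by metis
  obtain B' K where K: "K \<ge> 0" "\<And>x y. \<bar>v x - v y\<bar> \<le> K * norm (x - y)" using LS_bounds[OF v] by metis
  have [measurable]: "u \<in> borel_measurable borel" "v \<in> borel_measurable borel" using u v by measurable
  show ?thesis
  proof (rule integrable_pair_dominated[OF _ \<Omega>_measurable \<Omega>_finite integrable_near_kernel_norm])
    fix x y :: "real ^ 'n"
    have "\<bar>u x\<bar> * \<bar>v x - v y\<bar> \<le> (B * indicator \<Omega> x) * (K * norm (x - y))"
      using B K by (intro mult_mono) auto
    from mult_left_mono[OF this near_kernel_nonneg[of "x - y"]]
    show "\<bar>case (x, y) of (x, y) \<Rightarrow> near_kernel (x - y) * u x * (v x - v y)\<bar> \<le>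
        B * K * (indicator \<Omega> x * (near_kernel (x - y) * norm (x - y)))"
      by (simp add: abs_mult mult_ac)
  qed (use B(1) K(1) in \<open>auto intro!: mult_nonneg_nonneg\<close>)
qed

text \<open>The far kernel is not integrable, but it is at most 1, and two points of the bounded set
  differ by at most \<open>2 * R\<close>; the indicator of that ball is the dominating
  function.\<close>

lemma far_integrable:
  assumes u: "LS u" and v: "LS v"
  shows "integrable (lborel \<Otimes>\<^sub>M lborel) (\<lambda>(x, y). far_kernel (x - y) * u x * v y)"
proof -
  obtain B K where B: "B \<ge> 0" "\<And>x. \<bar>u x\<bar> \<le> B * indicator \<Omega> x" using LS_bounds[OF u] by metis
  obtain B' K' where B': "B' \<ge> 0" "\<And>x. \<bar>v x\<bar> \<le> B' * indicator \<Omega> x" using LS_bounds[OF v] by metis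
  have [measurable]: "u \<in> borel_measurable borel" "v \<in> borel_measurable borel" using u v by measurable
  obtain R where R: "\<And>x. x \<in> \<Omega> \<Longrightarrow> norm x \<le> R" using bounded by (auto simp: bounded_iff)
  have fin: "emeasure lborel (cball (0 :: real ^ 'n) (2 * R)) < \<infinity>"
    by (rule emeasure_bounded_finite) simp
  have int: "integrable lborel (indicator (cball (0 :: real ^ 'n) (2 * R)) :: _ \<Rightarrow> real)"
    using fin by simp
  show ?thesis
  proof (rule integrable_pair_dominated[OF _ \<Omega>_measurable \<Omega>_finite int])
    fix x y :: "real ^ 'n"
    have "\<bar>u x\<bar> * \<bar>v y\<bar> \<le> (B * indicator \<Omega> x) * (B' * indicator \<Omega> y)"
      using B B' by (intro mult_mono) auto
    also have "\<dots> \<le> B * B' * (indicator \<Omega> x * indicator (cball 0 (2 * R)) (x - y))"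
      using R[of x] R[of y] norm_triangle_ineq4[of x y] B(1) B'(1) by (auto simp: indicator_def)
    finally have le: "\<bar>u x\<bar> * \<bar>v y\<bar> \<le> B * B' * (indicator \<Omega> x * indicator (cball 0 (2 * R)) (x - y))" .
    have "far_kernel (x - y) * (\<bar>u x\<bar> * \<bar>v y\<bar>) \<le> 1 * (B * B' * (indicator \<Omega> x * indicator (cball 0 (2 * R)) (x - y)))"
      using mult_mono[OF far_kernel_bounds(2)[of "x - y"] le] by simp
    then show "\<bar>case (x, y) of (x, y) \<Rightarrow> far_kernel (x - y) * u x * v y\<bar> \<le>
        B * B' * (indicator \<Omega> x * indicator (cball 0 (2 * R)) (x - y))"
      using far_kernel_bounds[of "x - y"] by (simp add: abs_mult mult_ac)
  qed (use B(1) B'(1) in \<open>auto intro!: mult_nonneg_nonneg\<close>)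
qed

text \<open>Exchanging \<open>x\<close> and \<open>y\<close> maps the half with factor
  \<open>u x\<close> to the half with factor \<open>- u y\<close>, the kernel being even. Each half
  converges separately because \<open>v\<close> is Lipschitz.\<close>

lemma near_form_symmetrize:
  assumes u: "LS u" and v: "LS v"
  shows "integrable (lborel \<Otimes>\<^sub>M lborel) (\<lambda>p. near_kernel (fst p - snd p) * (u (fst p) - u (snd p)) * (v (fst p) - v (snd p)))"
    and "near_form u v = 2 * (LINT x|lborel. u x * (LINT y|lborel. near_kernel (x - y) * (v x - v y)))"
proof -
  let ?F = "\<lambda>(x, y). near_kernel (x - y) * u x * (v x - v y)"
  have F: "integrable (lborel \<Otimes>\<^sub>M lborel) ?F" by (rule near_half_integrable[OF u v])
  note F' = lborel_pair.integrable_product_swap[OF F]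
  have eq: "(\<lambda>p. near_kernel (fst p - snd p) * (u (fst p) - u (snd p)) * (v (fst p) - v (snd p))) =
      (\<lambda>p. ?F p + (case p of (x, y) \<Rightarrow> ?F (y, x)))"
    by (auto simp: fun_eq_iff near_kernel_minus_commute algebra_simps)
  show "integrable (lborel \<Otimes>\<^sub>M lborel) (\<lambda>p. near_kernel (fst p - snd p) * (u (fst p) - u (snd p)) * (v (fst p) - v (snd p)))"
    unfolding eq using F F' by (rule Bochner_Integration.integrable_add)
  have "near_form u v = integral\<^sup>L (lborel \<Otimes>\<^sub>M lborel) ?F + (LINT p|(lborel \<Otimes>\<^sub>M lborel). (case p of (x, y) \<Rightarrow> ?F (y, x)))"
    unfolding near_form_def eq using F F' by (rule Bochner_Integration.integral_add)
  also have "(LINT p|(lborel \<Otimes>\<^sub>M lborel). (case p of (x, y) \<Rightarrow> ?F (y, x))) = integral\<^sup>L (lborel \<Otimes>\<^sub>M lborel) ?F"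
    using F by (intro lborel_pair.integral_product_swap) auto
  also have "integral\<^sup>L (lborel \<Otimes>\<^sub>M lborel) ?F = (LINT x|lborel. LINT y|lborel. ?F (x, y))"
    using lborel_pair.integral_fst'[OF F] by simp
  also have "\<dots> = (LINT x|lborel. u x * (LINT y|lborel. near_kernel (x - y) * (v x - v y)))"
    by (intro Bochner_Integration.integral_cong refl) (simp add: mult_ac flip: integral_mult_right_zero)
  finally show "near_form u v = 2 * (LINT x|lborel. u x * (LINT y|lborel. near_kernel (x - y) * (v x - v y)))"
    by simp
qed

lemma near_half_integrable_outer:
  assumes u: "LS u" and v: "LS v"
  shows "integrable lborel (\<lambda>x. u x * (LINT y|lborel. near_kernel (x - y) * (v x - v y)))"
  using lborel_pair.integrable_fst'[OF near_half_integrable[OF u v]]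
  by (simp add: mult_ac flip: integral_mult_right_zero)

lemma far_form_iterated:
  assumes u: "LS u" and v: "LS v"
  shows "integrable lborel (\<lambda>x. u x * (LINT y|lborel. far_kernel (x - y) * v y))"
    and "far_form u v = (LINT x|lborel. u x * (LINT y|lborel. far_kernel (x - y) * v y))"
proof -
  have eq: "(\<lambda>x. LINT y|lborel. (case (x, y) of (x, y) \<Rightarrow> far_kernel (x - y) * u x * v y)) =
      (\<lambda>x. u x * (LINT y|lborel. far_kernel (x - y) * v y))"
    by (simp add: mult_ac flip: integral_mult_right_zero)
  show "integrable lborel (\<lambda>x. u x * (LINT y|lborel. far_kernel (x - y) * v y))"
    using lborel_pair.integrable_fst'[OF far_integrable[OF u v]] unfolding eq .
  show "far_form u v = (LINT x|lborel. u x * (LINT y|lborel. far_kernel (x - y) * v y))"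
    using lborel_pair.integral_fst'[OF far_integrable[OF u v]] unfolding eq far_form_def
    by (simp add: case_prod_beta')
qed

text \<open>The inequality \<open>ln t \<le> t - 1\<close> at \<open>t = r powr (- (1 / 2))\<close>
  dominates the singularity by a power that is integrable at the origin in every dimension.\<close>

lemma log_bound:
  fixes r R :: real
  assumes "0 < r" "r \<le> R"
  shows "\<bar>ln (1 / r)\<bar> \<le> 2 * r powr (- (1 / 2)) + R"
proof -
  have "ln r \<le> r" using assms ln_le_minus_one[of r] by simp
  then have "ln r \<le> R" using assms by simp
  moreover have "ln (r powr (- (1 / 2))) \<le> r powr (- (1 / 2))" using assms ln_le_minus_one[of "r powr (- (1 / 2))"] by simp
  then have "- ln r \<le> 2 * r powr (- (1 / 2))" using assms by (simp add: ln_powr)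
  moreover have "0 \<le> r powr (- (1 / 2))" "0 \<le> R" using assms by auto
  moreover have "ln (1 / r) = - ln r" using assms by (simp add: ln_div)
  ultimately show ?thesis unfolding abs_le_iff by linarith
qed

lemma log_integrable:
  assumes u: "LS u" and v: "LS v"
  shows "integrable lborel (\<lambda>x. ln (1 / norm x) * u x * v x)"
    and "integrable lborel (\<lambda>x. max 0 (ln (1 / norm x)) * u x * v x)"
    and "integrable lborel (\<lambda>x. max 0 (ln (norm x)) * u x * v x)"
proof -
  obtain B K where B: "B \<ge> 0" "\<And>x. \<bar>u x\<bar> \<le> B * indicator \<Omega> x" using LS_bounds[OF u] by metis
  obtain B' K' where B': "B' \<ge> 0" "\<And>x. \<bar>v x\<bar> \<le> B' * indicator \<Omega> x" using LS_bounds[OF v] by metis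
  have [measurable]: "u \<in> borel_measurable borel" "v \<in> borel_measurable borel" using u v by measurable
  obtain R where R: "R > 0" "\<And>x. x \<in> \<Omega> \<Longrightarrow> norm x \<le> R" using bounded by (auto simp: bounded_pos)
  let ?h = "\<lambda>x::real ^ 'n. norm x powr (- (1 / 2)) * indicator {0..R} (norm x)"
  have "real CARD('n) \<ge> 1" by (simp add: Suc_leI)
  then have N: "real CARD('n) - 1 / 2 > 0" by linarith
  have "(\<integral>\<^sup>+x. ennreal (?h x) \<partial>lborel) = (\<integral>\<^sup>+(x::real ^ 'n). ennreal (norm x powr ((real CARD('n) - 1 / 2) - real DIM(real ^ 'n))) * indicator {0..R} (norm x) \<partial>lborel)"
    by (intro nn_integral_cong) (simp add: indicator_def)
  also have "\<dots> < \<infinity>"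
    using R(1) by (subst nn_integral_radial_powr_atMost[OF _ N]) auto
  finally have h: "integrable lborel ?h" by (intro integrableI_bounded) (auto simp: abs_mult)
  define G where "G = (\<lambda>x. B * B' * (2 * ?h x + R * indicator \<Omega> x))"
  have G: "integrable lborel G"
    unfolding G_def using h \<Omega>_finite by (intro integrable_mult_right Bochner_Integration.integrable_add) auto
  have bound: "\<bar>w * u x * v x\<bar> \<le> G x" if "\<bar>w\<bar> \<le> \<bar>ln (1 / norm x)\<bar>" for w x
  proof (cases "x \<in> \<Omega> \<and> x \<noteq> 0")
    case True
    have "\<bar>w\<bar> * (\<bar>u x\<bar> * \<bar>v x\<bar>) \<le> (2 * norm x powr (- (1 / 2)) + R) * (B * B')"
      using True B B'(1) B(2)[of x] B'(2)[of x] log_bound[of "norm x" R] R(1) R(2)[of x] that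
      by (intro mult_mono) auto
    then show ?thesis using True R by (simp add: abs_mult G_def mult_ac)
  next
    case False
    then have "w * u x * v x = 0" using LS_zero[OF u] that by auto
    moreover have "0 \<le> G x" using B B' R by (simp add: G_def)
    ultimately show ?thesis by (simp only: abs_zero)
  qed
  have "integrable lborel (\<lambda>x. w x * u x * v x)"
    if [measurable]: "w \<in> borel_measurable borel" and w: "\<And>x. \<bar>w x\<bar> \<le> \<bar>ln (1 / norm x)\<bar>" for w
    using G by (rule Bochner_Integration.integrable_bound) (use bound[OF w] in \<open>auto intro: order_trans[OF _ abs_ge_self]\<close>)
  moreover have "\<bar>max 0 (ln (norm x))\<bar> \<le> \<bar>ln (1 / norm x)\<bar>" for x :: "real ^ 'n"
    by (cases "x = 0") (auto simp: ln_div)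
  ultimately show "integrable lborel (\<lambda>x. ln (1 / norm x) * u x * v x)"
    "integrable lborel (\<lambda>x. max 0 (ln (1 / norm x)) * u x * v x)"
    "integrable lborel (\<lambda>x. max 0 (ln (norm x)) * u x * v x)" by auto
qed

lemma near_integrable_inner:
  assumes v: "LS v"
  shows "integrable lborel (\<lambda>y. near_kernel (x - y) * (v x - v y))"
proof -
  obtain B K where K: "K \<ge> 0" "\<And>x y. \<bar>v x - v y\<bar> \<le> K * norm (x - y)" using LS_bounds[OF v] by metis
  have [measurable]: "v \<in> borel_measurable borel" using v by measurable
  have "integrable lborel (\<lambda>y. K * (near_kernel (x - y) * norm (x - y)))"
    using integrable_reflect[OF integrable_near_kernel_norm, of x] by (rule integrable_mult_right)
  then show ?thesis
  proof (rule Bochner_Integration.integrable_bound)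
    have "norm (near_kernel (x - y) * (v x - v y)) \<le> norm (K * (near_kernel (x - y) * norm (x - y)))" for y
      using mult_left_mono[OF K(2)[of x y] near_kernel_nonneg[of "x - y"]] K(1) by (simp add: abs_mult mult_ac)
    then show "AE y in lborel. norm (near_kernel (x - y) * (v x - v y)) \<le> norm (K * (near_kernel (x - y) * norm (x - y)))"
      by simp
  qed measurable
qed

text \<open>Dominated convergence removes the principal value: the integrand is absolutely
  integrable and every \<open>y\<close> other than \<open>x\<close> eventually leaves the excluded
  balls. The far part is only translated.\<close>

lemma log_laplacian_LS:
  assumes v: "LS v"
  shows "log_laplacian v x = c_const CARD('n) * (LINT y|lborel. near_kernel (x - y) * (v x - v y))
    - c_const CARD('n) * (LINT y|lborel. far_kernel (x - y) * v y) + rho_const CARD('n) * v x"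
proof -
  have [measurable]: "v \<in> borel_measurable borel" using v by measurable
  let ?f = "\<lambda>y. near_kernel (x - y) * (v x - v y)"
  let ?X = "\<lambda>\<epsilon>. LINT y:(ball x 1 - cball x \<epsilon>)|lborel. (v x - v y) / norm (x - y) ^ CARD('n)"
  have X: "?X \<epsilon> = (LINT y|lborel. indicator (- cball x \<epsilon>) y * ?f y)" for \<epsilon>
    unfolding set_lebesgue_integral_def
    by (intro Bochner_Integration.integral_cong refl) (auto simp: indicator_def near_kernel_def dist_norm)
  have "(?X \<longlongrightarrow> integral\<^sup>L lborel ?f) (at_right 0)"
  proof (rule tendsto_at_right_sequentially[of 0 1])
    fix S :: "nat \<Rightarrow> real" assume S: "S \<longlonglongrightarrow> 0" "\<And>n. 0 < S n"
    show "(\<lambda>n. ?X (S n)) \<longlonglongrightarrow> integral\<^sup>L lborel ?f"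
      unfolding X
    proof (rule integral_dominated_convergence[where w = "\<lambda>y. norm (?f y)"])
      show "integrable lborel (\<lambda>y. norm (?f y))" using near_integrable_inner[OF v] by (rule integrable_norm)
      show "AE y in lborel. (\<lambda>n. indicator (- cball x (S n)) y * ?f y) \<longlonglongrightarrow> ?f y"
      proof (intro AE_I2)
        fix y
        show "(\<lambda>n. indicator (- cball x (S n)) y * ?f y) \<longlonglongrightarrow> ?f y"
        proof (cases "y = x")
          case False
          then have "eventually (\<lambda>n. S n < dist x y) sequentially"
            using S(1) by (intro order_tendstoD(2)[OF S(1)]) auto
          then have "eventually (\<lambda>n. indicator (- cball x (S n)) y * ?f y = ?f y) sequentially"
            by eventually_elim (auto simp: indicator_def)
          then show ?thesis by (rule tendsto_eventually)
        qed simp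
      qed
    qed (auto simp: indicator_def)
  qed simp
  then have 1: "Lim (at_right 0) ?X = integral\<^sup>L lborel ?f"
    by (intro tendsto_Lim) auto
  have "(LINT y:(- ball 0 1)|lborel. v (x + y) / norm y ^ CARD('n)) = (LINT y|lborel. far_kernel y * v (x + y))"
    unfolding set_lebesgue_integral_def
    by (intro Bochner_Integration.integral_cong refl) (auto simp: indicator_def far_kernel_def)
  also have "\<dots> = (LINT y|distr lborel borel ((+) (- x)). far_kernel y * v (x + y))"
    unfolding lborel_distr_plus ..
  also have "\<dots> = (LINT y|lborel. far_kernel (- x + y) * v (x + (- x + y)))"
    by (subst integral_distr) auto
  also have "\<dots> = (LINT y|lborel. far_kernel (x - y) * v y)"
    using far_kernel_minus_commute[of x] by simp
  finally show ?thesis by (simp add: log_laplacian_def 1)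
qed

lemma set_integral_supported:
  assumes "\<And>x. x \<notin> \<Omega> \<Longrightarrow> f x = (0::real)"
  shows "(LINT x:\<Omega>|lborel. f x) = (LINT x|lborel. f x)"
  unfolding set_lebesgue_integral_def
  by (intro Bochner_Integration.integral_cong refl) (auto simp: indicator_def assms)

lemma test_energy_LS:
  assumes u: "LS u" and v: "LS v"
  shows "test_energy \<mu> \<Omega> u v = c_const CARD('n) / 2 * near_form u v - c_const CARD('n) * far_form u v
    + rho_const CARD('n) * mass_form u v + 2 * \<mu> * log_form u v"
proof -
  let ?c = "c_const CARD('n)" and ?\<rho> = "rho_const CARD('n)"
  let ?n = "\<lambda>x. u x * (LINT y|lborel. near_kernel (x - y) * (v x - v y))"
  let ?f = "\<lambda>x. u x * (LINT y|lborel. far_kernel (x - y) * v y)"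
  have "(LINT x:\<Omega>|lborel. u x * log_laplacian v x) = (LINT x|lborel. ?c * ?n x - ?c * ?f x + ?\<rho> * (u x * v x))"
    by (subst set_integral_supported) (auto simp: log_laplacian_LS[OF v] LS_zero[OF u] algebra_simps)
  also have "\<dots> = ?c * (LINT x|lborel. ?n x) - ?c * (LINT x|lborel. ?f x) + ?\<rho> * (LINT x|lborel. u x * v x)"
    using near_half_integrable_outer[OF u v] far_form_iterated(1)[OF u v] integrable_mult_LS[OF u v]
    by (subst Bochner_Integration.integral_add Bochner_Integration.integral_diff, simp_all)+
  finally have "(LINT x:\<Omega>|lborel. u x * log_laplacian v x) = ?c / 2 * near_form u v - ?c * far_form u v + ?\<rho> * mass_form u v"
    by (simp add: near_form_symmetrize(2)[OF u v] far_form_iterated(2)[OF u v] mass_form_def)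
  moreover have "(LINT x:\<Omega>|lborel. ln (1 / norm x) * u x * v x) = log_form u v"
    unfolding log_form_def by (rule set_integral_supported) (simp add: LS_zero[OF u])
  ultimately show ?thesis by (simp add: test_energy_def)
qed

lemma L2_inner_LS: "LS u \<Longrightarrow> L2_inner \<Omega> u v = mass_form u v"
  unfolding L2_inner_def mass_form_def by (rule set_integral_supported) (simp add: LS_zero)

lemma ln_mu_inner_LS:
  assumes u: "LS u" and v: "LS v"
  shows "ln_mu_inner \<mu> \<Omega> u v = c_const CARD('n) * near_form u v + (1 + max 0 (d_const \<Omega>)) * mass_form u v
    + 2 * \<mu> * (LINT x|lborel. max 0 (ln (1 / norm x)) * u x * v x)"
proof -
  have "(LINT p:{p. dist (fst p) (snd p) < 1}|(lborel \<Otimes>\<^sub>M lborel).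
      (u (fst p) - u (snd p)) * (v (fst p) - v (snd p)) / norm (fst p - snd p) ^ CARD('n)) = near_form u v"
    unfolding near_form_def set_lebesgue_integral_def
    by (intro Bochner_Integration.integral_cong refl) (auto simp: indicator_def near_kernel_def dist_norm)
  moreover have "(LINT x:\<Omega>|lborel. max 0 (ln (1 / norm x)) * u x * v x) = (LINT x|lborel. max 0 (ln (1 / norm x)) * u x * v x)"
    by (rule set_integral_supported) (simp add: LS_zero[OF u])
  ultimately show ?thesis
    by (simp add: ln_mu_inner_def ln_inner_def L2_inner_LS[OF u] algebra_simps)
qed

end

section \<open>Upper and lower bounds for the energy\<close>

context bounded_open
begin

lemma near_form_nn_integral:
  assumes u: "LS u"
  shows "ennreal (near_form u u) = (\<integral>\<^sup>+x. \<integral>\<^sup>+y. ennreal (near_kernel (x - y) * (u x - u y)\<^sup>2) \<partial>lborel \<partial>lborel)"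
    and near_form_nonneg: "0 \<le> near_form u u"
proof -
  have [measurable]: "u \<in> borel_measurable borel" using u by measurable
  have eq: "(\<lambda>p. near_kernel (fst p - snd p) * (u (fst p) - u (snd p)) * (u (fst p) - u (snd p))) =
      (\<lambda>p. near_kernel (fst p - snd p) * (u (fst p) - u (snd p))\<^sup>2)"
    by (simp add: power2_eq_square mult.assoc)
  note int = near_form_symmetrize(1)[OF u u, unfolded eq]
  have "(\<integral>\<^sup>+x. \<integral>\<^sup>+y. ennreal (near_kernel (x - y) * (u x - u y)\<^sup>2) \<partial>lborel \<partial>lborel) =
      (\<integral>\<^sup>+p. ennreal (near_kernel (fst p - snd p) * (u (fst p) - u (snd p))\<^sup>2) \<partial>(lborel \<Otimes>\<^sub>M lborel))"
    by (subst lborel.nn_integral_fst[symmetric]) auto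
  also have "\<dots> = ennreal (near_form u u)"
    unfolding near_form_def eq using int by (intro nn_integral_eq_integral) auto
  finally show "ennreal (near_form u u) = (\<integral>\<^sup>+x. \<integral>\<^sup>+y. ennreal (near_kernel (x - y) * (u x - u y)\<^sup>2) \<partial>lborel \<partial>lborel)" ..
  show "0 \<le> near_form u u" unfolding near_form_def eq by (intro integral_nonneg_AE) auto
qed

lemma mass_form_nn_integral:
  assumes u: "LS u"
  shows "ennreal (mass_form u u) = (\<integral>\<^sup>+x. ennreal ((u x)\<^sup>2) \<partial>lborel)"
  using integrable_mult_LS[OF u u] unfolding mass_form_def
  by (subst nn_integral_eq_integral[symmetric]) (auto simp: power2_eq_square)

lemma mass_form_nonneg: "0 \<le> mass_form u u"
  unfolding mass_form_def by (intro integral_nonneg_AE) auto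

definition log_plus_form :: "(real ^ 'n \<Rightarrow> real) \<Rightarrow> (real ^ 'n \<Rightarrow> real) \<Rightarrow> real" where
  "log_plus_form u v = (LINT x|lborel. max 0 (ln (1 / norm x)) * u x * v x)"

lemma log_plus_form_nonneg: "0 \<le> log_plus_form u u"
  unfolding log_plus_form_def by (intro integral_nonneg_AE AE_I2) (simp add: mult.assoc)

text \<open>The Hardy inequality multiplied by \<open>c_const N / 2\<close>. By the normalization
  the left side acquires the coefficient 2 of the potential, and on the right stands, with
  coefficient 1, precisely the near part of the energy.\<close>

lemma log_plus_form_le:
  obtains D where "D \<ge> 0" "\<And>u. LS u \<Longrightarrow> 2 * log_plus_form u u \<le> c_const CARD('n) / 2 * near_form u u + D * mass_form u u"
proof -
  define \<sigma> where "\<sigma> = sphere_area TYPE(real ^ 'n)"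
  define D where "D = 2 * \<sigma> * (2 ^ CARD('n) * (4 / CARD('n)) + ln 3 + CARD('n) / 2)"
  let ?c = "c_const CARD('n)"
  have \<sigma>: "\<sigma> > 0" using sphere_area_pos by (simp add: \<sigma>_def)
  have D: "D \<ge> 0" using \<sigma> by (simp add: D_def)
  have "2 * log_plus_form u u \<le> ?c / 2 * near_form u u + (?c / 2 * D) * mass_form u u" if u: "LS u" for u
  proof -
    have [measurable]: "u \<in> borel_measurable borel" using u by measurable
    have "ennreal (2 * \<sigma> * log_plus_form u u) = (\<integral>\<^sup>+x. ennreal (2 * \<sigma> * max 0 (ln (1 / norm x)) * (u x)\<^sup>2) \<partial>lborel)"
    proof -
      have "2 * \<sigma> * log_plus_form u u = (LINT x|lborel. 2 * \<sigma> * max 0 (ln (1 / norm x)) * (u x)\<^sup>2)"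
        unfolding log_plus_form_def by (simp add: mult.assoc power2_eq_square flip: integral_mult_right_zero)
      moreover have "integrable lborel (\<lambda>x. 2 * \<sigma> * max 0 (ln (1 / norm x)) * (u x)\<^sup>2)"
        using integrable_mult_right[OF log_integrable(2)[OF u u], of "2 * \<sigma>"] by (simp add: mult_ac power2_eq_square)
      ultimately show ?thesis using \<sigma> by (simp add: nn_integral_eq_integral)
    qed
    also have "\<dots> \<le> ennreal (near_form u u) + ennreal D * ennreal (mass_form u u)"
      using log_Hardy_inequality[of u] unfolding near_form_nn_integral(1)[OF u] mass_form_nn_integral[OF u] \<sigma>_def D_def by simp
    also have "\<dots> = ennreal (near_form u u + D * mass_form u u)"
      using D near_form_nonneg[OF u] mass_form_nonneg[of u] by (simp add: ennreal_mult)
    finally have "2 * \<sigma> * log_plus_form u u \<le> near_form u u + D * mass_form u u"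
      using D near_form_nonneg[OF u] mass_form_nonneg[of u] by (subst (asm) ennreal_le_iff) auto
    then have "?c / 2 * (2 * \<sigma> * log_plus_form u u) \<le> ?c / 2 * (near_form u u + D * mass_form u u)"
      using c_const_pos[where 'n = 'n] by (intro mult_left_mono) auto
    moreover have "?c / 2 * (2 * \<sigma> * log_plus_form u u) = 2 * log_plus_form u u"
      using c_const_sphere_area[where 'n = 'n] by (simp add: \<sigma>_def)
    ultimately have "2 * log_plus_form u u \<le> ?c / 2 * (near_form u u + D * mass_form u u)" by (simp only:)
    then show ?thesis by (simp add: algebra_simps)
  qed
  moreover have "?c / 2 * D \<ge> 0" using D c_const_pos[where 'n = 'n] by simp
  ultimately show ?thesis using that by blast
qed

lemma L1_le_L2:
  assumes [measurable]: "u \<in> borel_measurable borel" and zero: "\<And>x. x \<notin> \<Omega> \<Longrightarrow> u x = 0"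
    and int: "integrable lborel (\<lambda>x. u x * u x)"
  shows "integrable lborel u" "(LINT x|lborel. \<bar>u x\<bar>)\<^sup>2 \<le> (measure lborel \<Omega> + 1) * mass_form u u"
proof -
  let ?i = "indicator \<Omega> :: _ \<Rightarrow> real"
  have ind: "integrable lborel ?i" using \<Omega>_finite by simp
  show u1: "integrable lborel u"
  proof (rule Bochner_Integration.integrable_bound)
    show "integrable lborel (\<lambda>x. ?i x + u x * u x)" using ind int by simp
    have "\<bar>u x\<bar> \<le> 1 + u x * u x" for x
      using sum_squares_ge_zero[of "\<bar>u x\<bar> - 1" 0] zero_le_square[of "u x"] by (simp add: algebra_simps abs_mult_self_eq)
    then show "AE x in lborel. norm (u x) \<le> norm (?i x + u x * u x)"
      by (intro AE_I2) (use zero in \<open>auto simp: indicator_def intro: order_trans[OF _ abs_ge_self]\<close>)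
  qed measurable
  define M where "M = (LINT x|lborel. \<bar>u x\<bar>)"
  define m where "m = measure lborel \<Omega>"
  have m: "m \<ge> 0" by (simp add: m_def)
  \<comment> \<open>Integrating \<open>(\<bar>u\<bar> - t)\<^sup>2 \<ge> 0\<close> over the domain
    with \<open>t\<close> close to the mean gives the estimate; the 1 keeps the denominator positive
    for any measure.\<close>
  define t where "t = M / (m + 1)"
  have M: "M = t * (m + 1)" using m by (simp add: t_def)
  have "0 \<le> (LINT x|lborel. u x * u x - (2 * t) * \<bar>u x\<bar> + t\<^sup>2 * ?i x)"
  proof (intro integral_nonneg_AE AE_I2)
    fix x
    show "0 \<le> u x * u x - (2 * t) * \<bar>u x\<bar> + t\<^sup>2 * ?i x"
      using zero[of x] zero_le_power2[of "\<bar>u x\<bar> - t"] by (cases "x \<in> \<Omega>") (auto simp: power2_diff power2_eq_square algebra_simps)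
  qed
  also have "\<dots> = mass_form u u - 2 * t * M + t\<^sup>2 * m"
    using ind int u1 \<Omega>_finite by (simp add: mass_form_def M_def m_def)
  finally have "t\<^sup>2 * (m + 2) \<le> mass_form u u" by (simp add: M algebra_simps power2_eq_square)
  moreover have "t\<^sup>2 * (m + 1) \<le> t\<^sup>2 * (m + 2)" by (intro mult_left_mono) auto
  ultimately have "(m + 1) * (t\<^sup>2 * (m + 1)) \<le> (m + 1) * mass_form u u"
    using m by (intro mult_left_mono) auto
  then show "(LINT x|lborel. \<bar>u x\<bar>)\<^sup>2 \<le> (measure lborel \<Omega> + 1) * mass_form u u"
    unfolding M_def[symmetric] m_def[symmetric] by (simp add: M power2_eq_square algebra_simps)
qed

text \<open>As the kernel is at most 1, the form is bounded by the square of the L1 norm, which the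
  bounded domain controls by the mass.\<close>

lemma far_form_bound:
  assumes u: "LS u"
  shows "\<bar>far_form u u\<bar> \<le> (measure lborel \<Omega> + 1) * mass_form u u"
proof -
  have [measurable]: "u \<in> borel_measurable borel" using u by measurable
  note L1 = L1_le_L2[OF LS_measurable[OF u] LS_zero[OF u] integrable_mult_LS[OF u u]]
  define M where "M = (LINT x|lborel. \<bar>u x\<bar>)"
  have inner: "\<bar>LINT y|lborel. far_kernel (x - y) * u y\<bar> \<le> M" for x
  proof -
    have "\<bar>LINT y|lborel. far_kernel (x - y) * u y\<bar> \<le> (LINT y|lborel. \<bar>far_kernel (x - y) * u y\<bar>)"
      by (rule integral_abs_bound)
    also have "\<dots> \<le> M"
      unfolding M_def
    proof (rule integral_mono')
      fix y show "\<bar>far_kernel (x - y) * u y\<bar> \<le> \<bar>u y\<bar>"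
        using far_kernel_bounds[of "x - y"] mult_right_mono[of "far_kernel (x - y)" 1 "\<bar>u y\<bar>"] by (simp add: abs_mult)
    qed (use L1(1) in auto)
    finally show ?thesis .
  qed
  have "\<bar>far_form u u\<bar> \<le> (LINT x|lborel. \<bar>u x * (LINT y|lborel. far_kernel (x - y) * u y)\<bar>)"
    unfolding far_form_iterated(2)[OF u u] by (rule integral_abs_bound)
  also have "\<dots> \<le> (LINT x|lborel. \<bar>u x\<bar> * M)"
  proof (rule integral_mono')
    have "M \<ge> 0" by (simp add: M_def)
    then show "0 \<le> \<bar>u x\<bar> * M" for x by simp
  qed (use L1(1) inner in \<open>auto simp: abs_mult intro: mult_left_mono\<close>)
  also have "\<dots> = M\<^sup>2" by (simp add: M_def power2_eq_square)
  finally show ?thesis using L1(2) by (simp add: M_def)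
qed

text \<open>The negative part of \<open>ln (1 / norm x)\<close> is bounded on a bounded set, so the
  signed potential differs from its positive part by a multiple of the mass.\<close>

lemma log_form_split:
  obtains L where "L \<ge> 0" "\<And>u. LS u \<Longrightarrow> log_form u u \<le> log_plus_form u u"
    "\<And>u. LS u \<Longrightarrow> log_plus_form u u - L * mass_form u u \<le> log_form u u"
proof -
  obtain R where R: "R > 0" "\<And>x. x \<in> \<Omega> \<Longrightarrow> norm x \<le> R" using bounded by (auto simp: bounded_pos)
  define L where "L = max 0 (ln R)"
  have eq: "log_form u u = log_plus_form u u - (LINT x|lborel. max 0 (ln (norm x)) * u x * u x)" if u: "LS u" for u
  proof -
    have "ln (1 / norm x) * u x * u x = max 0 (ln (1 / norm x)) * u x * u x - max 0 (ln (norm x)) * u x * u x" for x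
      by (cases "x = 0") (auto simp: ln_div max_def)
    then show ?thesis
      using log_integrable(2,3)[OF u u] by (simp add: log_form_def log_plus_form_def Bochner_Integration.integral_diff)
  qed
  have "log_form u u \<le> log_plus_form u u" if "LS u" for u
    unfolding eq[OF that] by (simp add: mult.assoc)
  moreover have "log_plus_form u u - L * mass_form u u \<le> log_form u u" if u: "LS u" for u
  proof -
    have "(LINT x|lborel. max 0 (ln (norm x)) * u x * u x) \<le> (LINT x|lborel. L * (u x * u x))"
    proof (intro integral_mono log_integrable(3) u integrable_mult_right integrable_mult_LS)
      fix x
      show "max 0 (ln (norm x)) * u x * u x \<le> L * (u x * u x)"
      proof (cases "x \<in> \<Omega> \<and> x \<noteq> 0")
        case True
        then have "ln (norm x) \<le> ln R" using R by (subst ln_le_cancel_iff) auto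
        then have "max 0 (ln (norm x)) \<le> L" by (simp add: L_def max_def)
        then show ?thesis unfolding mult.assoc by (intro mult_right_mono) auto
      qed (use LS_zero[OF u] in \<open>auto simp: L_def\<close>)
    qed
    then show ?thesis using u by (simp add: eq mass_form_def)
  qed
  moreover have "L \<ge> 0" by (simp add: L_def)
  ultimately show ?thesis using that by blast
qed

text \<open>Up to multiples of the mass, the energy and the squared norm of the energy space are
  both comparable to \<open>near_form\<close>. All later statements about boundedness, compactness
  and equality of the two notions of convergence rest on these four bounds.\<close>

lemma form_bounds:
  assumes \<mu>: "\<mu> > - 1"
  obtains \<kappa> C where "\<kappa> > 0" "C \<ge> 0"
    "\<And>u. LS u \<Longrightarrow> \<kappa> * near_form u u \<le> test_energy \<mu> \<Omega> u u + C * mass_form u u"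
    "\<And>u. LS u \<Longrightarrow> test_energy \<mu> \<Omega> u u \<le> C * (near_form u u + mass_form u u)"
    "\<And>u. LS u \<Longrightarrow> \<kappa> * near_form u u \<le> ln_mu_inner \<mu> \<Omega> u u + C * mass_form u u"
    "\<And>u. LS u \<Longrightarrow> ln_mu_inner \<mu> \<Omega> u u \<le> C * (near_form u u + mass_form u u)"
proof -
  obtain D where D: "D \<ge> 0" "\<And>u. LS u \<Longrightarrow> 2 * log_plus_form u u \<le> c_const CARD('n) / 2 * near_form u u + D * mass_form u u"
    using log_plus_form_le by blast
  obtain L where L: "L \<ge> 0" "\<And>u. LS u \<Longrightarrow> log_form u u \<le> log_plus_form u u"
    "\<And>u. LS u \<Longrightarrow> log_plus_form u u - L * mass_form u u \<le> log_form u u"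
    using log_form_split by blast
  define c where "c = c_const CARD('n)"
  define F where "F = c * (measure lborel \<Omega> + 1)"
  define \<rho> where "\<rho> = rho_const CARD('n)"
  \<comment> \<open>Only a negative coefficient of the potential is dangerous, and
    \<open>\<nu>\<close> keeps that part; \<open>1 + \<nu>\<close> is the fraction of the near part
    that survives the Hardy inequality.\<close>
  define \<nu> where "\<nu> = min \<mu> 0"
  define d where "d = 1 + max 0 (d_const \<Omega>)"
  have c: "c > 0" using c_const_pos by (simp add: c_def)
  have \<nu>: "- 1 < \<nu>" "\<nu> \<le> 0" "\<nu> \<le> \<mu>" using \<mu> by (auto simp: \<nu>_def)
  have d: "d \<ge> 1" by (simp add: d_def)
  have F: "F \<ge> 0" using c by (simp add: F_def)
  define \<kappa> where "\<kappa> = (1 + \<nu>) * (c / 2)"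
  \<comment> \<open>Collects all errors proportional to the mass. Enlarging it to \<open>C\<close>
    lets one constant serve in the lower and the upper bounds.\<close>
  define G where "G = D + F + \<bar>\<rho>\<bar> + 2 * \<bar>\<mu>\<bar> * L + \<bar>\<mu>\<bar> * D + d"
  define C where "C = (2 + \<bar>\<mu>\<bar>) * (c / 2) + G"
  have G0: "G \<ge> 0" unfolding G_def using D(1) F L(1) d by (intro add_nonneg_nonneg mult_nonneg_nonneg) auto
  have \<kappa>: "\<kappa> > 0" using c \<nu> by (simp add: \<kappa>_def)
  have main: "\<kappa> * near_form u u \<le> test_energy \<mu> \<Omega> u u + C * mass_form u u \<and>
      test_energy \<mu> \<Omega> u u \<le> C * (near_form u u + mass_form u u) \<and>
      \<kappa> * near_form u u \<le> ln_mu_inner \<mu> \<Omega> u u + C * mass_form u u \<and>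
      ln_mu_inner \<mu> \<Omega> u u \<le> C * (near_form u u + mass_form u u)" if u: "LS u" for u
  proof -
    define a where "a = c / 2 * near_form u u"
    define m where "m = mass_form u u"
    define P where "P = log_plus_form u u"
    have a: "a \<ge> 0" using c near_form_nonneg[OF u] by (simp add: a_def)
    have m: "m \<ge> 0" by (simp add: m_def mass_form_nonneg)
    have P: "0 \<le> 2 * P" "2 * P \<le> a + D * m" using D(2)[OF u] log_plus_form_nonneg[of u] by (simp_all add: P_def a_def m_def c_def)
    have far: "\<bar>c * far_form u u\<bar> \<le> F * m"
      using mult_left_mono[OF far_form_bound[OF u], of c] c by (simp add: abs_mult F_def m_def mult.assoc)
    have \<rho>: "\<rho> * m \<le> \<bar>\<rho>\<bar> * m" "- (\<bar>\<rho>\<bar> * m) \<le> \<rho> * m"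
      using mult_right_mono[of \<rho> "\<bar>\<rho>\<bar>" m] mult_right_mono[of "- \<bar>\<rho>\<bar>" \<rho> m] m by auto
    have "\<mu> * (2 * P) \<ge> \<nu> * (2 * P)" using \<nu> P by (intro mult_right_mono) auto
    \<comment> \<open>The Hardy inequality multiplied by the nonpositive \<open>\<nu>\<close>;
      together with the term \<open>a\<close> of the energy this leaves
      \<open>(1 + \<nu>) * a\<close>.\<close>
    moreover have "\<nu> * (2 * P) \<ge> \<nu> * (a + D * m)" using \<nu> P by (intro mult_left_mono_neg) auto
    moreover have "\<nu> * (D * m) \<ge> (- 1) * (D * m)" using \<nu> m D(1) by (intro mult_right_mono mult_nonneg_nonneg) auto
    ultimately have Plow: "\<mu> * (2 * P) \<ge> \<nu> * a - D * m" by (simp add: distrib_left)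
    have "\<mu> * (2 * P) \<le> \<bar>\<mu>\<bar> * (2 * P)" using P by (intro mult_right_mono) auto
    also have "\<dots> \<le> \<bar>\<mu>\<bar> * (a + D * m)" using P by (intro mult_left_mono) auto
    finally have Phigh: "\<mu> * (2 * P) \<le> \<bar>\<mu>\<bar> * a + \<bar>\<mu>\<bar> * D * m" by (simp add: distrib_left mult.assoc)
    have "\<bar>log_form u u - P\<bar> \<le> L * m" using L(2,3)[OF u] L(1) m by (simp add: P_def m_def abs_le_iff)
    then have "\<bar>2 * \<mu> * (log_form u u - P)\<bar> \<le> 2 * \<bar>\<mu>\<bar> * (L * m)"
      using mult_left_mono[of "\<bar>log_form u u - P\<bar>" "L * m" "2 * \<bar>\<mu>\<bar>"] by (simp add: abs_mult)
    then have lg: "\<bar>2 * \<mu> * log_form u u - \<mu> * (2 * P)\<bar> \<le> 2 * \<bar>\<mu>\<bar> * L * m" by (simp add: algebra_simps)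
    have T: "test_energy \<mu> \<Omega> u u = a - c * far_form u u + \<rho> * m + 2 * \<mu> * log_form u u"
      by (simp add: test_energy_LS[OF u u] a_def c_def \<rho>_def m_def)
    have N: "ln_mu_inner \<mu> \<Omega> u u = 2 * a + d * m + \<mu> * (2 * P)"
      by (simp add: ln_mu_inner_LS[OF u u] a_def c_def d_def m_def P_def log_plus_form_def)
    have Gm: "G * m = D * m + F * m + \<bar>\<rho>\<bar> * m + 2 * \<bar>\<mu>\<bar> * L * m + \<bar>\<mu>\<bar> * D * m + d * m"
      by (simp add: G_def distrib_right)
    have nn: "0 \<le> D * m" "0 \<le> F * m" "0 \<le> \<bar>\<rho>\<bar> * m" "0 \<le> 2 * \<bar>\<mu>\<bar> * L * m" "0 \<le> \<bar>\<mu>\<bar> * D * m" "0 \<le> d * m"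
      using m D(1) F L(1) d by auto
    have \<kappa>a: "\<kappa> * near_form u u = a + \<nu> * a" by (simp add: \<kappa>_def a_def distrib_right distrib_left)
    have GC: "G * m \<le> C * m" using m c by (intro mult_right_mono) (auto simp: C_def)
    have "C * (near_form u u + m) = ((2 + \<bar>\<mu>\<bar>) * (c / 2)) * near_form u u + G * near_form u u + C * m"
      by (simp add: C_def algebra_simps)
    also have "((2 + \<bar>\<mu>\<bar>) * (c / 2)) * near_form u u = 2 * a + \<bar>\<mu>\<bar> * a" by (simp add: a_def algebra_simps)
    finally have up: "2 * a + \<bar>\<mu>\<bar> * a + G * m \<le> C * (near_form u u + m)"
      using GC mult_nonneg_nonneg[OF G0 near_form_nonneg[OF u]] by simp
    have low1: "a + \<nu> * a \<le> test_energy \<mu> \<Omega> u u + G * m"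
      unfolding T Gm using abs_le_D1[OF far] abs_le_D2[OF lg] \<rho> Plow nn by linarith
    have low2: "a + \<nu> * a \<le> ln_mu_inner \<mu> \<Omega> u u + G * m"
      unfolding N Gm using Plow a nn by linarith
    have up1: "test_energy \<mu> \<Omega> u u \<le> 2 * a + \<bar>\<mu>\<bar> * a + G * m"
      unfolding T Gm using abs_le_D2[OF far] abs_le_D1[OF lg] \<rho> Phigh nn a by linarith
    have up2: "ln_mu_inner \<mu> \<Omega> u u \<le> 2 * a + \<bar>\<mu>\<bar> * a + G * m"
      unfolding N Gm using Phigh nn by linarith
    show ?thesis using low1 low2 up1 up2 up GC \<kappa>a by (simp add: m_def)
  qed
  have "C \<ge> 0" unfolding C_def using c G0 by simp
  then show ?thesis using that[of \<kappa> C] \<kappa> main by blast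
qed

section \<open>Bilinearity of the forms and the L2 space\<close>

lemma near_form_linear:
  assumes u: "LS u" and v: "LS v" and w: "LS w"
  shows "near_form (\<lambda>x. a * u x + b * v x) w = a * near_form u w + b * near_form v w"
proof -
  let ?k = "\<lambda>u p. near_kernel (fst p - snd p) * (u (fst p) - u (snd p)) * (w (fst p) - w (snd p))"
  have "near_form (\<lambda>x. a * u x + b * v x) w = (LINT p|(lborel \<Otimes>\<^sub>M lborel). a * ?k u p + b * ?k v p)"
    unfolding near_form_def by (intro Bochner_Integration.integral_cong refl) (simp add: algebra_simps)
  also have "\<dots> = a * near_form u w + b * near_form v w"
    using near_form_symmetrize(1)[OF u w] near_form_symmetrize(1)[OF v w]
    by (simp add: near_form_def Bochner_Integration.integral_add)
  finally show ?thesis .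
qed

lemma far_form_linear:
  assumes u: "LS u" and v: "LS v" and w: "LS w"
  shows "far_form (\<lambda>x. a * u x + b * v x) w = a * far_form u w + b * far_form v w"
proof -
  let ?k = "\<lambda>u p. far_kernel (fst p - snd p) * u (fst p) * w (snd p)"
  have int: "integrable (lborel \<Otimes>\<^sub>M lborel) (?k u)" if "LS u" for u
    using far_integrable[OF that w] by (simp add: case_prod_beta')
  have "far_form (\<lambda>x. a * u x + b * v x) w = (LINT p|(lborel \<Otimes>\<^sub>M lborel). a * ?k u p + b * ?k v p)"
    unfolding far_form_def by (intro Bochner_Integration.integral_cong refl) (simp add: algebra_simps)
  also have "\<dots> = a * far_form u w + b * far_form v w"
    using int[OF u] int[OF v] by (simp add: far_form_def Bochner_Integration.integral_add)
  finally show ?thesis .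
qed

lemma far_form_commute:
  assumes u: "LS u" and v: "LS v"
  shows "far_form u v = far_form v u"
proof -
  have "far_form u v = (LINT (x, y)|(lborel \<Otimes>\<^sub>M lborel). far_kernel (y - x) * u y * v x)"
    using lborel_pair.integral_product_swap[of "\<lambda>(x, y). far_kernel (x - y) * u x * v y"] far_integrable[OF u v]
    by (simp add: far_form_def case_prod_beta')
  also have "\<dots> = far_form v u"
    unfolding far_form_def
    by (intro Bochner_Integration.integral_cong refl) (auto simp: far_kernel_minus_commute mult_ac)
  finally show ?thesis .
qed

lemma log_form_linear:
  assumes u: "LS u" and v: "LS v" and w: "LS w"
  shows "log_form (\<lambda>x. a * u x + b * v x) w = a * log_form u w + b * log_form v w"
proof -
  let ?k = "\<lambda>u x. ln (1 / norm x) * u x * w x"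
  have "log_form (\<lambda>x. a * u x + b * v x) w = (LINT x|lborel. a * ?k u x + b * ?k v x)"
    unfolding log_form_def by (intro Bochner_Integration.integral_cong refl) (simp add: algebra_simps)
  also have "\<dots> = a * log_form u w + b * log_form v w"
    using log_integrable(1)[OF u w] log_integrable(1)[OF v w]
    by (simp add: log_form_def Bochner_Integration.integral_add)
  finally show ?thesis .
qed

lemma mass_form_linear:
  assumes "integrable lborel (\<lambda>x. u x * w x)" "integrable lborel (\<lambda>x. v x * w x)"
  shows "mass_form (\<lambda>x. a * u x + b * v x) w = a * mass_form u w + b * mass_form v w"
proof -
  have "mass_form (\<lambda>x. a * u x + b * v x) w = (LINT x|lborel. a * (u x * w x) + b * (v x * w x))"
    unfolding mass_form_def by (intro Bochner_Integration.integral_cong refl) (simp add: algebra_simps)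
  also have "\<dots> = a * mass_form u w + b * mass_form v w"
    using assms by (simp add: mass_form_def Bochner_Integration.integral_add)
  finally show ?thesis .
qed

lemma test_energy_linear:
  assumes u: "LS u" and v: "LS v" and w: "LS w"
  shows "test_energy \<mu> \<Omega> (\<lambda>x. a * u x + b * v x) w = a * test_energy \<mu> \<Omega> u w + b * test_energy \<mu> \<Omega> v w"
  unfolding test_energy_LS[OF Lipschitz_supported_lincomb[OF u v] w] test_energy_LS[OF u w] test_energy_LS[OF v w]
    near_form_linear[OF u v w] far_form_linear[OF u v w] log_form_linear[OF u v w]
    mass_form_linear[OF integrable_mult_LS[OF u w] integrable_mult_LS[OF v w]]
  by (simp add: algebra_simps)

lemma test_energy_commute:
  assumes u: "LS u" and v: "LS v"
  shows "test_energy \<mu> \<Omega> u v = test_energy \<mu> \<Omega> v u"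
  unfolding test_energy_LS[OF u v] test_energy_LS[OF v u] far_form_commute[OF u v]
  by (simp add: near_form_def mass_form_def log_form_def mult_ac)

end

lemma fun_add_eq_lincomb: "u + v = (\<lambda>x. 1 * u x + 1 * v x :: real)"
  by (simp add: fun_eq_iff)

lemma fun_scale_eq_lincomb: "a *\<^sub>R u = (\<lambda>x. a * u x + 0 * u x :: real)"
  by (simp add: fun_eq_iff scaleR_fun_def)

lemma subspace_lincomb:
  fixes V :: "('a \<Rightarrow> real) set"
  assumes "0 \<in> V" "\<And>a b u v. u \<in> V \<Longrightarrow> v \<in> V \<Longrightarrow> (\<lambda>x. a * u x + b * v x) \<in> V"
  shows "subspace V"
  unfolding subspace_def using assms(1) assms(2)[of _ _ 1 1] assms(2)[of _ _ _ 0]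
  by (simp only: fun_add_eq_lincomb fun_scale_eq_lincomb) blast

context bounded_open
begin

lemma sym_bilinear_test_energy: "sym_bilinear (test_functions \<Omega>) (test_energy \<mu> \<Omega>)"
proof
  have "(0 :: real ^ 'n \<Rightarrow> real) \<in> test_functions \<Omega>"
    by (simp add: test_functions_def zero_fun_def C_k_const)
  then show "subspace (test_functions \<Omega>)" by (intro subspace_lincomb test_functions_lincomb)
  fix u v w :: "real ^ 'n \<Rightarrow> real" and c :: real
  assume u: "u \<in> test_functions \<Omega>" and w: "w \<in> test_functions \<Omega>"
  note LS = test_function_Lipschitz_supported[OF u] test_function_Lipschitz_supported[OF w]
  show "test_energy \<mu> \<Omega> u w = test_energy \<mu> \<Omega> w u" using LS by (rule test_energy_commute)
  show "test_energy \<mu> \<Omega> (c *\<^sub>R u) w = c * test_energy \<mu> \<Omega> u w"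
    unfolding fun_scale_eq_lincomb test_energy_linear[OF LS(1,1,2)] by simp
  assume v: "v \<in> test_functions \<Omega>"
  show "test_energy \<mu> \<Omega> (u + v) w = test_energy \<mu> \<Omega> u w + test_energy \<mu> \<Omega> v w"
    unfolding fun_add_eq_lincomb test_energy_linear[OF LS(1) test_function_Lipschitz_supported[OF v] LS(2)] by simp
qed

lemma L2_space_iff: "u \<in> L2_space \<Omega> \<longleftrightarrow> u \<in> borel_measurable borel \<and> (\<forall>x. x \<notin> \<Omega> \<longrightarrow> u x = 0) \<and> integrable lborel (\<lambda>x. u x * u x)"
  by (simp add: L2_space_def power2_eq_square)

lemma integrable_mult_L2:
  assumes u: "u \<in> L2_space \<Omega>" and v: "v \<in> L2_space \<Omega>"
  shows "integrable lborel (\<lambda>x. u x * v x)"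
proof (rule Bochner_Integration.integrable_bound)
  show "integrable lborel (\<lambda>x. u x * u x + v x * v x)" using u v by (simp add: L2_space_iff)
  show "(\<lambda>x. u x * v x) \<in> borel_measurable lborel"
    using u v by (intro borel_measurable_times) (simp_all add: L2_space_iff)
  have "\<bar>a * b\<bar> \<le> a * a + b * b" for a b :: real
  proof -
    have "2 * (\<bar>a\<bar> * \<bar>b\<bar>) \<le> a * a + b * b"
      using sum_squares_bound[of "\<bar>a\<bar>" "\<bar>b\<bar>"] by (simp add: power2_eq_square mult.assoc)
    moreover have "0 \<le> \<bar>a\<bar> * \<bar>b\<bar>" by simp
    ultimately show ?thesis unfolding abs_mult by linarith
  qed
  then show "AE x in lborel. norm (u x * v x) \<le> norm (u x * u x + v x * v x)"
    by (auto intro: order_trans[OF _ abs_ge_self])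
qed

lemma L2_inner_eq: "u \<in> L2_space \<Omega> \<Longrightarrow> L2_inner \<Omega> u v = mass_form u v"
  unfolding L2_inner_def mass_form_def by (rule set_integral_supported) (simp add: L2_space_iff)

lemma L2_space_lincomb:
  assumes u: "u \<in> L2_space \<Omega>" and v: "v \<in> L2_space \<Omega>"
  shows "(\<lambda>x. a * u x + b * v x) \<in> L2_space \<Omega>"
proof -
  have "integrable lborel (\<lambda>x. a\<^sup>2 * (u x * u x) + 2 * a * b * (u x * v x) + b\<^sup>2 * (v x * v x))"
    using integrable_mult_L2[OF u u] integrable_mult_L2[OF u v] integrable_mult_L2[OF v v] by simp
  moreover have "(\<lambda>x. (a * u x + b * v x) * (a * u x + b * v x)) = (\<lambda>x. a\<^sup>2 * (u x * u x) + 2 * a * b * (u x * v x) + b\<^sup>2 * (v x * v x))"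
    by (simp add: fun_eq_iff algebra_simps power2_eq_square)
  moreover have "(\<lambda>x. a * u x + b * v x) \<in> borel_measurable borel"
    using u v by (intro borel_measurable_add borel_measurable_times) (simp_all add: L2_space_iff)
  ultimately show ?thesis using u v by (simp add: L2_space_iff)
qed

text \<open>Definiteness is absent because functions are not identified modulo null sets; the
  abstract theory asks for a semi-inner product only.\<close>

lemma semi_inner_L2: "semi_inner (L2_space \<Omega>) (L2_inner \<Omega>)"
proof
  show "subspace (L2_space \<Omega>)"
  proof (rule subspace_lincomb)
    show "0 \<in> L2_space \<Omega>" by (simp add: L2_space_iff zero_fun_def)
  qed (rule L2_space_lincomb)
  show "L2_inner \<Omega> (u + v) w = L2_inner \<Omega> u w + L2_inner \<Omega> v w"
    if "u \<in> L2_space \<Omega>" "v \<in> L2_space \<Omega>" "w \<in> L2_space \<Omega>" for u v w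
    using L2_space_lincomb[OF that(1,2), of 1 1] mass_form_linear[OF integrable_mult_L2 integrable_mult_L2, OF that(1,3) that(2,3), of 1 1] that
    by (simp add: L2_inner_eq plus_fun_def)
  show "L2_inner \<Omega> (c *\<^sub>R u) w = c * L2_inner \<Omega> u w" if "u \<in> L2_space \<Omega>" "w \<in> L2_space \<Omega>" for c u w
    using L2_space_lincomb[OF that(1,1), of c 0] mass_form_linear[OF integrable_mult_L2 integrable_mult_L2, OF that that, of c 0] that
    by (simp add: L2_inner_eq scaleR_fun_def)
  show "L2_inner \<Omega> u v = L2_inner \<Omega> v u" for u v by (simp add: L2_inner_def mult.commute)
  show "0 \<le> L2_inner \<Omega> u u" if "u \<in> L2_space \<Omega>" for u using that by (simp add: L2_inner_eq mass_form_nonneg)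
qed

lemma LS_L2: "LS u \<Longrightarrow> u \<in> L2_space \<Omega>"
  using integrable_mult_LS[of u u] by (auto simp: L2_space_iff Lipschitz_supported_def)

end

section \<open>Compactness\<close>

text \<open>Label of the half-open dyadic cube of side \<open>1 / 2 ^ j\<close> containing the
  point, so the cells of one scale partition the space.\<close>

definition cell_index :: "nat \<Rightarrow> real ^ 'n \<Rightarrow> int ^ 'n" where
  "cell_index j x = (\<chi> i. \<lfloor>2 ^ j * x $ i\<rfloor>)"

definition cell :: "nat \<Rightarrow> int ^ 'n \<Rightarrow> (real ^ 'n) set" where
  "cell j q = {x. cell_index j x = q}"

lemma mem_cell_iff: "x \<in> cell j q \<longleftrightarrow> (\<forall>i. real_of_int (q $ i) / 2 ^ j \<le> x $ i \<and> x $ i < real_of_int (q $ i) / 2 ^ j + 1 / 2 ^ j)"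
proof -
  have "\<lfloor>2 ^ j * x $ i\<rfloor> = q $ i \<longleftrightarrow> real_of_int (q $ i) / 2 ^ j \<le> x $ i \<and> x $ i < real_of_int (q $ i) / 2 ^ j + 1 / 2 ^ j" for i
    by (auto simp: floor_eq_iff field_simps)
  then show ?thesis by (simp add: cell_def cell_index_def vec_eq_iff)
qed

lemma cell_measurable [measurable]: "cell j q \<in> sets borel"
proof -
  have "cell j q = (\<Inter>i\<in>UNIV. {x. real_of_int (q $ i) / 2 ^ j \<le> x $ i} \<inter> {x. x $ i < real_of_int (q $ i) / 2 ^ j + 1 / 2 ^ j})"
    by (auto simp: mem_cell_iff)
  moreover have "{x :: real ^ 'n. a \<le> x $ i} \<in> sets borel" "{x :: real ^ 'n. x $ i < b} \<in> sets borel" for a b i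
    by (auto intro: borel_closed borel_open closed_halfspace_component_ge_cart open_halfspace_component_lt_cart)
  ultimately show ?thesis by (auto intro!: sets.finite_INT)
qed

lemma emeasure_cell: "emeasure lborel (cell j q :: (real ^ 'n) set) = ennreal ((1 / 2 ^ j) ^ CARD('n))"
proof -
  define l :: "real ^ 'n" where "l = (\<chi> i. real_of_int (q $ i) / 2 ^ j)"
  define h :: "real ^ 'n" where "h = l + (1 / 2 ^ j) *\<^sub>R One"
  have h: "h $ i = real_of_int (q $ i) / 2 ^ j + 1 / 2 ^ j" for i
  proof -
    have "One $ i = (One :: real ^ 'n) \<bullet> axis i 1" by (simp add: inner_axis)
    also have "\<dots> = 1" by (simp add: inner_sum_left_Basis axis_in_Basis_iff)
    finally show ?thesis by (simp add: h_def l_def)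
  qed
  have prod: "(\<Prod>b\<in>Basis. (h - l) \<bullet> b) = (1 / 2 ^ j) ^ CARD('n)"
    by (simp add: h_def inner_Basis inner_scaleR_left)
  have le: "l \<bullet> b \<le> h \<bullet> b" if "b \<in> Basis" for b
    using that by (simp add: h_def inner_add_left)
  have "box l h \<subseteq> cell j q" "cell j q \<subseteq> cbox l h"
    by (auto simp: mem_cell_iff mem_box_cart l_def h less_imp_le)
  then have "emeasure lborel (box l h) \<le> emeasure lborel (cell j q)"
    "emeasure lborel (cell j q) \<le> emeasure lborel (cbox l h)"
    by (auto intro: emeasure_mono)
  then show ?thesis
    using emeasure_lborel_box[OF le] emeasure_lborel_cbox[OF le] prod by simp
qed

lemma measure_cell: "measure lborel (cell j q :: (real ^ 'n) set) = (1 / 2 ^ j) ^ CARD('n)"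
  by (simp add: measure_def emeasure_cell)

lemma cell_diameter:
  fixes x y :: "real ^ 'n"
  assumes "cell_index j x = cell_index j y"
  shows "norm (x - y) < CARD('n) / 2 ^ j"
proof -
  have xy: "x \<in> cell j (cell_index j x)" "y \<in> cell j (cell_index j x)" using assms by (auto simp: cell_def)
  have "\<bar>(x - y) $ i\<bar> < 1 / 2 ^ j" for i
    using xy unfolding mem_cell_iff by (auto simp: abs_less_iff) (smt (verit))+
  then have "(\<Sum>i\<in>UNIV. \<bar>(x - y) $ i\<bar>) < (\<Sum>i\<in>(UNIV :: 'n set). 1 / 2 ^ j)"
    by (intro sum_strict_mono) auto
  then show ?thesis using norm_le_l1_cart[of "x - y"] by simp
qed

lemma finite_cell_indices:
  fixes S :: "(real ^ 'n) set"
  assumes "bounded S"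
  shows "finite (cell_index j ` S)"
proof -
  obtain R where R: "\<And>x. x \<in> S \<Longrightarrow> norm x \<le> R" using assms by (auto simp: bounded_iff)
  let ?A = "{- \<lceil>2 ^ j * R\<rceil>..\<lceil>2 ^ j * R\<rceil>}"
  have "cell_index j ` S \<subseteq> vec_lambda ` (UNIV \<rightarrow>\<^sub>E ?A)"
  proof
    fix q assume "q \<in> cell_index j ` S"
    then obtain x where x: "x \<in> S" "q = cell_index j x" by auto
    have "q $ i \<in> ?A" for i
    proof -
      have "\<bar>x $ i\<bar> \<le> R" using component_le_norm_cart[of x i] R[OF x(1)] by simp
      then have "\<bar>2 ^ j * x $ i\<bar> \<le> 2 ^ j * R" by (simp add: abs_mult)
      then have "2 ^ j * x $ i \<le> 2 ^ j * R" "- (2 ^ j * R) \<le> 2 ^ j * x $ i" by linarith+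
      moreover have "2 ^ j * R \<le> \<lceil>2 ^ j * R\<rceil>" by (rule le_of_int_ceiling)
      ultimately have "- real_of_int \<lceil>2 ^ j * R\<rceil> \<le> 2 ^ j * x $ i" "2 ^ j * x $ i < real_of_int \<lceil>2 ^ j * R\<rceil> + 1"
        by linarith+
      then show ?thesis unfolding x(2) cell_index_def by (simp add: floor_le_iff le_floor_iff)
    qed
    then have "vec_nth q \<in> UNIV \<rightarrow>\<^sub>E ?A" by auto
    then show "q \<in> vec_lambda ` (UNIV \<rightarrow>\<^sub>E ?A)" by (metis image_eqI vec_lambda_eta)
  qed
  moreover have "finite (vec_lambda ` (UNIV \<rightarrow>\<^sub>E ?A) :: (int ^ 'n) set)" by (intro finite_imageI finite_PiE) auto
  ultimately show ?thesis by (rule finite_subset)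
qed

text \<open>A geometric series with ratio at least 2 is at most twice its last term, and the last
  active term is below \<open>t ^ N\<close>.\<close>

lemma dyadic_sum_le:
  fixes t :: real
  assumes "N \<ge> 1" "t > 0"
  shows "(\<Sum>j<J. if 2 ^ j < t then (2 ^ j) ^ N else 0) \<le> 2 * t ^ N"
proof (induction J)
  case (Suc J)
  show ?case
  proof (cases "2 ^ J < t")
    case True
    have full: "(\<Sum>j<Suc J. if 2 ^ j < t then (2 ^ j) ^ N else 0) \<le> (\<Sum>j<Suc J. ((2 ^ N) ^ j :: real))"
      by (intro sum_mono) (auto simp: power_mult[symmetric] mult.commute)
    have "(\<Sum>j<Suc K. ((2 ^ N) ^ j :: real)) \<le> 2 * (2 ^ N) ^ K" for K
    proof (induction K)
      case (Suc K)
      have "(2::real) * (2 ^ N) ^ K \<le> 2 ^ N * (2 ^ N) ^ K"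
        using assms(1) power_increasing[of 1 N "2::real"] by (intro mult_right_mono) auto
      moreover have "(\<Sum>j<Suc (Suc K). ((2 ^ N) ^ j :: real)) = (\<Sum>j<Suc K. (2 ^ N) ^ j) + 2 ^ N * (2 ^ N) ^ K" by simp
      moreover have "2 * ((2 ^ N) ^ Suc K :: real) = 2 * (2 ^ N * (2 ^ N) ^ K)" by simp
      ultimately show ?case using Suc by linarith
    qed simp
    also have "2 * (2 ^ N) ^ J = 2 * ((2 ^ J) ^ N :: real)" by (simp add: power_mult[symmetric] mult.commute)
    also have "2 * (2 ^ J) ^ N \<le> 2 * t ^ N" using True by (intro mult_left_mono power_mono) auto
    finally show ?thesis using full by linarith
  qed (use Suc in simp)
qed (use assms in simp)

text \<open>The averaging kernels of all scales together cost no more than a multiple of one near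
  kernel. Points sharing a cell of scale \<open>j\<close> are closer than
  \<open>CARD('n) / 2 ^ j\<close>, so only scales with \<open>2 ^ j\<close> below the reciprocal
  distance contribute and their sum is geometric. Starting at \<open>j0\<close> keeps such points
  closer than 1, inside the range of the near kernel.\<close>

lemma dyadic_kernel_le:
  fixes x y :: "real ^ 'n"
  assumes "x \<noteq> y" and j0: "real CARD('n) \<le> 2 ^ j0"
  shows "(\<Sum>j\<in>{j0..<J}. if cell_index j x = cell_index j y then (2 ^ j) ^ CARD('n) else 0) \<le>
    2 * real CARD('n) ^ CARD('n) * near_kernel (x - y)"
proof (cases "\<exists>j\<in>{j0..<J}. cell_index j x = cell_index j y")
  case False
  then have "(\<Sum>j\<in>{j0..<J}. if cell_index j x = cell_index j y then (2 ^ j) ^ CARD('n) else 0) = (\<Sum>j\<in>{j0..<J}. 0 :: real)"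
    by (intro sum.cong) auto
  then show ?thesis by simp
next
  case True
  define t where "t = CARD('n) / norm (x - y)"
  have pos: "norm (x - y) > 0" using assms by simp
  have t: "t > 0" using pos by (simp add: t_def)
  obtain j where j: "j \<ge> j0" "cell_index j x = cell_index j y" using True by auto
  have "norm (x - y) < CARD('n) / 2 ^ j" by (rule cell_diameter[OF j(2)])
  also have "\<dots> \<le> CARD('n) / 2 ^ j0" using j(1) by (intro divide_left_mono) auto
  also have "\<dots> \<le> 1" using j0 by simp
  finally have near: "near_kernel (x - y) = 1 / norm (x - y) ^ CARD('n)" by (simp add: near_kernel_def)
  have "(\<Sum>j\<in>{j0..<J}. if cell_index j x = cell_index j y then (2 ^ j) ^ CARD('n) else 0) \<le>
      (\<Sum>j\<in>{j0..<J}. if 2 ^ j < t then (2 ^ j) ^ CARD('n) else (0::real))"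
  proof (intro sum_mono)
    fix j
    have "2 ^ j < t" if "cell_index j x = cell_index j y"
      using cell_diameter[OF that] pos by (simp add: t_def field_simps)
    then show "(if cell_index j x = cell_index j y then (2 ^ j) ^ CARD('n) else 0) \<le> (if 2 ^ j < t then (2 ^ j) ^ CARD('n) else (0::real))"
      by auto
  qed
  also have "\<dots> \<le> (\<Sum>j<J. if 2 ^ j < t then (2 ^ j) ^ CARD('n) else (0::real))"
    by (intro sum_mono2) auto
  also have "\<dots> \<le> 2 * t ^ CARD('n)" using t by (intro dyadic_sum_le) (auto simp: Suc_leI)
  also have "\<dots> = 2 * real CARD('n) ^ CARD('n) * near_kernel (x - y)" by (simp add: near t_def power_divide)
  finally show ?thesis .
qed

context bounded_open
begin

definition cell_mean :: "(real ^ 'n \<Rightarrow> real) \<Rightarrow> nat \<Rightarrow> int ^ 'n \<Rightarrow> real" where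
  "cell_mean u j q = (2 ^ j) ^ CARD('n) * (LINT x|lborel. indicator (cell j q) x * u x)"

lemma LS_integrable:
  assumes "LS u" shows "integrable lborel u"
  by (rule L1_le_L2(1)[OF LS_measurable[OF assms] LS_zero[OF assms] integrable_mult_LS[OF assms assms]])

lemma integrable_cell: "LS u \<Longrightarrow> integrable lborel (\<lambda>y. indicator (cell j q) y * u y)"
  using integrable_mult_indicator[OF _ LS_integrable, of "cell j q" u] by simp

text \<open>The value at \<open>x\<close> is its deviation from the cell mean plus the mean;
  \<open>p\<^sup>2 \<le> 2 * (p - m)\<^sup>2 + 2 * m\<^sup>2\<close> and convexity of the square
  bound the deviation by the average of \<open>(u x - u y)\<^sup>2\<close> over the cell.\<close>

lemma pointwise_cell_estimate:
  assumes u: "LS u"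
  shows "ennreal ((u x)\<^sup>2) \<le> 2 * (\<integral>\<^sup>+y. ennreal ((if cell_index j x = cell_index j y then (2 ^ j) ^ CARD('n) else 0) * (u x - u y)\<^sup>2) \<partial>lborel)
    + ennreal (2 * (cell_mean u j (cell_index j x))\<^sup>2)"
proof -
  define q where "q = cell_index j x"
  define v :: real where "v = (2 ^ j) ^ CARD('n)"
  let ?i = "indicator (cell j q) :: _ \<Rightarrow> real"
  have v: "v > 0" by (simp add: v_def)
  have meas: "measure lborel (cell j q) = 1 / v" by (simp add: measure_cell v_def power_one_over)
  have i: "integrable lborel ?i" by (simp add: emeasure_cell)
  have ui: "integrable lborel (\<lambda>y. ?i y * u y)" using u by (rule integrable_cell)
  have uui: "integrable lborel (\<lambda>y. ?i y * (u y * u y))"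
    using integrable_mult_indicator[OF _ integrable_mult_LS[OF u u], of "cell j q"] by simp
  define b where "b = (LINT y|lborel. ?i y * u y)"
  define S where "S = (LINT y|lborel. ?i y * (u y * u y))"
  have mean: "cell_mean u j q = v * b" by (simp add: cell_mean_def b_def v_def)
  have expand: "integrable lborel (\<lambda>y. ?i y * (c - u y)\<^sup>2)" "(LINT y|lborel. ?i y * (c - u y)\<^sup>2) = c\<^sup>2 / v - 2 * c * b + S" for c
  proof -
    have eq: "(\<lambda>y. ?i y * (c - u y)\<^sup>2) = (\<lambda>y. c\<^sup>2 * ?i y - (2 * c) * (?i y * u y) + ?i y * (u y * u y))"
      by (simp add: fun_eq_iff power2_eq_square algebra_simps)
    show "integrable lborel (\<lambda>y. ?i y * (c - u y)\<^sup>2)" unfolding eq using i ui uui by simp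
    show "(LINT y|lborel. ?i y * (c - u y)\<^sup>2) = c\<^sup>2 / v - 2 * c * b + S"
      unfolding eq using i ui uui by (simp add: b_def S_def meas)
  qed
  \<comment> \<open>Nonnegativity of the variance: \<open>v\<close> is the reciprocal of the cell
    volume, so \<open>v * b\<close> is the mean of \<open>u\<close> over the cell.\<close>
  have "0 \<le> (LINT y|lborel. ?i y * (v * b - u y)\<^sup>2)" by (intro integral_nonneg_AE) auto
  then have S: "v * b\<^sup>2 \<le> S" unfolding expand(2) using v by (simp add: power2_eq_square field_simps)
  define c where "c = u x"
  have "c\<^sup>2 \<le> c\<^sup>2 + (c - 2 * v * b)\<^sup>2" by simp
  also have "\<dots> = 2 * v * (c\<^sup>2 / v - 2 * c * b + v * b\<^sup>2) + 2 * (v * b)\<^sup>2"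
    using v by (simp add: power2_eq_square algebra_simps)
  also have "\<dots> \<le> 2 * v * (c\<^sup>2 / v - 2 * c * b + S) + 2 * (v * b)\<^sup>2"
    using S v by simp
  also have "\<dots> = 2 * (LINT y|lborel. v * (?i y * (c - u y)\<^sup>2)) + 2 * (v * b)\<^sup>2"
    by (simp add: expand(2) mult.assoc)
  finally have "ennreal (c\<^sup>2) \<le> ennreal (2 * (LINT y|lborel. v * (?i y * (c - u y)\<^sup>2)) + 2 * (v * b)\<^sup>2)"
    by (rule ennreal_leI)
  also have "\<dots> = 2 * ennreal (LINT y|lborel. v * (?i y * (c - u y)\<^sup>2)) + ennreal (2 * (v * b)\<^sup>2)"
    using v by (subst ennreal_plus) (auto simp: ennreal_mult intro!: integral_nonneg_AE)
  also have "ennreal (LINT y|lborel. v * (?i y * (c - u y)\<^sup>2)) = (\<integral>\<^sup>+y. ennreal (v * (?i y * (c - u y)\<^sup>2)) \<partial>lborel)"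
    using v expand(1)[of c] by (subst nn_integral_eq_integral) auto
  also have "\<dots> = (\<integral>\<^sup>+y. ennreal ((if cell_index j x = cell_index j y then (2 ^ j) ^ CARD('n) else 0) * (u x - u y)\<^sup>2) \<partial>lborel)"
    by (intro nn_integral_cong) (auto simp: indicator_def cell_def q_def v_def c_def)
  finally show ?thesis by (simp add: c_def mean flip: q_def)
qed

lemma cell_index_measurable [measurable]: "Measurable.pred borel (\<lambda>y. cell_index j x = cell_index j y)"
proof -
  have "{y. cell_index j x = cell_index j y} = cell j (cell_index j x)" by (auto simp: cell_def)
  then show ?thesis by (simp add: pred_def)
qed

text \<open>The pointwise estimate is summed over the scales. The left side and the contribution of
  the means grow with the number of scales, whereas the kernel term does not, by
  \<open>dyadic_kernel_le\<close>; division by that number makes the kernel term as small as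
  desired.\<close>

lemma mass_form_dyadic_estimate:
  assumes u: "LS u" and j0: "real CARD('n) \<le> 2 ^ j0" and "j0 \<le> J" and \<delta>: "\<delta> \<ge> 0"
    and mean: "\<And>j q. j \<in> {j0..<J} \<Longrightarrow> q \<in> cell_index j ` \<Omega> \<Longrightarrow> \<bar>cell_mean u j q\<bar> \<le> \<delta>"
  shows "real (J - j0) * mass_form u u \<le>
    4 * real CARD('n) ^ CARD('n) * near_form u u + real (J - j0) * (2 * \<delta>\<^sup>2 * measure lborel \<Omega>)"
proof -
  define K where "K = real (J - j0)"
  define D where "D = 2 * real CARD('n) ^ CARD('n)"
  have [measurable]: "u \<in> borel_measurable borel" using u by measurable
  let ?k = "\<lambda>j x y. (if cell_index j x = cell_index j y then (2 ^ j) ^ CARD('n) else 0) :: real"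
  have K: "K \<ge> 0" by (simp add: K_def)
  have D: "D \<ge> 0" by (simp add: D_def)
  have pt: "ennreal (K * (u x)\<^sup>2) \<le> 2 * (\<integral>\<^sup>+y. ennreal (D * (near_kernel (x - y) * (u x - u y)\<^sup>2)) \<partial>lborel)
      + ennreal (K * (2 * \<delta>\<^sup>2)) * indicator \<Omega> x" for x
  proof (cases "x \<in> \<Omega>")
    case True
    have "ennreal (K * (u x)\<^sup>2) = (\<Sum>j\<in>{j0..<J}. ennreal ((u x)\<^sup>2))"
      by (simp add: K_def ennreal_mult ennreal_of_nat_eq_real_of_nat)
    also have "\<dots> \<le> (\<Sum>j\<in>{j0..<J}. 2 * (\<integral>\<^sup>+y. ennreal (?k j x y * (u x - u y)\<^sup>2) \<partial>lborel) + ennreal (2 * \<delta>\<^sup>2))"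
    proof (intro sum_mono)
      fix j assume j: "j \<in> {j0..<J}"
      have "(cell_mean u j (cell_index j x))\<^sup>2 \<le> \<delta>\<^sup>2"
        using mean[OF j, of "cell_index j x"] True \<delta> by (simp add: abs_le_square_iff[symmetric])
      then show "ennreal ((u x)\<^sup>2) \<le> 2 * (\<integral>\<^sup>+y. ennreal (?k j x y * (u x - u y)\<^sup>2) \<partial>lborel) + ennreal (2 * \<delta>\<^sup>2)"
        by (intro order_trans[OF pointwise_cell_estimate[OF u]] add_mono order_refl ennreal_leI) auto
    qed
    also have "\<dots> = 2 * (\<Sum>j\<in>{j0..<J}. \<integral>\<^sup>+y. ennreal (?k j x y * (u x - u y)\<^sup>2) \<partial>lborel) + ennreal (K * (2 * \<delta>\<^sup>2))"
      by (simp add: sum.distrib sum_distrib_left K_def ennreal_mult ennreal_of_nat_eq_real_of_nat)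
    also have "(\<Sum>j\<in>{j0..<J}. \<integral>\<^sup>+y. ennreal (?k j x y * (u x - u y)\<^sup>2) \<partial>lborel) =
        (\<integral>\<^sup>+y. (\<Sum>j\<in>{j0..<J}. ennreal (?k j x y * (u x - u y)\<^sup>2)) \<partial>lborel)"
      by (rule nn_integral_sum[symmetric]) measurable
    also have "\<dots> \<le> (\<integral>\<^sup>+y. ennreal (D * (near_kernel (x - y) * (u x - u y)\<^sup>2)) \<partial>lborel)"
    proof (intro nn_integral_mono)
      fix y
      have "(\<Sum>j\<in>{j0..<J}. ?k j x y) * (u x - u y)\<^sup>2 \<le> D * near_kernel (x - y) * (u x - u y)\<^sup>2"
      proof (cases "x = y")
        case False
        then show ?thesis using dyadic_kernel_le[OF False j0, of J] by (intro mult_right_mono) (auto simp: D_def)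
      qed simp
      then show "(\<Sum>j\<in>{j0..<J}. ennreal (?k j x y * (u x - u y)\<^sup>2)) \<le> ennreal (D * (near_kernel (x - y) * (u x - u y)\<^sup>2))"
        by (subst sum_ennreal) (auto simp: sum_distrib_right mult.assoc intro!: ennreal_leI)
    qed
    finally show ?thesis using True by (simp add: add_right_mono mult_left_mono)
  next
    case False
    then show ?thesis using LS_zero[OF u] by simp
  qed
  have "ennreal (K * mass_form u u) = ennreal K * (\<integral>\<^sup>+x. ennreal ((u x)\<^sup>2) \<partial>lborel)"
    using K mass_form_nonneg[of u] by (simp add: mass_form_nn_integral[OF u, symmetric] ennreal_mult)
  also have "\<dots> = (\<integral>\<^sup>+x. ennreal (K * (u x)\<^sup>2) \<partial>lborel)"
    using K by (simp add: ennreal_mult nn_integral_cmult)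
  also have "\<dots> \<le> (\<integral>\<^sup>+x. 2 * (\<integral>\<^sup>+y. ennreal (D * (near_kernel (x - y) * (u x - u y)\<^sup>2)) \<partial>lborel)
      + ennreal (K * (2 * \<delta>\<^sup>2)) * indicator \<Omega> x \<partial>lborel)"
    by (intro nn_integral_mono pt)
  also have "\<dots> = 2 * (\<integral>\<^sup>+x. \<integral>\<^sup>+y. ennreal (D * (near_kernel (x - y) * (u x - u y)\<^sup>2)) \<partial>lborel \<partial>lborel)
      + ennreal (K * (2 * \<delta>\<^sup>2)) * emeasure lborel \<Omega>"
    by (simp add: nn_integral_add nn_integral_cmult)
  also have "(\<integral>\<^sup>+x. \<integral>\<^sup>+y. ennreal (D * (near_kernel (x - y) * (u x - u y)\<^sup>2)) \<partial>lborel \<partial>lborel) = ennreal (D * near_form u u)"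
    using D near_form_nonneg[OF u] by (simp add: ennreal_mult nn_integral_cmult near_form_nn_integral(1)[OF u])
  also have "emeasure lborel \<Omega> = ennreal (measure lborel \<Omega>)"
    using \<Omega>_finite by (intro emeasure_eq_ennreal_measure) auto
  also have "2 * ennreal (D * near_form u u) + ennreal (K * (2 * \<delta>\<^sup>2)) * ennreal (measure lborel \<Omega>) =
      ennreal (2 * D * near_form u u + K * (2 * \<delta>\<^sup>2 * measure lborel \<Omega>))"
    using D K near_form_nonneg[OF u] by (simp add: ennreal_mult mult_ac)
  finally have "K * mass_form u u \<le> 2 * D * near_form u u + K * (2 * \<delta>\<^sup>2 * measure lborel \<Omega>)"
    using D K near_form_nonneg[OF u] by (subst (asm) ennreal_le_iff) auto
  then show ?thesis by (simp add: K_def D_def)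
qed

lemma near_form_diff_le:
  assumes u: "LS u" and v: "LS v"
  shows "near_form (u - v) (u - v) \<le> 2 * near_form u u + 2 * near_form v v"
proof -
  have d: "(u - v) = (\<lambda>x. 1 * u x + (-1) * v x)" and s: "(u + v) = (\<lambda>x. 1 * u x + 1 * v x)" by (simp_all add: fun_eq_iff)
  have LSd: "LS (u - v)" unfolding d by (rule Lipschitz_supported_lincomb[OF u v])
  have LSs: "LS (u + v)" unfolding s by (rule Lipschitz_supported_lincomb[OF u v])
  have comm: "near_form f g = near_form g f" for f g by (simp add: near_form_def mult_ac)
  have "near_form (u - v) (u - v) = near_form u (u - v) - near_form v (u - v)"
    using near_form_linear[OF u v LSd, of 1 "-1"] unfolding d[symmetric] by simp
  also have "\<dots> = near_form u u - 2 * near_form u v + near_form v v"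
    unfolding comm[of u "u - v"] comm[of v "u - v"] unfolding d near_form_linear[OF u v u] near_form_linear[OF u v v]
    by (simp add: comm[of v u])
  finally have 1: "near_form (u - v) (u - v) = near_form u u - 2 * near_form u v + near_form v v" .
  have "near_form (u + v) (u + v) = near_form u (u + v) + near_form v (u + v)"
    using near_form_linear[OF u v LSs, of 1 1] unfolding s[symmetric] by simp
  also have "\<dots> = near_form u u + 2 * near_form u v + near_form v v"
    unfolding comm[of u "u + v"] comm[of v "u + v"] unfolding s near_form_linear[OF u v u] near_form_linear[OF u v v]
    by (simp add: comm[of v u])
  finally show ?thesis using 1 near_form_nonneg[OF LSs] by simp
qed

text \<open>Smallness of a difference follows from finitely many cell means, the remainder being
  controlled by the uniform bound on \<open>near_form\<close>. Along a diagonal subsequence all cell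
  integrals converge.\<close>

lemma compact_embedding:
  fixes U :: "nat \<Rightarrow> real ^ 'n \<Rightarrow> real"
  assumes U: "\<And>n. LS (U n)" and mass: "\<And>n. mass_form (U n) (U n) \<le> M" and near: "\<And>n. near_form (U n) (U n) \<le> M"
  shows "\<exists>r. strict_mono r \<and> form_Cauchy mass_form (U \<circ> r)"
proof -
  define m where "m = measure lborel \<Omega> + 1"
  have m: "m > 0" by (simp add: m_def add_nonneg_pos)
  have M: "M \<ge> 0" using order_trans[OF mass_form_nonneg mass] .
  define b where "b = (\<lambda>n (p :: nat \<times> (int ^ 'n)). LINT x|lborel. indicator (cell (fst p) (snd p)) x * U n x)"
  have "norm (b n p) \<le> sqrt (m * M)" for n p
  proof (rule real_le_rsqrt)
    have "\<bar>b n p\<bar> \<le> (LINT x|lborel. \<bar>indicator (cell (fst p) (snd p)) x * U n x\<bar>)"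
      unfolding b_def by (rule integral_abs_bound)
    also have "\<dots> \<le> (LINT x|lborel. \<bar>U n x\<bar>)"
      using LS_integrable[OF U] by (intro integral_mono') (auto simp: indicator_def)
    finally have "\<bar>b n p\<bar>\<^sup>2 \<le> (LINT x|lborel. \<bar>U n x\<bar>)\<^sup>2" by (intro power_mono) auto
    also have "\<dots> \<le> m * mass_form (U n) (U n)"
      unfolding m_def by (rule L1_le_L2(2)[OF LS_measurable[OF U] LS_zero[OF U] integrable_mult_LS[OF U U]])
    also have "\<dots> \<le> m * M" using m mass by (intro mult_left_mono) auto
    finally show "(norm (b n p))\<^sup>2 \<le> m * M" by simp
  qed
  \<comment> \<open>Pairs of a scale and a cell label are countable, and the integrals are bounded
    uniformly in \<open>n\<close>, so one subsequence serves for all of them.\<close>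
  then obtain r where r: "strict_mono (r :: nat \<Rightarrow> nat)" "\<And>p. \<exists>l. (\<lambda>n. b (r n) p) \<longlonglongrightarrow> l"
    using function_convergent_subsequence[OF countableI_type[of UNIV], of b "sqrt (m * M)"] by (metis UNIV_I)
  have "form_Cauchy mass_form (U \<circ> r)"
    unfolding form_Cauchy_def
  proof (intro allI impI)
    fix e :: real assume e: "e > 0"
    obtain j0 where j0: "real CARD('n) \<le> 2 ^ j0" using real_arch_pow[of 2 "real CARD('n)"] by (auto intro: less_imp_le)
    define D where "D = 4 * real CARD('n) ^ CARD('n)"
    have D: "D \<ge> 0" by (simp add: D_def)
    \<comment> \<open>Number of scales: \<open>4 * M\<close> bounds \<open>near_form\<close> of a
      difference, and division by \<open>K\<close> brings the kernel term below
      \<open>e / 2\<close>. The choice of \<open>\<delta>\<close> below does the same for the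
      means.\<close>
    obtain K :: nat where K: "D * (4 * M) / (e / 2) < real K" using reals_Archimedean2 by blast
    have "0 \<le> D * (4 * M) / (e / 2)" using D M e by simp
    then have "K > 0" using K by linarith
    define J where "J = j0 + K"
    define \<delta> where "\<delta> = sqrt (e / (8 * m))"
    have \<delta>: "\<delta> > 0" using e m by (simp add: \<delta>_def)
    define Q where "Q = (SIGMA j:{j0..<J}. cell_index j ` \<Omega>)"
    have fin: "finite Q" unfolding Q_def using finite_cell_indices[OF bounded] by (intro finite_SigmaI) auto
    have "\<exists>N. \<forall>k\<ge>N. \<forall>l\<ge>N. \<bar>(2 ^ fst p) ^ CARD('n) * (b (r k) p - b (r l) p)\<bar> \<le> \<delta>" for p
    proof -
      define a :: real where "a = (2 ^ fst p) ^ CARD('n)"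
      have a: "a > 0" by (simp add: a_def)
      have "Cauchy (\<lambda>n. b (r n) p)" using r(2)[of p] by (auto intro: LIMSEQ_imp_Cauchy)
      then obtain N where N: "\<And>k l. k \<ge> N \<Longrightarrow> l \<ge> N \<Longrightarrow> dist (b (r k) p) (b (r l) p) < \<delta> / a"
        using a \<delta> unfolding Cauchy_def by (meson divide_pos_pos)
      have "\<bar>a * (b (r k) p - b (r l) p)\<bar> \<le> \<delta>" if "k \<ge> N" "l \<ge> N" for k l
        using N[OF that] a by (simp add: dist_real_def abs_mult pos_less_divide_eq mult.commute less_imp_le)
      then show ?thesis by (auto simp: a_def)
    qed
    then obtain N where N: "\<And>p k l. k \<ge> N p \<Longrightarrow> l \<ge> N p \<Longrightarrow> \<bar>(2 ^ fst p) ^ CARD('n) * (b (r k) p - b (r l) p)\<bar> \<le> \<delta>" by metis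
    \<comment> \<open>Convergence is not uniform in the cells, but only finitely many cells of the
      selected scales meet the bounded domain.\<close>
    define N' where "N' = Max (insert 0 (N ` Q))"
    have N': "N p \<le> N'" if "p \<in> Q" for p unfolding N'_def using fin that by (intro Max_ge) auto
    have "mass_form (U (r k) - U (r l)) (U (r k) - U (r l)) < e" if k: "k \<ge> N'" and l: "l \<ge> N'" for k l
    proof -
      let ?w = "U (r k) - U (r l)"
      have w: "?w = (\<lambda>x. 1 * U (r k) x + (-1) * U (r l) x)" by (simp add: fun_eq_iff)
      have LSw: "LS ?w" unfolding w by (rule Lipschitz_supported_lincomb[OF U U])
      have "\<bar>cell_mean ?w j q\<bar> \<le> \<delta>" if "j \<in> {j0..<J}" "q \<in> cell_index j ` \<Omega>" for j q
      proof -
        have p: "(j, q) \<in> Q" using that by (simp add: Q_def)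
        have "(LINT x|lborel. indicator (cell j q) x * ?w x) = b (r k) (j, q) - b (r l) (j, q)"
          using integrable_cell[OF U] by (simp add: b_def right_diff_distrib Bochner_Integration.integral_diff)
        then show ?thesis using N[of "(j, q)" k l] N'[OF p] k l by (simp add: cell_mean_def)
      qed
      then have "real (J - j0) * mass_form ?w ?w \<le> D * near_form ?w ?w + real (J - j0) * (2 * \<delta>\<^sup>2 * measure lborel \<Omega>)"
        unfolding D_def using \<delta> by (intro mass_form_dyadic_estimate LSw j0) (auto simp: J_def)
      also have "\<dots> \<le> D * (4 * M) + real K * (2 * \<delta>\<^sup>2 * measure lborel \<Omega>)"
        using D near_form_diff_le[OF U U, of "r k" "r l"] near[of "r k"] near[of "r l"]
        by (intro add_mono mult_left_mono) (auto simp: J_def)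
      also have "\<dots> < real K * (e / 2) + real K * (e / 2)"
      proof (intro add_less_le_mono mult_left_mono)
        show "D * (4 * M) < real K * (e / 2)" using K e by (simp add: field_simps)
        have "2 * \<delta>\<^sup>2 * measure lborel \<Omega> \<le> 2 * \<delta>\<^sup>2 * m" by (intro mult_left_mono) (auto simp: m_def)
        also have "\<dots> \<le> e / 2" using e m by (simp add: \<delta>_def)
        finally show "2 * \<delta>\<^sup>2 * measure lborel \<Omega> \<le> e / 2" .
      qed simp
      finally have "real K * mass_form ?w ?w < real K * e" by (simp add: J_def algebra_simps)
      then show ?thesis using \<open>K > 0\<close> by simp
    qed
    then show "\<exists>M. \<forall>k\<ge>M. \<forall>l\<ge>M. mass_form ((U \<circ> r) k - (U \<circ> r) l) ((U \<circ> r) k - (U \<circ> r) l) < e"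
      by (intro exI[of _ N']) simp
  qed
  with r(1) show ?thesis by blast
qed

end

section \<open>Completeness and closability\<close>

lemma nn_integral_le_of_AE_limit:
  assumes [measurable]: "\<And>k. f k \<in> borel_measurable M"
    and lim: "AE x in M. (\<lambda>k::nat. f k x) \<longlonglongrightarrow> (g x :: ennreal)"
  shows "(\<integral>\<^sup>+x. g x \<partial>M) \<le> liminf (\<lambda>k. \<integral>\<^sup>+x. f k x \<partial>M)"
proof -
  have "(\<integral>\<^sup>+x. g x \<partial>M) = (\<integral>\<^sup>+x. liminf (\<lambda>k. f k x) \<partial>M)"
    using lim by (intro nn_integral_cong_AE) (auto simp: lim_imp_Liminf)
  also have "\<dots> \<le> liminf (\<lambda>k. \<integral>\<^sup>+x. f k x \<partial>M)" by (rule nn_integral_liminf) measurable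
  finally show ?thesis .
qed

lemma liminf_le_const:
  assumes "eventually (\<lambda>k. f k \<le> (c::ennreal)) sequentially"
  shows "liminf f \<le> c"
  using Liminf_mono[OF assms] by (simp add: Liminf_const)

context bounded_open
begin

lemma L2_nn_integral:
  assumes "u \<in> L2_space \<Omega>"
  shows "(\<integral>\<^sup>+x. ennreal ((u x)\<^sup>2) \<partial>lborel) = ennreal (L2_inner \<Omega> u u)"
proof -
  have "integrable lborel (\<lambda>x. (u x)\<^sup>2)" using assms by (simp add: L2_space_def)
  from nn_integral_eq_integral[OF this] show ?thesis
    using L2_inner_eq[OF assms] by (simp add: mass_form_def power2_eq_square)
qed

text \<open>Riesz-Fischer: on a bounded domain an L2-Cauchy sequence is L1-Cauchy, hence has an
  almost everywhere convergent subsequence, and Fatou's lemma turns the Cauchy estimate into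
  convergence in L2.\<close>

lemma L2_complete:
  assumes U: "\<And>n. U n \<in> L2_space \<Omega>" and Cauchy: "form_Cauchy (L2_inner \<Omega>) U"
  shows "\<exists>u\<in>L2_space \<Omega>. (\<lambda>n. L2_inner \<Omega> (U n - u) (U n - u)) \<longlonglongrightarrow> 0"
proof -
  interpret L2: semi_inner "L2_space \<Omega>" "L2_inner \<Omega>" by (rule semi_inner_L2)
  have meas [measurable]: "U n \<in> borel_measurable borel" for n using U[of n] by (simp add: L2_space_iff)
  have zero: "U n x = 0" if "x \<notin> \<Omega>" for n x using U[of n] that by (simp add: L2_space_iff)
  have L1: "integrable lborel (U n)" for n
    by (rule L1_le_L2(1)[OF meas zero]) (use U[of n] in \<open>simp_all add: L2_space_iff\<close>)
  have diff: "U m - U n \<in> L2_space \<Omega>" for m n using U by simp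
  define a where "a = measure lborel \<Omega> + 1"
  have a: "a > 0" by (simp add: a_def add_nonneg_pos)
  have "\<exists>N. \<forall>i\<ge>N. \<forall>j\<ge>N. (LINT x|lborel. norm (U i x - U j x)) < e" if "e > 0" for e
  proof -
    have "e\<^sup>2 / a > 0" using that a by simp
    then obtain N where N: "\<And>i j. i \<ge> N \<Longrightarrow> j \<ge> N \<Longrightarrow> L2_inner \<Omega> (U i - U j) (U i - U j) < e\<^sup>2 / a"
      using Cauchy unfolding form_Cauchy_def by blast
    have "(LINT x|lborel. norm (U i x - U j x)) < e" if "i \<ge> N" "j \<ge> N" for i j
    proof (rule power2_less_imp_less)
      have "(LINT x|lborel. norm (U i x - U j x))\<^sup>2 \<le> a * mass_form (U i - U j) (U i - U j)"
        using L1_le_L2(2)[of "U i - U j"] diff[of i j] by (simp add: L2_space_iff a_def)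
      also have "\<dots> < e\<^sup>2"
        using N[OF that] a L2_inner_eq[OF diff[of i j]] by (simp add: field_simps)
      finally show "(LINT x|lborel. norm (U i x - U j x))\<^sup>2 < e\<^sup>2" .
    qed (use \<open>e > 0\<close> in simp)
    then show ?thesis by blast
  qed
  then obtain r where r: "strict_mono r" "AE x in lborel. Cauchy (\<lambda>i. U (r i) x)"
    using cauchy_L1_AE_cauchy_subseq[of lborel U] L1 by blast
  define u where "u = (\<lambda>x. lim (\<lambda>i. U (r i) x))"
  have [measurable]: "u \<in> borel_measurable borel" unfolding u_def by measurable
  have u_zero: "u x = 0" if "x \<notin> \<Omega>" for x using zero[OF that] by (simp add: u_def)
  have conv: "AE x in lborel. (\<lambda>i. U (r i) x) \<longlonglongrightarrow> u x"
    using r(2) by eventually_elim (auto simp: u_def real_Cauchy_convergent convergent_LIMSEQ_iff[symmetric])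
  have close: "\<exists>N. \<forall>n\<ge>N. (\<integral>\<^sup>+x. ennreal ((U n x - u x)\<^sup>2) \<partial>lborel) \<le> ennreal e" if "e > 0" for e
  proof -
    obtain N where N: "\<And>i j. i \<ge> N \<Longrightarrow> j \<ge> N \<Longrightarrow> L2_inner \<Omega> (U i - U j) (U i - U j) < e"
      using Cauchy \<open>e > 0\<close> unfolding form_Cauchy_def by blast
    have "(\<integral>\<^sup>+x. ennreal ((U n x - u x)\<^sup>2) \<partial>lborel) \<le> ennreal e" if n: "n \<ge> N" for n
    proof -
      have "AE x in lborel. (\<lambda>k. ennreal ((U n x - U (r k) x)\<^sup>2)) \<longlonglongrightarrow> ennreal ((U n x - u x)\<^sup>2)"
        using conv by eventually_elim (intro tendsto_intros)
      then have "(\<integral>\<^sup>+x. ennreal ((U n x - u x)\<^sup>2) \<partial>lborel) \<le> liminf (\<lambda>k. \<integral>\<^sup>+x. ennreal ((U n x - U (r k) x)\<^sup>2) \<partial>lborel)"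
        by (intro nn_integral_le_of_AE_limit) auto
      also have "\<dots> \<le> ennreal e"
      proof (rule liminf_le_const, rule eventually_sequentiallyI)
        fix k assume "k \<ge> N"
        then have "r k \<ge> N" using seq_suble[OF r(1), of k] by simp
        then show "(\<integral>\<^sup>+x. ennreal ((U n x - U (r k) x)\<^sup>2) \<partial>lborel) \<le> ennreal e"
          using L2_nn_integral[OF diff[of n "r k"]] N[OF n, of "r k"] by (simp add: ennreal_leI)
      qed
      finally show ?thesis .
    qed
    then show ?thesis by blast
  qed
  \<comment> \<open>A single member at finite distance shows that the limit is square
    integrable.\<close>
  obtain N where N: "(\<integral>\<^sup>+x. ennreal ((U N x - u x)\<^sup>2) \<partial>lborel) \<le> ennreal 1" using close[of 1] by auto
  then have "integrable lborel (\<lambda>x. (U N x - u x)\<^sup>2)"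
    by (intro integrableI_bounded) (auto intro: order.strict_trans1)
  then have "(\<lambda>x. U N x - u x) \<in> L2_space \<Omega>" using zero u_zero by (simp add: L2_space_def)
  then have "U N - u \<in> L2_space \<Omega>" by (simp add: fun_diff_def)
  from L2.mem(2)[OF U[of N] this] have uL: "u \<in> L2_space \<Omega>" by simp
  have "(\<lambda>n. L2_inner \<Omega> (U n - u) (U n - u)) \<longlonglongrightarrow> 0"
  proof (rule LIMSEQ_I)
    fix e :: real assume e: "e > 0"
    obtain N where N: "\<And>n. n \<ge> N \<Longrightarrow> (\<integral>\<^sup>+x. ennreal ((U n x - u x)\<^sup>2) \<partial>lborel) \<le> ennreal (e / 2)"
      using close[of "e / 2"] e by auto
    have "norm (L2_inner \<Omega> (U n - u) (U n - u) - 0) < e" if "n \<ge> N" for n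
    proof -
      have d: "U n - u \<in> L2_space \<Omega>" using U uL by simp
      have "ennreal (L2_inner \<Omega> (U n - u) (U n - u)) \<le> ennreal (e / 2)"
        using N[OF that] L2_nn_integral[OF d] by simp
      then have "L2_inner \<Omega> (U n - u) (U n - u) \<le> e / 2" using e by (simp add: ennreal_le_iff)
      then show ?thesis using L2.nonneg[OF d] e by simp
    qed
    then show "\<exists>N. \<forall>n\<ge>N. norm (L2_inner \<Omega> (U n - u) (U n - u) - 0) < e" by blast
  qed
  with uL show ?thesis by blast
qed

text \<open>Energy Cauchy together with L2 null makes the sequence Cauchy for
  \<open>near_form\<close>. Fatou's lemma along a subsequence tending to 0 almost everywhere bounds
  \<open>near_form (U n) (U n)\<close> by the tail of the Cauchy estimate; the comparison bounds
  then squeeze the energy, whose sign is unknown, to 0.\<close>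

lemma test_closable:
  assumes \<mu>: "\<mu> > - 1" and U: "\<And>n. U n \<in> test_functions \<Omega>"
    and Cauchy: "form_Cauchy (test_energy \<mu> \<Omega>) U"
    and lim: "(\<lambda>n. L2_inner \<Omega> (U n) (U n)) \<longlonglongrightarrow> 0"
  shows "(\<lambda>n. test_energy \<mu> \<Omega> (U n) (U n)) \<longlonglongrightarrow> 0"
proof -
  interpret L2: semi_inner "L2_space \<Omega>" "L2_inner \<Omega>" by (rule semi_inner_L2)
  interpret T: sym_bilinear "test_functions \<Omega>" "test_energy \<mu> \<Omega>" by (rule sym_bilinear_test_energy)
  obtain \<kappa> C where \<kappa>: "\<kappa> > 0" "C \<ge> 0"
    "\<And>u. LS u \<Longrightarrow> \<kappa> * near_form u u \<le> test_energy \<mu> \<Omega> u u + C * mass_form u u"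
    "\<And>u. LS u \<Longrightarrow> test_energy \<mu> \<Omega> u u \<le> C * (near_form u u + mass_form u u)"
    using form_bounds[OF \<mu>] by metis
  have LS: "LS u" if "u \<in> test_functions \<Omega>" for u using that by (rule test_function_Lipschitz_supported)
  have diff: "LS (U m - U n)" for m n using U by (intro LS) simp
  have [measurable]: "U n \<in> borel_measurable borel" for n using LS[OF U[of n]] by measurable
  have mass: "L2_inner \<Omega> u u = mass_form u u" if "LS u" for u using that by (rule L2_inner_LS)
  have lim_mass: "(\<lambda>n. mass_form (U n) (U n)) \<longlonglongrightarrow> 0" using lim mass[OF LS[OF U]] by simp
  have "form_Cauchy (L2_inner \<Omega>) U"
    by (rule L2.convergent_Cauchy[of U 0]) (use lim L2.subspace in \<open>auto simp: LS_L2 LS U subspace_0\<close>)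
  then have "form_Cauchy (\<lambda>u v. test_energy \<mu> \<Omega> u v + C * L2_inner \<Omega> u v) U"
    using Cauchy diff by (intro form_Cauchy_add_scaled) (auto simp: mass mass_form_nonneg)
  then have near_Cauchy: "\<exists>N. \<forall>m\<ge>N. \<forall>n\<ge>N. near_form (U m - U n) (U m - U n) < e" if "e > 0" for e
  proof -
    assume "form_Cauchy (\<lambda>u v. test_energy \<mu> \<Omega> u v + C * L2_inner \<Omega> u v) U"
    moreover have "e * \<kappa> > 0" using that \<kappa> by simp
    ultimately obtain N where N: "\<And>m n. m \<ge> N \<Longrightarrow> n \<ge> N \<Longrightarrow>
        test_energy \<mu> \<Omega> (U m - U n) (U m - U n) + C * L2_inner \<Omega> (U m - U n) (U m - U n) < e * \<kappa>"
      unfolding form_Cauchy_def by blast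
    have "near_form (U m - U n) (U m - U n) < e" if "m \<ge> N" "n \<ge> N" for m n
    proof -
      have "\<kappa> * near_form (U m - U n) (U m - U n) < \<kappa> * e"
        using N[OF that] \<kappa>(3)[OF diff[of m n]] mass[OF diff[of m n]] by (simp add: mult.commute)
      then show ?thesis using \<kappa>(1) by simp
    qed
    then show ?thesis by blast
  qed
  have "\<exists>r. strict_mono r \<and> (AE x in lborel. (\<lambda>n. U (r n) x * U (r n) x) \<longlonglongrightarrow> 0)"
    using lim_mass integrable_mult_LS[OF LS LS, OF U U]
    by (intro tendsto_L1_AE_subseq) (simp_all add: mass_form_def)
  then obtain r where r: "strict_mono r" "AE x in lborel. (\<lambda>n. U (r n) x * U (r n) x) \<longlonglongrightarrow> 0" by blast
  have AE0: "AE x in lborel. (\<lambda>n. U (r n) x) \<longlonglongrightarrow> 0"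
    using r(2)
  proof eventually_elim
    case (elim x)
    from tendsto_real_sqrt[OF elim] show ?case by (simp add: tendsto_rabs_zero_iff)
  qed
  have "(\<lambda>n. near_form (U n) (U n)) \<longlonglongrightarrow> 0"
  proof (rule LIMSEQ_I)
    fix e :: real assume e: "e > 0"
    obtain N where N: "\<And>m n. m \<ge> N \<Longrightarrow> n \<ge> N \<Longrightarrow> near_form (U m - U n) (U m - U n) < e / 2"
      using near_Cauchy[of "e / 2"] e by auto
    have "norm (near_form (U n) (U n) - 0) < e" if n: "n \<ge> N" for n
    proof -
      let ?f = "\<lambda>k x y. ennreal (near_kernel (x - y) * ((U n x - U (r k) x) - (U n y - U (r k) y))\<^sup>2)"
      let ?g = "\<lambda>x y. ennreal (near_kernel (x - y) * (U n x - U n y)\<^sup>2)"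
      \<comment> \<open>Fatou's lemma in \<open>y\<close> for almost every fixed \<open>x\<close>; a
        second application in \<open>x\<close> follows.\<close>
      have inner: "AE x in lborel. (\<integral>\<^sup>+y. ?g x y \<partial>lborel) \<le> liminf (\<lambda>k. \<integral>\<^sup>+y. ?f k x y \<partial>lborel)"
        using AE0
      proof eventually_elim
        case (elim x)
        have "AE y in lborel. (\<lambda>k. ?f k x y) \<longlonglongrightarrow> ?g x y"
          using AE0
        proof eventually_elim
          case (elim y)
          have "(\<lambda>k. ?f k x y) \<longlonglongrightarrow> ennreal (near_kernel (x - y) * ((U n x - 0) - (U n y - 0))\<^sup>2)"
            using \<open>(\<lambda>n. U (r n) x) \<longlonglongrightarrow> 0\<close> elim by (intro tendsto_intros)
          then show ?case by simp
        qed
        then show ?case by (intro nn_integral_le_of_AE_limit) auto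
      qed
      have "ennreal (near_form (U n) (U n)) = (\<integral>\<^sup>+x. \<integral>\<^sup>+y. ?g x y \<partial>lborel \<partial>lborel)"
        by (rule near_form_nn_integral(1)[OF LS[OF U]])
      also have "\<dots> \<le> (\<integral>\<^sup>+x. liminf (\<lambda>k. \<integral>\<^sup>+y. ?f k x y \<partial>lborel) \<partial>lborel)"
        using inner by (rule nn_integral_mono_AE)
      also have "\<dots> \<le> liminf (\<lambda>k. \<integral>\<^sup>+x. \<integral>\<^sup>+y. ?f k x y \<partial>lborel \<partial>lborel)"
        by (rule nn_integral_liminf) measurable
      also have "\<dots> \<le> ennreal (e / 2)"
      proof (rule liminf_le_const, rule eventually_sequentiallyI)
        fix k assume "k \<ge> N"
        then have "r k \<ge> N" using seq_suble[OF r(1), of k] by simp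
        then have "ennreal (near_form (U n - U (r k)) (U n - U (r k))) \<le> ennreal (e / 2)"
          using N[OF n, of "r k"] by (intro ennreal_leI) simp
        then show "(\<integral>\<^sup>+x. \<integral>\<^sup>+y. ?f k x y \<partial>lborel \<partial>lborel) \<le> ennreal (e / 2)"
          using near_form_nn_integral(1)[OF diff[of n "r k"]] by (simp only: minus_apply)
      qed
      finally have "near_form (U n) (U n) \<le> e / 2" using e by (simp add: ennreal_le_iff)
      then show ?thesis using near_form_nonneg[OF LS[OF U[of n]]] e by simp
    qed
    then show "\<exists>N. \<forall>n\<ge>N. norm (near_form (U n) (U n) - 0) < e" by blast
  qed
  from tendsto_mult_left[OF tendsto_add[OF this lim_mass], of C]
  have up: "(\<lambda>n. C * (near_form (U n) (U n) + mass_form (U n) (U n))) \<longlonglongrightarrow> 0" by simp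
  have low: "(\<lambda>n. - (C * mass_form (U n) (U n))) \<longlonglongrightarrow> 0"
    using tendsto_minus[OF tendsto_mult_left[OF lim_mass, of C]] by simp
  have "- (C * mass_form (U n) (U n)) \<le> test_energy \<mu> \<Omega> (U n) (U n)" for n
    using \<kappa>(1) \<kappa>(3)[OF LS[OF U[of n]]] near_form_nonneg[OF LS[OF U[of n]]]
      mult_nonneg_nonneg[of \<kappa> "near_form (U n) (U n)"] by linarith
  then show ?thesis
    using \<kappa>(4)[OF LS[OF U]] by (intro tendsto_sandwich[OF _ _ low up]) auto
qed

end

section \<open>Eigenvalues on a bounded open set\<close>

lemma mass_form_bump_pos:
  assumes "r > 0"
  shows "mass_form (\<lambda>x. exp_flat 0 (r\<^sup>2 - (x - a) \<bullet> (x - a))) (\<lambda>x::real ^ 'n. exp_flat 0 (r\<^sup>2 - (x - a) \<bullet> (x - a))) > 0"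
proof -
  let ?t = "\<lambda>x::real ^ 'n. exp_flat 0 (r\<^sup>2 - (x - a) \<bullet> (x - a))"
  have t: "?t \<in> test_functions (ball a (r + 1))" using assms by (intro bump_test_function) auto
  interpret bounded_open "ball a (r + 1)" by unfold_locales auto
  have LS: "LS ?t" using t by (rule test_function_Lipschitz_supported)
  have "mass_form ?t ?t \<noteq> 0"
  proof
    assume "mass_form ?t ?t = 0"
    then have "AE x in lborel. ?t x * ?t x = 0"
      using integrable_mult_LS[OF LS LS] unfolding mass_form_def by (subst (asm) integral_nonneg_eq_0_iff_AE) auto
    then have "AE x in lborel. x \<notin> ball a r"
    proof eventually_elim
      case (elim x)
      have "dist a x < r \<Longrightarrow> (x - a) \<bullet> (x - a) < r\<^sup>2"
        using power_strict_mono[of "norm (x - a)" r 2] by (simp add: dot_square_norm dist_norm norm_minus_commute)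
      then show ?case using elim by (auto simp: exp_flat_def)
    qed
    then have "emeasure lborel (ball a r) = 0" by (subst (asm) AE_iff_measurable[OF _ refl]) (auto simp: ball_def)
    then show False
      using assms emeasure_ball[of r a] zero_less_power[OF assms, of "CARD('n)"]
      by (simp add: ennreal_eq_0_iff mult_le_0_iff not_le) (use unit_ball_vol_pos[of "real CARD('n)"] in linarith)
  qed
  then show ?thesis using mass_form_nonneg[of ?t] by simp
qed

lemma disjoint_bumps:
  fixes \<Omega> :: "(real ^ 'n) set"
  assumes "open \<Omega>" "\<Omega> \<noteq> {}"
  shows "\<exists>t. (\<forall>i\<le>n::nat. t i \<in> test_functions \<Omega> \<and> mass_form (t i) (t i) > 0) \<and>
    (\<forall>i\<le>n. \<forall>j\<le>n. i \<noteq> j \<longrightarrow> mass_form (t i) (t j) = 0)"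
proof -
  obtain p \<epsilon> where p: "\<epsilon> > 0" "ball p \<epsilon> \<subseteq> \<Omega>" using assms by (meson all_not_in_conv open_contains_ball)
  obtain e :: "real ^ 'n" where e: "norm e = 1" using vector_choose_size[of 1] by auto
  \<comment> \<open>The centres lie on a segment from \<open>p\<close> at spacing \<open>s\<close>,
    with total length below \<open>\<epsilon> / 2\<close>; radius \<open>s / 4\<close> keeps the
    supports disjoint and inside the ball.\<close>
  define s where "s = \<epsilon> / (2 * (real n + 1))"
  have s: "s > 0" using p by (simp add: s_def)
  define a where "a = (\<lambda>i::nat. p + (real i * s) *\<^sub>R e)"
  define t where "t = (\<lambda>i x. exp_flat 0 ((s / 4)\<^sup>2 - (x - a i) \<bullet> (x - a i)))"
  have dist_a: "dist (a i) (a j) = \<bar>real i - real j\<bar> * s" for i j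
  proof -
    have "a i - a j = ((real i - real j) * s) *\<^sub>R e" by (simp add: a_def algebra_simps)
    then show ?thesis using s e by (simp add: dist_norm abs_mult)
  qed
  have "t i \<in> test_functions \<Omega>" if "i \<le> n" for i
    unfolding t_def
  proof (rule bump_test_function)
    have "dist p (a i) = real i * s" using dist_a[of 0 i] s by (simp add: a_def)
    also have "\<dots> \<le> real n * s" using that s by (intro mult_right_mono) auto
    finally have "dist p (a i) + s / 4 < (real n + 1) * s" using s by (simp add: algebra_simps)
    also have "(real n + 1) * s = \<epsilon> / 2" by (simp add: s_def field_simps)
    finally have "cball (a i) (s / 4) \<subseteq> ball p \<epsilon>"
      using p(1) s by (auto simp: cball_subset_ball_iff dist_commute)
    then show "cball (a i) (s / 4) \<subseteq> \<Omega>" using p(2) by blast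
  qed (use s in simp)
  moreover have "mass_form (t i) (t i) > 0" for i
    unfolding t_def using s by (intro mass_form_bump_pos) simp
  moreover have "mass_form (t i) (t j) = 0" if "i \<noteq> j" for i j
  proof -
    have near: "dist (a i) x < s / 4" if "t i x \<noteq> 0" for i x
    proof -
      have "(norm (x - a i))\<^sup>2 < (s / 4)\<^sup>2"
        using that by (auto simp: t_def exp_flat_def dot_square_norm split: if_splits)
      then have "norm (x - a i) < s / 4" by (rule power2_less_imp_less) (use s in simp)
      then show ?thesis by (simp only: dist_norm norm_minus_commute)
    qed
    have "t i x * t j x = 0" for x
    proof (rule ccontr)
      assume "t i x * t j x \<noteq> 0"
      then have "t i x \<noteq> 0" "t j x \<noteq> 0" by auto
      then have "dist (a i) x < s / 4" "dist (a j) x < s / 4" by (blast intro: near)+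
      then have "dist (a i) (a j) < s" using dist_triangle2[of "a i" "a j" x] s by linarith
      moreover have "1 * s \<le> \<bar>real i - real j\<bar> * s" using that s by (intro mult_right_mono) auto
      ultimately show False by (simp add: dist_a)
    qed
    then show ?thesis unfolding mass_form_def by (simp only: integral_zero)
  qed
  ultimately show ?thesis by blast
qed

section \<open>The given definitions as an instance of the abstract theory\<close>

locale hardy_domain = bounded_open \<Omega> for \<Omega> :: "(real ^ 'n) set" +
  fixes \<mu> :: real
  assumes nonempty: "\<Omega> \<noteq> {}" and \<mu>: "\<mu> > - 1"
begin

lemma test_energy_lower:
  "\<exists>C. \<forall>u\<in>test_functions \<Omega>. L2_inner \<Omega> u u \<le> test_energy \<mu> \<Omega> u u + C * L2_inner \<Omega> u u"
proof -
  obtain \<kappa> C where \<kappa>: "\<kappa> > 0" "\<And>u. LS u \<Longrightarrow> \<kappa> * near_form u u \<le> test_energy \<mu> \<Omega> u u + C * mass_form u u"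
    using form_bounds[OF \<mu>] by metis
  have "mass_form u u \<le> test_energy \<mu> \<Omega> u u + (C + 1) * mass_form u u" if u: "LS u" for u
    using \<kappa>(2)[OF u] mult_nonneg_nonneg[OF less_imp_le[OF \<kappa>(1)] near_form_nonneg[OF u]] by (simp add: distrib_right)
  then have "L2_inner \<Omega> u u \<le> test_energy \<mu> \<Omega> u u + (C + 1) * L2_inner \<Omega> u u" if "u \<in> test_functions \<Omega>" for u
    unfolding L2_inner_LS[OF test_function_Lipschitz_supported[OF that]] using that test_function_Lipschitz_supported by blast
  then show ?thesis by blast
qed

text \<open>The bound provides its constant only existentially; the choice turns it into a term that
  can serve as a parameter of the abstract form.\<close>

definition lower_shift :: real where
  "lower_shift = (SOME C. \<forall>u\<in>test_functions \<Omega>. L2_inner \<Omega> u u \<le> test_energy \<mu> \<Omega> u u + C * L2_inner \<Omega> u u)"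

lemma test_energy_compact:
  fixes U :: "nat \<Rightarrow> real ^ 'n \<Rightarrow> real"
  assumes U: "\<And>n. U n \<in> test_functions \<Omega>" and I: "\<And>n. L2_inner \<Omega> (U n) (U n) \<le> M"
    and E: "\<And>n. test_energy \<mu> \<Omega> (U n) (U n) \<le> M"
  shows "\<exists>r. strict_mono r \<and> form_Cauchy (L2_inner \<Omega>) (U \<circ> r)"
proof -
  interpret T: sym_bilinear "test_functions \<Omega>" "test_energy \<mu> \<Omega>" by (rule sym_bilinear_test_energy)
  obtain \<kappa> C where \<kappa>: "\<kappa> > 0" "C \<ge> 0" "\<And>u. LS u \<Longrightarrow> \<kappa> * near_form u u \<le> test_energy \<mu> \<Omega> u u + C * mass_form u u"
    using form_bounds[OF \<mu>] by metis
  have LS: "LS (U n)" for n using U by (rule test_function_Lipschitz_supported)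
  have mass: "mass_form (U n) (U n) \<le> M" for n using I[of n] by (simp add: L2_inner_LS[OF LS])
  have near: "near_form (U n) (U n) \<le> (M + C * M) / \<kappa>" for n
  proof -
    have "\<kappa> * near_form (U n) (U n) \<le> M + C * M"
      using \<kappa>(3)[OF LS[of n]] E[of n] mult_left_mono[OF mass[of n] \<kappa>(2)] by linarith
    then show ?thesis using \<kappa>(1) by (simp add: field_simps)
  qed
  obtain r where r: "strict_mono r" "form_Cauchy mass_form (U \<circ> r)"
    using compact_embedding[of U "max M ((M + C * M) / \<kappa>)"] LS mass near by (auto simp: le_max_iff_disj)
  have "L2_inner \<Omega> (U m - U n) (U m - U n) = mass_form (U m - U n) (U m - U n)" for m n
    using U by (intro L2_inner_LS test_function_Lipschitz_supported) simp
  then have "form_Cauchy (L2_inner \<Omega>) (U \<circ> r)" using r(2) by (simp add: form_Cauchy_def)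
  with r(1) show ?thesis by blast
qed

sublocale closable_form "L2_space \<Omega>" "test_functions \<Omega>" "L2_inner \<Omega>" "test_energy \<mu> \<Omega>" lower_shift
proof -
  interpret L2: semi_inner "L2_space \<Omega>" "L2_inner \<Omega>" by (rule semi_inner_L2)
  interpret T: sym_bilinear "test_functions \<Omega>" "test_energy \<mu> \<Omega>" by (rule sym_bilinear_test_energy)
  show "closable_form (L2_space \<Omega>) (test_functions \<Omega>) (L2_inner \<Omega>) (test_energy \<mu> \<Omega>) lower_shift"
  proof
    show "test_functions \<Omega> \<subseteq> L2_space \<Omega>" using LS_L2 test_function_Lipschitz_supported by blast
    show "L2_inner \<Omega> u u \<le> test_energy \<mu> \<Omega> u u + lower_shift * L2_inner \<Omega> u u" if "u \<in> test_functions \<Omega>" for u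
      using someI_ex[OF test_energy_lower] that unfolding lower_shift_def by blast
    show "\<exists>t. (\<forall>i\<le>n::nat. t i \<in> test_functions \<Omega> \<and> 0 < L2_inner \<Omega> (t i) (t i)) \<and>
        (\<forall>i\<le>n. \<forall>j\<le>n. i \<noteq> j \<longrightarrow> L2_inner \<Omega> (t i) (t j) = 0)" for n
      using disjoint_bumps[OF open_\<Omega> nonempty, of n] L2_inner_LS test_function_Lipschitz_supported by metis
  qed (fact L2_complete test_energy_compact test_closable[OF \<mu>])+
qed

lemma L2_norm_on_eq: "L2_norm_on \<Omega> u = sqrt (L2_inner \<Omega> u u)"
  by (simp add: L2_norm_on_def L2_inner_def power2_eq_square)

text \<open>Along L2-Cauchy sequences each of the two conditions is equivalent to being Cauchy for
  \<open>near_form\<close>, by the two-sided bounds. Hence the completion may be described through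
  the energy itself.\<close>

lemma form_Cauchy_ln_mu_inner_iff:
  assumes U: "\<And>n. U n \<in> test_functions \<Omega>" and I: "form_Cauchy (L2_inner \<Omega>) U"
  shows "form_Cauchy (ln_mu_inner \<mu> \<Omega>) U \<longleftrightarrow> form_Cauchy (test_energy \<mu> \<Omega>) U"
proof -
  obtain \<kappa> C where \<kappa>: "\<kappa> > 0" "C \<ge> 0"
    "\<And>u. LS u \<Longrightarrow> \<kappa> * near_form u u \<le> test_energy \<mu> \<Omega> u u + C * mass_form u u"
    "\<And>u. LS u \<Longrightarrow> test_energy \<mu> \<Omega> u u \<le> C * (near_form u u + mass_form u u)"
    "\<And>u. LS u \<Longrightarrow> \<kappa> * near_form u u \<le> ln_mu_inner \<mu> \<Omega> u u + C * mass_form u u"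
    "\<And>u. LS u \<Longrightarrow> ln_mu_inner \<mu> \<Omega> u u \<le> C * (near_form u u + mass_form u u)"
    using form_bounds[OF \<mu>] by metis
  have LS: "LS (U m - U n)" for m n using U by (intro test_function_Lipschitz_supported) simp
  note mass = L2_inner_LS[OF LS]
  have to_near: "form_Cauchy near_form U" if G: "form_Cauchy G U"
    and le: "\<And>u. LS u \<Longrightarrow> \<kappa> * near_form u u \<le> G u u + C * mass_form u u" for G
  proof (rule form_Cauchy_dominated[where G = G and D = "L2_inner \<Omega>" and a = "1 / \<kappa>" and b = "C / \<kappa>"])
    show "near_form (U m - U n) (U m - U n) \<le> 1 / \<kappa> * G (U m - U n) (U m - U n) + C / \<kappa> * L2_inner \<Omega> (U m - U n) (U m - U n)" for m n
      using le[OF LS[of m n]] \<kappa>(1) by (simp add: mass field_simps)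
  qed (use G I \<kappa> in auto)
  have from_near: "form_Cauchy G U" if "form_Cauchy near_form U"
    and le: "\<And>u. LS u \<Longrightarrow> G u u \<le> C * (near_form u u + mass_form u u)" for G
  proof (rule form_Cauchy_dominated[where G = near_form and D = "L2_inner \<Omega>" and a = C and b = C])
    show "G (U m - U n) (U m - U n) \<le> C * near_form (U m - U n) (U m - U n) + C * L2_inner \<Omega> (U m - U n) (U m - U n)" for m n
      using le[OF LS[of m n]] by (simp add: mass distrib_left)
  qed (use that I \<kappa> in auto)
  show ?thesis
    using to_near[of "test_energy \<mu> \<Omega>", OF _ \<kappa>(3)] to_near[of "ln_mu_inner \<mu> \<Omega>", OF _ \<kappa>(5)]
      from_near[of "test_energy \<mu> \<Omega>", OF _ \<kappa>(4)] from_near[of "ln_mu_inner \<mu> \<Omega>", OF _ \<kappa>(6)] by blast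
qed

text \<open>For \<open>u\<close> in L2, L2 convergence of the sequence to \<open>u\<close> makes it
  L2-Cauchy, which is what the exchange of the two Cauchy conditions requires. The rest is passing
  between norms and their squares.\<close>

lemma approximates_iff:
  assumes u: "u \<in> L2_space \<Omega>"
  shows "approximates \<mu> \<Omega> U u \<longleftrightarrow> approx U u"
proof (cases "\<forall>n. U n \<in> test_functions \<Omega>")
  case T: True
  have d: "U n - u \<in> L2_space \<Omega>" for n using T u by simp
  have norm: "(\<forall>e>0. \<exists>M. \<forall>m\<ge>M. \<forall>n\<ge>M. ln_mu_norm \<mu> \<Omega> (\<lambda>x. U m x - U n x) < e) \<longleftrightarrow> form_Cauchy (ln_mu_inner \<mu> \<Omega>) U"
    (is "?l \<longleftrightarrow> ?r")
  proof
    assume l: ?l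
    show ?r
      unfolding form_Cauchy_def
    proof (intro allI impI)
      fix e :: real assume "e > 0"
      then obtain M where "\<forall>m\<ge>M. \<forall>n\<ge>M. ln_mu_norm \<mu> \<Omega> (\<lambda>x. U m x - U n x) < sqrt e"
        using l real_sqrt_gt_zero by blast
      then show "\<exists>M. \<forall>m\<ge>M. \<forall>n\<ge>M. ln_mu_inner \<mu> \<Omega> (U m - U n) (U m - U n) < e"
        by (auto simp: ln_mu_norm_def fun_diff_def)
    qed
  next
    assume r: ?r
    show ?l
    proof (intro allI impI)
      fix e :: real assume e: "e > 0"
      then obtain M where M: "\<forall>m\<ge>M. \<forall>n\<ge>M. ln_mu_inner \<mu> \<Omega> (U m - U n) (U m - U n) < e\<^sup>2"
        using r unfolding form_Cauchy_def by (meson zero_less_power)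
      have "sqrt x < e" if "x < e\<^sup>2" for x using real_sqrt_less_mono[OF that] e by simp
      then show "\<exists>M. \<forall>m\<ge>M. \<forall>n\<ge>M. ln_mu_norm \<mu> \<Omega> (\<lambda>x. U m x - U n x) < e"
        using M by (auto simp: ln_mu_norm_def fun_diff_def)
    qed
  qed
  have lim: "(\<lambda>n. L2_norm_on \<Omega> (\<lambda>x. U n x - u x)) \<longlonglongrightarrow> 0 \<longleftrightarrow> (\<lambda>n. L2_inner \<Omega> (U n - u) (U n - u)) \<longlonglongrightarrow> 0"
    using L2.tendsto_zero_iff[of "\<lambda>n. U n - u", OF d] by (simp add: L2_norm_on_eq L2.nrm_def fun_diff_def)
  have "form_Cauchy (L2_inner \<Omega>) U" if "(\<lambda>n. L2_inner \<Omega> (U n - u) (U n - u)) \<longlonglongrightarrow> 0"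
    using that T u by (intro L2.convergent_Cauchy) auto
  then show ?thesis
    using T form_Cauchy_ln_mu_inner_iff[of U] unfolding approximates_def approx_def norm lim by blast
qed (auto simp: approximates_def approx_def)

lemma energy_space_eq: "energy_space \<mu> \<Omega> = H"
  using approximates_iff by (auto simp: energy_space_def H_def simp del: H_L)

lemma dirichlet_energy_eq:
  "u \<in> L2_space \<Omega> \<Longrightarrow> v \<in> L2_space \<Omega> \<Longrightarrow> dirichlet_energy \<mu> \<Omega> u v = EE u v"
  by (simp add: dirichlet_energy_def EE_def approximates_iff)

lemma admissible_eq: "admissible \<mu> \<Omega> k \<phi> = adm k \<phi>"
proof -
  have "sqrt x = 1 \<longleftrightarrow> x = 1" for x :: real by simp
  then show ?thesis by (simp add: admissible_def adm_def energy_space_eq L2_norm_on_eq)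
qed

text \<open>The selection by \<open>ARG_MIN\<close> is meaningful only if a minimizer exists, which
  requires the previously selected functions to be in L2; hence the strong induction. Index 0, which
  carries no constraint, is covered as well.\<close>

lemma eigenfunction_minimizer:
  "eigenfunction \<mu> \<Omega> k \<in> adm k (eigenfunction \<mu> \<Omega>) \<and>
    (\<forall>v\<in>adm k (eigenfunction \<mu> \<Omega>). EE (eigenfunction \<mu> \<Omega> k) (eigenfunction \<mu> \<Omega> k) \<le> EE v v)"
proof (induction k rule: less_induct)
  case (less k)
  let ?\<phi> = "eigenfunction \<mu> \<Omega>"
  let ?e = "\<lambda>u. dirichlet_energy \<mu> \<Omega> u u"
  have e: "?e u = EE u u" if "u \<in> adm k ?\<phi>" for u using that by (intro dirichlet_energy_eq) (auto simp: adm_def)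
  have "\<forall>j\<in>{1..<k}. ?\<phi> j \<in> L2_space \<Omega>" using less by (auto simp: adm_def)
  then obtain u where u: "u \<in> adm k ?\<phi>" "\<forall>v\<in>adm k ?\<phi>. EE u u \<le> EE v v" using minimizer_exists by blast
  have "is_arg_min ?e (\<lambda>u. u \<in> adm k ?\<phi>) u" using u e by (auto simp: is_arg_min_def not_less)
  then have "is_arg_min ?e (\<lambda>u. u \<in> adm k ?\<phi>) (arg_min ?e (\<lambda>u. u \<in> adm k ?\<phi>))"
    unfolding arg_min_def by (rule someI[where P = "is_arg_min ?e (\<lambda>u. u \<in> adm k ?\<phi>)"])
  moreover have "?\<phi> k = arg_min ?e (\<lambda>u. u \<in> adm k ?\<phi>)"
    by (subst eigenfunction.simps) (simp add: admissible_eq)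
  ultimately have "is_arg_min ?e (\<lambda>u. u \<in> adm k ?\<phi>) (?\<phi> k)" by simp
  then show ?case using e by (auto simp: is_arg_min_def not_less)
qed

lemma eigenfunctions_successive_minimizers: "successive_minimizers k (eigenfunction \<mu> \<Omega>)"
  using eigenfunction_minimizer by (simp add: successive_minimizers_def)

lemma eigenvalue_eq: "eigenvalue \<mu> \<Omega> k = EE (eigenfunction \<mu> \<Omega> k) (eigenfunction \<mu> \<Omega> k)"
  unfolding eigenvalue_def admissible_eq
proof (rule Least_equality)
  have e: "dirichlet_energy \<mu> \<Omega> u u = EE u u" if "u \<in> adm k (eigenfunction \<mu> \<Omega>)" for u
    using that by (intro dirichlet_energy_eq) (auto simp: adm_def)
  show "EE (eigenfunction \<mu> \<Omega> k) (eigenfunction \<mu> \<Omega> k) \<in> (\<lambda>u. dirichlet_energy \<mu> \<Omega> u u) ` adm k (eigenfunction \<mu> \<Omega>)"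
    using eigenfunction_minimizer[of k] by (intro image_eqI[where x = "eigenfunction \<mu> \<Omega> k"]) (auto simp: e)
  fix c assume "c \<in> (\<lambda>u. dirichlet_energy \<mu> \<Omega> u u) ` adm k (eigenfunction \<mu> \<Omega>)"
  then obtain v where v: "v \<in> adm k (eigenfunction \<mu> \<Omega>)" "c = dirichlet_energy \<mu> \<Omega> v v" by blast
  then show "EE (eigenfunction \<mu> \<Omega> k) (eigenfunction \<mu> \<Omega> k) \<le> c"
    using eigenfunction_minimizer[of k] unfolding v(2) e[OF v(1)] by blast
qed

end

section \<open>Scaling\<close>

lemma integral_lborel_scale:
  fixes f :: "'a::euclidean_space \<Rightarrow> real"
  assumes [measurable]: "f \<in> borel_measurable borel" and l: "l > 0"
  shows "(LINT x|lborel. f x) = l ^ DIM('a) * (LINT x|lborel. f (l *\<^sub>R x))"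
proof -
  have "lborel = density (distr lborel borel (\<lambda>x::'a. l *\<^sub>R x)) (\<lambda>_. ennreal (l ^ DIM('a)))"
    using lborel_affine[of l "0::'a"] l by simp
  then have "(LINT x|lborel. f x) = (LINT x|density (distr lborel borel (\<lambda>x::'a. l *\<^sub>R x)) (\<lambda>_. ennreal (l ^ DIM('a))). f x)"
    by simp
  also have "\<dots> = l ^ DIM('a) * (LINT x|lborel. f (l *\<^sub>R x))"
    using l by (simp add: integral_density integral_distr)
  finally show ?thesis .
qed

lemma integrable_lborel_scale:
  fixes f :: "'a::euclidean_space \<Rightarrow> real"
  assumes f: "integrable lborel f" and l: "l > 0"
  shows "integrable lborel (\<lambda>x. f (l *\<^sub>R x))"
proof -
  have [measurable]: "f \<in> borel_measurable borel" using f by auto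
  have "lborel = density (distr lborel borel (\<lambda>x::'a. l *\<^sub>R x)) (\<lambda>_. ennreal (l ^ DIM('a)))"
    using lborel_affine[of l "0::'a"] l by simp
  then have "integrable (density (distr lborel borel (\<lambda>x::'a. l *\<^sub>R x)) (\<lambda>_. ennreal (l ^ DIM('a)))) f" using f by simp
  then have "integrable lborel (\<lambda>x. l ^ DIM('a) * f (l *\<^sub>R x))"
    using l by (simp add: integrable_density integrable_distr_eq)
  then show ?thesis using l by simp
qed

lemma integral_reflect:
  fixes f :: "'a::euclidean_space \<Rightarrow> real"
  assumes [measurable]: "f \<in> borel_measurable borel"
  shows "(LINT y|lborel. f (x - y)) = (LINT y|lborel. f y)"
  by (subst (2) distr_lborel_reflect[of x, symmetric], subst integral_distr) auto

lemma annulus_integral: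
  assumes "0 < a" "a \<le> b"
  shows "integrable lborel (\<lambda>y::'a::euclidean_space. indicator {a..<b} (norm y) / norm y ^ DIM('a))"
    and "(LINT y|lborel. indicator {a..<b} (norm (y::'a)) / norm y ^ DIM('a)) = sphere_area TYPE('a) * ln (b / a)"
proof -
  have "(\<integral>\<^sup>+(y::'a). ennreal (indicator {a..<b} (norm y) / norm y ^ DIM('a)) \<partial>lborel) =
      (\<integral>\<^sup>+(y::'a). ennreal (1 / norm y ^ DIM('a)) * indicator {a..<b} (norm y) \<partial>lborel)"
    by (intro nn_integral_cong) (simp add: indicator_def)
  then have nn: "(\<integral>\<^sup>+(y::'a). ennreal (indicator {a..<b} (norm y) / norm y ^ DIM('a)) \<partial>lborel) = ennreal (sphere_area TYPE('a) * ln (b / a))"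
    using nn_integral_annulus[OF assms, where 'a = 'a] by simp
  have pos: "sphere_area TYPE('a) * ln (b / a) \<ge> 0"
    using assms sphere_area_pos[where 'a = 'a] by (intro mult_nonneg_nonneg) auto
  show "integrable lborel (\<lambda>y::'a. indicator {a..<b} (norm y) / norm y ^ DIM('a))"
    using nn by (intro integrableI_bounded) auto
  show "(LINT y|lborel. indicator {a..<b} (norm (y::'a)) / norm y ^ DIM('a)) = sphere_area TYPE('a) * ln (b / a)"
    using nn pos by (intro integral_eq_nn_integral[THEN trans]) auto
qed

text \<open>Dilation moves the cut-off of the kernel from radius 1 to radius \<open>1 / l\<close>.
  By homogeneity the change is the kernel restricted to the shell between these radii, positive for
  \<open>l < 1\<close> and negative for \<open>l > 1\<close>; the far kernel changes by the opposite
  amount.\<close>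

definition shell_kernel :: "real \<Rightarrow> 'a::euclidean_space \<Rightarrow> real" where
  "shell_kernel l z = l ^ DIM('a) * near_kernel (l *\<^sub>R z) - near_kernel z"

lemma near_kernel_scale: "l ^ DIM('a) * near_kernel (l *\<^sub>R z) = near_kernel z + shell_kernel l (z :: 'a::euclidean_space)"
  by (simp add: shell_kernel_def)

lemma far_kernel_scale:
  assumes "l > 0"
  shows "l ^ DIM('a) * far_kernel (l *\<^sub>R z) = far_kernel z - shell_kernel l (z :: 'a::euclidean_space)"
  using assms by (auto simp: shell_kernel_def near_kernel_def far_kernel_def indicator_def power_mult_distrib)

lemma shell_kernel_integral:
  assumes l: "l > 0"
  shows "integrable lborel (shell_kernel l :: 'a::euclidean_space \<Rightarrow> real)"
    and "(LINT z|lborel. shell_kernel l (z::'a)) = - sphere_area TYPE('a) * ln l"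
proof -
  have "integrable lborel (shell_kernel l :: 'a \<Rightarrow> real) \<and> (LINT z|lborel. shell_kernel l (z::'a)) = - sphere_area TYPE('a) * ln l"
  proof (cases "l \<le> 1")
    case True
    have eq: "shell_kernel l = (\<lambda>z::'a. indicator {1..<1 / l} (norm z) / norm z ^ DIM('a))"
    proof
      fix z :: 'a
      show "shell_kernel l z = indicator {1..<1 / l} (norm z) / norm z ^ DIM('a)"
        using l True mult_left_le_one_le[of "norm z" l]
        by (auto simp: shell_kernel_def near_kernel_def indicator_def power_mult_distrib field_simps)
    qed
    show ?thesis
      unfolding eq using annulus_integral[of 1 "1 / l", where 'a = 'a] l True by (simp add: ln_div field_simps)
  next
    case False
    have eq: "shell_kernel l = (\<lambda>z::'a. - (indicator {1 / l..<1} (norm z) / norm z ^ DIM('a)))"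
    proof
      fix z :: 'a
      have "norm z \<le> l * norm z" using False mult_right_mono[of 1 l "norm z"] by simp
      then show "shell_kernel l z = - (indicator {1 / l..<1} (norm z) / norm z ^ DIM('a))"
        using l False by (auto simp: shell_kernel_def near_kernel_def indicator_def power_mult_distrib field_simps)
    qed
    show ?thesis
      unfolding eq using annulus_integral[of "1 / l" 1, where 'a = 'a] l False by (simp add: field_simps)
  qed
  then show "integrable lborel (shell_kernel l :: 'a \<Rightarrow> real)"
    "(LINT z|lborel. shell_kernel l (z::'a)) = - sphere_area TYPE('a) * ln l" by auto
qed

lemma shell_kernel_measurable [measurable]: "shell_kernel l \<in> borel_measurable borel"
  unfolding shell_kernel_def[abs_def] by measurable

section \<open>The operator, the energy and L2 under dilations\<close>

context bounded_open
begin

lemma far_integrable_inner: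
  assumes v: "LS v" shows "integrable lborel (\<lambda>y. far_kernel (x - y) * v y)"
proof (rule Bochner_Integration.integrable_bound[OF LS_integrable[OF v]])
  have [measurable]: "v \<in> borel_measurable borel" using v by measurable
  show "(\<lambda>y. far_kernel (x - y) * v y) \<in> borel_measurable lborel" by measurable
  show "AE y in lborel. norm (far_kernel (x - y) * v y) \<le> norm (v y)"
    using far_kernel_bounds[of "x - _"] by (intro AE_I2) (auto simp: abs_mult intro: mult_left_le_one_le)
qed

lemma shell_integrable_inner:
  assumes l: "l > 0" and v: "LS v"
  shows "integrable lborel (\<lambda>y. shell_kernel l (x - y) * v y)"
proof -
  obtain B K where B: "B \<ge> 0" "\<And>x. \<bar>v x\<bar> \<le> B * indicator \<Omega> x" using LS_bounds[OF v] by metis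
  have [measurable]: "v \<in> borel_measurable borel" using v by measurable
  have "integrable lborel (\<lambda>y. B * shell_kernel l (x - y))"
    using integrable_reflect[OF shell_kernel_integral(1)[OF l], of x] by simp
  then show ?thesis
  proof (rule Bochner_Integration.integrable_bound)
    have "\<bar>v y\<bar> \<le> B" for y using B(2)[of y] B(1) by (cases "y \<in> \<Omega>") auto
    then show "AE y in lborel. norm (shell_kernel l (x - y) * v y) \<le> norm (B * shell_kernel l (x - y))"
      using B(1) by (intro AE_I2) (simp add: abs_mult mult.commute mult_right_mono)
  qed measurable
qed

text \<open>What the near part gains on the shell the far part loses, so the shell integrals of
  \<open>v y\<close> cancel. There remains \<open>v x\<close> times the integral of the shell
  kernel, which is the logarithm.\<close>

lemma log_laplacian_scale:
  fixes l :: real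
  assumes l: "l > 0" and v: "LS v"
    and v': "bounded_open ((*\<^sub>R) l ` \<Omega>)" "Lipschitz_supported ((*\<^sub>R) l ` \<Omega>) (\<lambda>x. v ((1 / l) *\<^sub>R x))"
  shows "log_laplacian (\<lambda>x. v ((1 / l) *\<^sub>R x)) (l *\<^sub>R x) = log_laplacian v x - 2 * ln l * v x"
proof -
  interpret scaled: bounded_open "(*\<^sub>R) l ` \<Omega>" by (rule v'(1))
  let ?v = "\<lambda>x. v ((1 / l) *\<^sub>R x)"
  have [measurable]: "v \<in> borel_measurable borel" using v by measurable
  have near: "(LINT y|lborel. near_kernel (l *\<^sub>R x - y) * (?v (l *\<^sub>R x) - ?v y)) =
      (LINT y|lborel. near_kernel (x - y) * (v x - v y)) + (LINT y|lborel. shell_kernel l (x - y) * v x) - (LINT y|lborel. shell_kernel l (x - y) * v y)"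
  proof -
    have "(LINT y|lborel. near_kernel (l *\<^sub>R x - y) * (?v (l *\<^sub>R x) - ?v y)) =
        l ^ CARD('n) * (LINT y|lborel. near_kernel (l *\<^sub>R x - l *\<^sub>R y) * (?v (l *\<^sub>R x) - ?v (l *\<^sub>R y)))"
      using l by (subst integral_lborel_scale[of _ l]) auto
    also have "\<dots> = (LINT y|lborel. l ^ CARD('n) * (near_kernel (l *\<^sub>R (x - y)) * (v x - v y)))"
      using l by (simp add: scaleR_right_diff_distrib)
    also have "\<dots> = (LINT y|lborel. near_kernel (x - y) * (v x - v y) + shell_kernel l (x - y) * v x - shell_kernel l (x - y) * v y)"
    proof (intro Bochner_Integration.integral_cong refl)
      fix y
      have "l ^ CARD('n) * near_kernel (l *\<^sub>R (x - y)) = near_kernel (x - y) + shell_kernel l (x - y)"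
        using near_kernel_scale[of l "x - y"] by simp
      then have "(l ^ CARD('n) * near_kernel (l *\<^sub>R (x - y))) * (v x - v y) = (near_kernel (x - y) + shell_kernel l (x - y)) * (v x - v y)" by simp
      then show "l ^ CARD('n) * (near_kernel (l *\<^sub>R (x - y)) * (v x - v y)) = near_kernel (x - y) * (v x - v y) + shell_kernel l (x - y) * v x - shell_kernel l (x - y) * v y"
        by (simp add: algebra_simps)
    qed
    also have "\<dots> = (LINT y|lborel. near_kernel (x - y) * (v x - v y)) + (LINT y|lborel. shell_kernel l (x - y) * v x) - (LINT y|lborel. shell_kernel l (x - y) * v y)"
      using near_integrable_inner[OF v, of x] shell_integrable_inner[OF l v, of x] integrable_reflect[OF shell_kernel_integral(1)[OF l], of x]
      by (subst Bochner_Integration.integral_diff Bochner_Integration.integral_add, simp_all)+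
    finally show ?thesis .
  qed
  have far: "(LINT y|lborel. far_kernel (l *\<^sub>R x - y) * ?v y) =
      (LINT y|lborel. far_kernel (x - y) * v y) - (LINT y|lborel. shell_kernel l (x - y) * v y)"
  proof -
    have "(LINT y|lborel. far_kernel (l *\<^sub>R x - y) * ?v y) =
        l ^ CARD('n) * (LINT y|lborel. far_kernel (l *\<^sub>R x - l *\<^sub>R y) * ?v (l *\<^sub>R y))"
      using l by (subst integral_lborel_scale[of _ l]) auto
    also have "\<dots> = (LINT y|lborel. l ^ CARD('n) * (far_kernel (l *\<^sub>R (x - y)) * v y))"
      using l by (simp add: scaleR_right_diff_distrib)
    also have "\<dots> = (LINT y|lborel. far_kernel (x - y) * v y - shell_kernel l (x - y) * v y)"
    proof (intro Bochner_Integration.integral_cong refl)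
      fix y
      have "l ^ CARD('n) * far_kernel (l *\<^sub>R (x - y)) = far_kernel (x - y) - shell_kernel l (x - y)"
        using far_kernel_scale[OF l, of "x - y"] by simp
      then have "(l ^ CARD('n) * far_kernel (l *\<^sub>R (x - y))) * v y = (far_kernel (x - y) - shell_kernel l (x - y)) * v y" by simp
      then show "l ^ CARD('n) * (far_kernel (l *\<^sub>R (x - y)) * v y) = far_kernel (x - y) * v y - shell_kernel l (x - y) * v y"
        by (simp add: algebra_simps)
    qed
    also have "\<dots> = (LINT y|lborel. far_kernel (x - y) * v y) - (LINT y|lborel. shell_kernel l (x - y) * v y)"
      using far_integrable_inner[OF v] shell_integrable_inner[OF l v] by (rule Bochner_Integration.integral_diff)
    finally show ?thesis .
  qed
  have "(LINT y|lborel. shell_kernel l (x - y) * v x) = - sphere_area TYPE(real ^ 'n) * ln l * v x"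
    using integral_reflect[of "shell_kernel l" x] shell_kernel_integral(2)[OF l, where 'a = "real ^ 'n"] by simp
  \<comment> \<open>The normalization \<open>c_const_sphere_area\<close> turns the area of the
    sphere into the exact factor 2.\<close>
  then have shell: "c_const CARD('n) * (LINT y|lborel. shell_kernel l (x - y) * v x) = - 2 * ln l * v x"
    using c_const_sphere_area[where 'n = 'n] by (simp add: mult.assoc[symmetric])
  show ?thesis
    unfolding scaled.log_laplacian_LS[OF v'(2)] log_laplacian_LS[OF v] near far
    using shell l by (simp add: algebra_simps)
qed

lemma integrable_LS_log_laplacian:
  assumes u: "LS u" and v: "LS v"
  shows "integrable lborel (\<lambda>x. u x * log_laplacian v x)"
proof -
  have "(\<lambda>x. u x * log_laplacian v x) = (\<lambda>x. c_const CARD('n) * (u x * (LINT y|lborel. near_kernel (x - y) * (v x - v y)))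
      - c_const CARD('n) * (u x * (LINT y|lborel. far_kernel (x - y) * v y)) + rho_const CARD('n) * (u x * v x))"
    by (simp add: fun_eq_iff log_laplacian_LS[OF v] algebra_simps)
  then show ?thesis
    using near_half_integrable_outer[OF u v] far_form_iterated(1)[OF u v] integrable_mult_LS[OF u v]
    by (simp only: Bochner_Integration.integrable_add Bochner_Integration.integrable_diff integrable_mult_right)
qed

lemma set_integral_image_scale:
  fixes f :: "real ^ 'n \<Rightarrow> real" and l :: real
  assumes l: "l > 0" and meas: "f \<in> borel_measurable borel" and zero: "\<And>x. x \<notin> \<Omega> \<Longrightarrow> f (l *\<^sub>R x) = 0"
  shows "(LINT x:(*\<^sub>R) l ` \<Omega>|lborel. f x) = l ^ CARD('n) * (LINT x|lborel. f (l *\<^sub>R x))"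
proof -
  have "indicator ((*\<^sub>R) l ` \<Omega>) x *\<^sub>R f x = f x" for x
  proof (cases "x \<in> (*\<^sub>R) l ` \<Omega>")
    case False
    then have "(1 / l) *\<^sub>R x \<notin> \<Omega>" using l by (auto simp: image_iff)
    then show ?thesis using zero[of "(1 / l) *\<^sub>R x"] l by simp
  qed simp
  then have "(LINT x:(*\<^sub>R) l ` \<Omega>|lborel. f x) = (LINT x|lborel. f x)" unfolding set_lebesgue_integral_def by (simp only:)
  also have "\<dots> = l ^ CARD('n) * (LINT x|lborel. f (l *\<^sub>R x))" using integral_lborel_scale[OF meas l] by simp
  finally show ?thesis .
qed

lemma bounded_open_scale: "l > 0 \<Longrightarrow> bounded_open ((*\<^sub>R) l ` \<Omega>)"
  using bounded open_\<Omega> by unfold_locales (auto intro: bounded_scaling open_scaling)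

text \<open>The operator contributes the shift \<open>2 * ln l\<close> and the potential
  \<open>2 * \<mu> * ln l\<close>, both times the mass, whence the factor \<open>1 + \<mu>\<close>.
  The Jacobian stays in front and is normalized away later.\<close>

lemma test_energy_scale:
  fixes l :: real
  assumes l: "l > 0" and u: "u \<in> test_functions \<Omega>" and v: "v \<in> test_functions \<Omega>"
  shows "test_energy \<mu> ((*\<^sub>R) l ` \<Omega>) (\<lambda>x. u ((1 / l) *\<^sub>R x)) (\<lambda>x. v ((1 / l) *\<^sub>R x)) =
    l ^ CARD('n) * (test_energy \<mu> \<Omega> u v - 2 * (1 + \<mu>) * ln l * L2_inner \<Omega> u v)"
proof -
  interpret scaled: bounded_open "(*\<^sub>R) l ` \<Omega>" by (rule bounded_open_scale[OF l])
  let ?u = "\<lambda>x. u ((1 / l) *\<^sub>R x)" and ?v = "\<lambda>x. v ((1 / l) *\<^sub>R x)"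
  have LS: "LS u" "LS v" using u v by (auto intro: test_function_Lipschitz_supported)
  have LS': "scaled.LS ?u" "scaled.LS ?v"
    using test_functions_scale[OF u l] test_functions_scale[OF v l] by (auto intro: test_function_Lipschitz_supported)
  have "(LINT x:(*\<^sub>R) l ` \<Omega>|lborel. ?u x * log_laplacian ?v x) = l ^ CARD('n) * (LINT x|lborel. ?u (l *\<^sub>R x) * log_laplacian ?v (l *\<^sub>R x))"
    using l scaled.integrable_LS_log_laplacian[OF LS'] LS_zero[OF LS(1)] by (intro set_integral_image_scale) auto
  also have "(LINT x|lborel. ?u (l *\<^sub>R x) * log_laplacian ?v (l *\<^sub>R x)) = (LINT x|lborel. u x * log_laplacian v x - 2 * ln l * (u x * v x))"
  proof (intro Bochner_Integration.integral_cong refl)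
    show "?u (l *\<^sub>R x) * log_laplacian ?v (l *\<^sub>R x) = u x * log_laplacian v x - 2 * ln l * (u x * v x)" for x
      unfolding log_laplacian_scale[OF l LS(2) scaled.bounded_open_axioms LS'(2)] using l by (simp add: algebra_simps)
  qed
  also have "\<dots> = (LINT x|lborel. u x * log_laplacian v x) - 2 * ln l * L2_inner \<Omega> u v"
    using integrable_LS_log_laplacian[OF LS] integrable_mult_LS[OF LS]
    by (simp add: L2_inner_LS[OF LS(1)] mass_form_def)
  also have "(LINT x|lborel. u x * log_laplacian v x) = (LINT x:\<Omega>|lborel. u x * log_laplacian v x)"
    by (rule set_integral_supported[symmetric]) (simp add: LS_zero[OF LS(1)])
  finally have 1: "(LINT x:(*\<^sub>R) l ` \<Omega>|lborel. ?u x * log_laplacian ?v x) =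
      l ^ CARD('n) * ((LINT x:\<Omega>|lborel. u x * log_laplacian v x) - 2 * ln l * L2_inner \<Omega> u v)" .
  have "(LINT x:(*\<^sub>R) l ` \<Omega>|lborel. ln (1 / norm x) * ?u x * ?v x) = l ^ CARD('n) * (LINT x|lborel. ln (1 / norm (l *\<^sub>R x)) * ?u (l *\<^sub>R x) * ?v (l *\<^sub>R x))"
    using l scaled.log_integrable(1)[OF LS'] LS_zero[OF LS(1)] by (intro set_integral_image_scale) auto
  also have "(LINT x|lborel. ln (1 / norm (l *\<^sub>R x)) * ?u (l *\<^sub>R x) * ?v (l *\<^sub>R x)) =
      (LINT x|lborel. ln (1 / norm x) * u x * v x - ln l * (u x * v x))"
  proof (rule integral_cong_AE)
    have [measurable]: "u \<in> borel_measurable borel" "v \<in> borel_measurable borel" using LS by measurable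
    show "(\<lambda>x. ln (1 / norm (l *\<^sub>R x)) * ?u (l *\<^sub>R x) * ?v (l *\<^sub>R x)) \<in> borel_measurable lborel" by measurable
    show "(\<lambda>x. ln (1 / norm x) * u x * v x - ln l * (u x * v x)) \<in> borel_measurable lborel" by measurable
    show "AE x in lborel. ln (1 / norm (l *\<^sub>R x)) * ?u (l *\<^sub>R x) * ?v (l *\<^sub>R x) = ln (1 / norm x) * u x * v x - ln l * (u x * v x)"
      \<comment> \<open>The rule for the logarithm of a product requires
        \<open>x \<noteq> 0\<close>; one point is a null set.\<close>
      using AE_lborel_singleton[of "0 :: real ^ 'n"]
    proof eventually_elim
      case (elim x)
      then have eq: "ln (1 / norm (l *\<^sub>R x)) = ln (1 / norm x) - ln l" using l by (simp add: ln_div ln_mult)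
      show ?case unfolding eq using l by (simp add: algebra_simps)
    qed
  qed
  also have "\<dots> = (LINT x|lborel. ln (1 / norm x) * u x * v x) - ln l * L2_inner \<Omega> u v"
    using log_integrable(1)[OF LS] integrable_mult_LS[OF LS] by (simp add: L2_inner_LS[OF LS(1)] mass_form_def)
  also have "(LINT x|lborel. ln (1 / norm x) * u x * v x) = (LINT x:\<Omega>|lborel. ln (1 / norm x) * u x * v x)"
    by (rule set_integral_supported[symmetric]) (simp add: LS_zero[OF LS(1)])
  finally have 2: "(LINT x:(*\<^sub>R) l ` \<Omega>|lborel. ln (1 / norm x) * ?u x * ?v x) =
      l ^ CARD('n) * ((LINT x:\<Omega>|lborel. ln (1 / norm x) * u x * v x) - ln l * L2_inner \<Omega> u v)" .
  show ?thesis unfolding test_energy_def 1 2 by (simp add: algebra_simps)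
qed

lemma L2_space_scale:
  assumes l: "l > 0" and u: "u \<in> L2_space \<Omega>"
  shows "(\<lambda>x. u ((1 / l) *\<^sub>R x)) \<in> L2_space ((*\<^sub>R) l ` \<Omega>)"
proof -
  have [measurable]: "u \<in> borel_measurable borel" using u by (simp add: L2_space_iff)
  have "(\<lambda>x. u ((1 / l) *\<^sub>R x)) \<in> borel_measurable borel" by measurable
  moreover have "u ((1 / l) *\<^sub>R x) = 0" if "x \<notin> (*\<^sub>R) l ` \<Omega>" for x
  proof -
    have "(1 / l) *\<^sub>R x \<notin> \<Omega>" using that l by (auto simp: image_iff)
    then show ?thesis using u by (simp add: L2_space_iff)
  qed
  moreover have "integrable lborel (\<lambda>x. (u ((1 / l) *\<^sub>R x))\<^sup>2)"
    using u l by (intro integrable_lborel_scale) (auto simp: L2_space_def)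
  ultimately show ?thesis by (simp add: L2_space_def)
qed

lemma L2_inner_scale:
  assumes l: "l > 0" and u: "u \<in> L2_space \<Omega>" and v: "v \<in> L2_space \<Omega>"
  shows "L2_inner ((*\<^sub>R) l ` \<Omega>) (\<lambda>x. u ((1 / l) *\<^sub>R x)) (\<lambda>x. v ((1 / l) *\<^sub>R x)) = l ^ CARD('n) * L2_inner \<Omega> u v"
proof -
  have [measurable]: "u \<in> borel_measurable borel" "v \<in> borel_measurable borel" using u v by (auto simp: L2_space_iff)
  have "L2_inner ((*\<^sub>R) l ` \<Omega>) (\<lambda>x. u ((1 / l) *\<^sub>R x)) (\<lambda>x. v ((1 / l) *\<^sub>R x)) =
      l ^ CARD('n) * (LINT x|lborel. u ((1 / l) *\<^sub>R l *\<^sub>R x) * v ((1 / l) *\<^sub>R l *\<^sub>R x))"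
    unfolding L2_inner_def using l u by (intro set_integral_image_scale) (auto simp: L2_space_iff)
  then show ?thesis using l by (simp add: L2_inner_eq[OF u] mass_form_def)
qed

end

context hardy_domain
begin

lemma hardy_domain_scale: "l > 0 \<Longrightarrow> hardy_domain ((*\<^sub>R) l ` \<Omega>) \<mu>"
  using bounded_open_scale nonempty \<mu> by (auto simp: hardy_domain_def hardy_domain_axioms_def)

text \<open>The normalized dilation is an isomorphism between the two form structures with constant
  shift, so the minima move by that constant, independently of how the eigenfunctions were selected
  on either domain.\<close>

lemma eigenvalue_scale:
  fixes l :: real
  assumes l: "l > 0" and k: "k \<ge> 1"
  shows "eigenvalue \<mu> ((*\<^sub>R) l ` \<Omega>) k = eigenvalue \<mu> \<Omega> k - 2 * (1 + \<mu>) * ln l"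
proof -
  interpret scaled: hardy_domain "(*\<^sub>R) l ` \<Omega>" \<mu> by (rule hardy_domain_scale[OF l])
  \<comment> \<open>Square root of the inverse Jacobian, which makes the dilation an L2
    isometry.\<close>
  define c where "c = 1 / sqrt (l ^ CARD('n))"
  have c: "c > 0" and c2: "c * c * l ^ CARD('n) = 1" using l by (auto simp: c_def field_simps)
  define \<Phi> where "\<Phi> = (\<lambda>u :: real ^ 'n \<Rightarrow> real. c *\<^sub>R (\<lambda>x. u ((1 / l) *\<^sub>R x)))"
  \<comment> \<open>The inverse dilation, written with \<open>1 / (1 / l)\<close> so that the
    scaling lemmas apply with \<open>1 / l\<close> in place of \<open>l\<close>.\<close>
  define \<Psi> where "\<Psi> = (\<lambda>w :: real ^ 'n \<Rightarrow> real. (1 / c) *\<^sub>R (\<lambda>x. w ((1 / (1 / l)) *\<^sub>R x)))"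
  have inv: "(*\<^sub>R) (1 / l) ` (*\<^sub>R) l ` \<Omega> = \<Omega>" using l by (simp add: image_image)
  have l': "1 / l > 0" using l by simp
  interpret shifted_forms "L2_space \<Omega>" "test_functions \<Omega>" "L2_inner \<Omega>" "test_energy \<mu> \<Omega>" lower_shift
    "L2_space ((*\<^sub>R) l ` \<Omega>)" "test_functions ((*\<^sub>R) l ` \<Omega>)" "L2_inner ((*\<^sub>R) l ` \<Omega>)" "test_energy \<mu> ((*\<^sub>R) l ` \<Omega>)" scaled.lower_shift
    \<Phi> \<Psi> "2 * (1 + \<mu>) * ln l"
  proof
    fix u v :: "real ^ 'n \<Rightarrow> real"
    show "\<Phi> (u - v) = \<Phi> u - \<Phi> v" "\<Psi> (u - v) = \<Psi> u - \<Psi> v"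
      by (simp_all add: \<Phi>_def \<Psi>_def scaleR_fun_def fun_eq_iff right_diff_distrib diff_divide_distrib)
    show "\<Psi> (\<Phi> u) = u" "\<Phi> (\<Psi> u) = u"
      using c l by (simp_all add: \<Phi>_def \<Psi>_def scaleR_fun_def fun_eq_iff)
    show "\<Phi> u \<in> L2_space ((*\<^sub>R) l ` \<Omega>)" if "u \<in> L2_space \<Omega>"
      unfolding \<Phi>_def using L2_space_scale[OF l that] by (rule scaled.L2.mem(3))
    show "\<Psi> u \<in> L2_space \<Omega>" if "u \<in> L2_space ((*\<^sub>R) l ` \<Omega>)"
      unfolding \<Psi>_def using scaled.L2_space_scale[OF l' that] inv by (intro L2.mem(3)) simp
    show "\<Phi> u \<in> test_functions ((*\<^sub>R) l ` \<Omega>)" if "u \<in> test_functions \<Omega>"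
      unfolding \<Phi>_def using test_functions_scale[OF that l] by (rule scaled.test.mem(3))
    show "\<Psi> u \<in> test_functions \<Omega>" if "u \<in> test_functions ((*\<^sub>R) l ` \<Omega>)"
      unfolding \<Psi>_def using test_functions_scale[OF that l'] inv by (intro test.mem(3)) simp
    show I: "L2_inner ((*\<^sub>R) l ` \<Omega>) (\<Phi> u) (\<Phi> v) = L2_inner \<Omega> u v" if "u \<in> L2_space \<Omega>" "v \<in> L2_space \<Omega>"
    proof -
      have "L2_inner ((*\<^sub>R) l ` \<Omega>) (\<Phi> u) (\<Phi> v) = c * c * l ^ CARD('n) * L2_inner \<Omega> u v"
        unfolding \<Phi>_def using L2_space_scale[OF l] that
        by (simp add: scaled.L2.scale scaled.L2.scale_right L2_inner_scale[OF l that])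
      then show ?thesis by (simp add: c2)
    qed
    show "test_energy \<mu> ((*\<^sub>R) l ` \<Omega>) (\<Phi> u) (\<Phi> v) = test_energy \<mu> \<Omega> u v - 2 * (1 + \<mu>) * ln l * L2_inner \<Omega> u v"
      if "u \<in> test_functions \<Omega>" "v \<in> test_functions \<Omega>"
    proof -
      have "test_energy \<mu> ((*\<^sub>R) l ` \<Omega>) (\<Phi> u) (\<Phi> v) = c * c * l ^ CARD('n) * (test_energy \<mu> \<Omega> u v - 2 * (1 + \<mu>) * ln l * L2_inner \<Omega> u v)"
        unfolding \<Phi>_def using test_functions_scale[OF that(1) l] test_functions_scale[OF that(2) l]
        by (simp add: scaled.test.scale scaled.test.scale_right test_energy_scale[OF l that])
      then show ?thesis by (simp add: c2)
    qed
  qed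
  show ?thesis
    using successive_minima_shift[OF eigenfunctions_successive_minimizers scaled.eigenfunctions_successive_minimizers k]
    by (simp add: eigenvalue_eq scaled.eigenvalue_eq)
qed

end

theorem corollary4p3:
  fixes \<Omega> :: "(real ^ 'n) set" and \<mu> :: real
  assumes "bounded \<Omega>" and "lipschitz_domain \<Omega>" and "0 \<in> \<Omega>" and "\<mu> > -1"
  shows "(\<exists>l_c. l_c = exp (eigenvalue \<mu> \<Omega> 1 / (2 * (1 + \<mu>))) \<and> l_c > 0 \<and>
            (\<forall>l. 0 < l \<and> l < l_c \<longrightarrow> eigenvalue \<mu> ((*\<^sub>R) l ` \<Omega>) 1 > 0) \<and>
            eigenvalue \<mu> ((*\<^sub>R) l_c ` \<Omega>) 1 = 0 \<and>
            (\<forall>l. l > l_c \<longrightarrow> eigenvalue \<mu> ((*\<^sub>R) l ` \<Omega>) 1 < 0)) \<and>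
         (\<forall>k \<ge> 1. \<forall>l > 0.
            eigenvalue \<mu> ((*\<^sub>R) l ` \<Omega>) (k + 1) - eigenvalue \<mu> ((*\<^sub>R) l ` \<Omega>) k =
            eigenvalue \<mu> \<Omega> (k + 1) - eigenvalue \<mu> \<Omega> k)"
proof -
  interpret hardy_domain \<Omega> \<mu>
    using assms by unfold_locales (auto simp: lipschitz_domain_def)
  define a where "a = eigenvalue \<mu> \<Omega> 1 / (2 * (1 + \<mu>))"
  have pos: "2 * (1 + \<mu>) > 0" using assms(4) by simp
  \<comment> \<open>With the critical value written as \<open>exp a\<close>, the sign of the first
    eigenvalue is that of \<open>a - ln l\<close>, because \<open>1 + \<mu>\<close> is
    positive.\<close>
  have first: "eigenvalue \<mu> ((*\<^sub>R) l ` \<Omega>) 1 = 2 * (1 + \<mu>) * (a - ln l)" if "l > 0" for l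
    using eigenvalue_scale[OF that, of 1] pos by (simp add: a_def right_diff_distrib)
  have "eigenvalue \<mu> ((*\<^sub>R) l ` \<Omega>) 1 > 0" if "0 < l" "l < exp a" for l
    using first[OF that(1)] pos ln_less_cancel_iff[of l "exp a"] that by simp
  moreover have "eigenvalue \<mu> ((*\<^sub>R) (exp a) ` \<Omega>) 1 = 0" using first[of "exp a"] by simp
  moreover have "eigenvalue \<mu> ((*\<^sub>R) l ` \<Omega>) 1 < 0" if "l > exp a" for l
  proof -
    have l: "l > 0" using that exp_gt_zero[of a] by linarith
    then have "a - ln l < 0" using ln_less_cancel_iff[of "exp a" l] that by simp
    then show ?thesis unfolding first[OF l] using pos by (rule mult_pos_neg[rotated])
  qed
  \<comment> \<open>The shift does not depend on the index, so it cancels in differences.\<close>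
  moreover have "\<forall>k\<ge>1. \<forall>l>0. eigenvalue \<mu> ((*\<^sub>R) l ` \<Omega>) (k + 1) - eigenvalue \<mu> ((*\<^sub>R) l ` \<Omega>) k =
      eigenvalue \<mu> \<Omega> (k + 1) - eigenvalue \<mu> \<Omega> k"
    by (simp add: eigenvalue_scale)
  ultimately show ?thesis unfolding a_def[symmetric] using exp_gt_zero[of a] by blast
qed

end
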